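(* Assume that $L$ satisfies $CD(\rho_1,\rho_2,k,d)$ for some $\rho_1\ge0$, $\rho_2>0$, $k\ge0$ and $d<\infty$. Let $u$ be a positive solution of $\partial_tu=Lu$ on $M\times[0,\infty)$ with $\int_M u\,d\mu=1$. For $\rho_2\le\varsigma\le\frac53\rho_2$ and $\tau\ge2+\frac{2k}{\rho_2}$, $$\frac{d}{dt}\mathcal W_\varsigma(u,t)\le-\frac{2t}{d}\int_Mu\,(L\log u)^2\,d\mu+\frac{D}{2t}\left(\frac{2(k+\varsigma)}{\varsigma}-\tau\right)\le0$$ holds for all $t>0$, where $D=d\left(1+\frac{3k}{2\rho_2}\right)^2$.
   Context: Setting. $M$ is a connected, finite dimensional, compact $C^\infty$ manifold with a smooth measure $\mu$, normalized to be a probability measure, and $L$ is a second-order diffusion operator on $M$, locally subelliptic, with $L1=0$, $\int_M fLg\,d\mu=\int_M gLf\,d\mu$ and $\int_M fLf\,d\mu\le 0$ for all $f,g\in C^\infty(M)$. In a neighborhood of every point, $L=-\sum_{i=1}^m X_i^*X_i$ with $X_1,\dots,X_m$ Lipschitz continuous vector fields. The carré du champ is $\Gamma(f,g)=\frac12(L(fg)-fLg-gLf)=\sum_{i=1}^m X_if\,X_ig$ and $\Gamma(f)=\Gamma(f,f)$. $M$ is also endowed with a smooth symmetric bilinear differential form $\Gamma^Z$ satisfying $\Gamma^Z(fg,h)=f\Gamma^Z(g,h)+g\Gamma^Z(f,h)$ for $f,g,h\in C^\infty(M)$; write $\Gamma^Z(f)=\Gamma^Z(f,f)$. Standing assumption: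 $\Gamma(f,\Gamma^Z(f))=\Gamma^Z(f,\Gamma(f))$ for all $f\in C^\infty(M)$. Define $\Gamma_2(f)=\frac12\big(L\Gamma(f)-2\Gamma(f,Lf)\big)$ and $\Gamma_2^Z(f)=\frac12\big(L\Gamma^Z(f)-2\Gamma^Z(f,Lf)\big)$. $L$ satisfies the generalized curvature-dimension inequality $CD(\rho_1,\rho_2,k,d)$ if $$\Gamma_2(f)+\nu\Gamma_2^Z(f)\ge\frac1d(Lf)^2+\Big(\rho_1-\frac k\nu\Big)\Gamma(f)+\rho_2\Gamma^Z(f)$$ for all $f\in C^\infty(M)$ and all $\nu>0$. For functions of $(x,t)$, the operators $L,\Gamma,\Gamma^Z$ act in the $x$ variable. Entropies. With $D=d\left(1+\frac{3k}{2\rho_2}\right)^2$ and a constant $\tau>0$, the function $g(x,t)$ is defined by $u(x,t)=\dfrac{e^{-g(x,t)}}{(4\pi t)^{\tau D/2}}$. Put $N(u,t)=-\int_Mu\log u\,d\mu$, $\widetilde N(u,t)=N(u,t)-\frac{\tau D}{2}(\log(4\pi t)+1)$, $$\mathcal W(u,t)=\int_Mu\left(t\Gamma(g)+g-\tau D\right)d\mu=\frac{d}{dt}\left(t\widetilde N(u,t)\right),$$ and, for a constant $\varsigma>0$, $$\mathcal W_\varsigma(u,t)=\mathcal W(u,t)+\varsigma t^2\int_Mu\,\Gamma^Z(\log u)\,d\mu.$$ *)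

theory Defs
  imports "HOL-Probability.Probability"
begin

section \<open>Smooth functions on open subsets of Euclidean spaces\<close>

primrec Ck_on :: "nat \<Rightarrow> 'a::real_normed_vector set \<Rightarrow> ('a \<Rightarrow> 'b::real_normed_vector) \<Rightarrow> bool" where
  "Ck_on 0 S f \<longleftrightarrow> continuous_on S f"
| "Ck_on (Suc k) S f \<longleftrightarrow>
     (\<forall>x\<in>S. f differentiable (at x)) \<and>
     (\<forall>v. Ck_on k S (\<lambda>x. frechet_derivative f (at x) v))"

definition smooth_on :: "'a::real_normed_vector set \<Rightarrow> ('a \<Rightarrow> 'b::real_normed_vector) \<Rightarrow> bool" where
  "smooth_on S f \<longleftrightarrow> (\<forall>k. Ck_on k S f)"

section \<open>Manifolds\<close>

text \<open>
  The underlying space of the manifold is a type \<open>'m\<close>; the smooth structure is given by an atlas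
  \<open>A\<close>, not necessarily maximal. A chart is a pair \<open>(U, \<phi>)\<close>; the values of \<open>\<phi>\<close> outside \<open>U\<close> are
  irrelevant, and the inverse chart is \<open>inv_into U \<phi>\<close>.
\<close>

type_synonym ('m, 'e) atlas = "('m set \<times> ('m \<Rightarrow> 'e)) set"

definition smooth_atlas ::
  "('m::{t2_space, second_countable_topology}, 'e::euclidean_space) atlas \<Rightarrow> bool" where
  "smooth_atlas A \<longleftrightarrow>
     (\<forall>(U, \<phi>)\<in>A. open U \<and> open (\<phi> ` U) \<and> homeomorphism U (\<phi> ` U) \<phi> (inv_into U \<phi>)) \<and>
     (\<Union>(U, \<phi>)\<in>A. U) = UNIV \<and>
     (\<forall>(U, \<phi>)\<in>A. \<forall>(V, \<psi>)\<in>A. smooth_on (\<phi> ` (U \<inter> V)) (\<psi> \<circ> inv_into U \<phi>))"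

definition in_chart :: "'m set \<Rightarrow> ('m \<Rightarrow> 'e) \<Rightarrow> ('m \<Rightarrow> 'b) \<Rightarrow> 'e \<Rightarrow> 'b" where
  "in_chart U \<phi> f = f \<circ> inv_into U \<phi>"

abbreviation dir_deriv ::
  "'e::real_normed_vector \<Rightarrow> ('e \<Rightarrow> real) \<Rightarrow> 'e \<Rightarrow> real" where
  "dir_deriv v h y \<equiv> frechet_derivative h (at y) v"

definition Cinf :: "('m, 'e::euclidean_space) atlas \<Rightarrow> ('m \<Rightarrow> real) set" where
  "Cinf A = {f. \<forall>(U, \<phi>)\<in>A. smooth_on (\<phi> ` U) (in_chart U \<phi> f)}"

definition Cinf_supp_in ::
  "('m::topological_space, 'e::euclidean_space) atlas \<Rightarrow> 'm set \<Rightarrow> ('m \<Rightarrow> real) set" where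
  "Cinf_supp_in A V = {f \<in> Cinf A. closure {x. f x \<noteq> 0} \<subseteq> V}"

text \<open>A Borel measure with a smooth positive density with respect to Lebesgue measure in each chart.\<close>

definition smooth_measure ::
  "('m::topological_space, 'e::euclidean_space) atlas \<Rightarrow> 'm measure \<Rightarrow> bool" where
  "smooth_measure A \<mu> \<longleftrightarrow> sets \<mu> = sets borel \<and>
     (\<forall>(U, \<phi>)\<in>A. \<exists>w :: 'e \<Rightarrow> real. smooth_on (\<phi> ` U) w \<and> (\<forall>y\<in>\<phi> ` U. 0 < w y) \<and>
        (\<forall>B\<in>sets borel. B \<subseteq> U \<longrightarrow> emeasure \<mu> B = (\<integral>\<^sup>+y\<in>\<phi> ` B. ennreal (w y) \<partial>lborel)))"

section \<open>The operator and its bilinear forms\<close>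

text \<open>
  A linear differential operator of order two with smooth real coefficients and nonnegative
  (possibly degenerate) principal symbol. Operators are only constrained on smooth functions.
\<close>

definition diffusion_operator ::
  "('m, 'e::euclidean_space) atlas \<Rightarrow> (('m \<Rightarrow> real) \<Rightarrow> 'm \<Rightarrow> real) \<Rightarrow> bool" where
  "diffusion_operator A L \<longleftrightarrow>
     (\<forall>(U, \<phi>)\<in>A. \<exists>(a :: 'e \<Rightarrow> 'e \<Rightarrow> 'e \<Rightarrow> real) (b :: 'e \<Rightarrow> 'e \<Rightarrow> real) (c :: 'e \<Rightarrow> real).
        (\<forall>i\<in>Basis. \<forall>j\<in>Basis. smooth_on (\<phi> ` U) (a i j)) \<and>
        (\<forall>i\<in>Basis. smooth_on (\<phi> ` U) (b i)) \<and> smooth_on (\<phi> ` U) c \<and>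
        (\<forall>y\<in>\<phi> ` U. (\<forall>i\<in>Basis. \<forall>j\<in>Basis. a i j y = a j i y) \<and>
           (\<forall>\<xi>. 0 \<le> (\<Sum>i\<in>Basis. \<Sum>j\<in>Basis. a i j y * (\<xi> \<bullet> i) * (\<xi> \<bullet> j)))) \<and>
        (\<forall>f\<in>Cinf A. \<forall>y\<in>\<phi> ` U.
           in_chart U \<phi> (L f) y =
             (\<Sum>i\<in>Basis. \<Sum>j\<in>Basis. a i j y * dir_deriv i (dir_deriv j (in_chart U \<phi> f)) y) +
             (\<Sum>i\<in>Basis. b i y * dir_deriv i (in_chart U \<phi> f) y) +
             c y * in_chart U \<phi> f y))"

definition fourier :: "('e::euclidean_space \<Rightarrow> real) \<Rightarrow> 'e \<Rightarrow> complex" where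
  "fourier h \<xi> = (LINT y|lborel. cis (- (y \<bullet> \<xi>)) * complex_of_real (h y))"

definition sobolev_norm_sq :: "real \<Rightarrow> ('e::euclidean_space \<Rightarrow> real) \<Rightarrow> ennreal" where
  "sobolev_norm_sq s h =
     (\<integral>\<^sup>+\<xi>. ennreal ((1 + (norm \<xi>)\<^sup>2) powr s * (cmod (fourier h \<xi>))\<^sup>2) \<partial>lborel)"

text \<open>
  Local subellipticity in the sense of Fefferman and Phong: near every point, an estimate
  \<open>\<parallel>f\<parallel>\<^sub>\<epsilon>\<^sup>2 \<le> C (|\<langle>Lf, f\<rangle>| + \<parallel>f\<parallel>\<^sup>2)\<close> for test functions, with the Sobolev norm of order
  \<open>\<epsilon>\<close> computed in a chart (the function being extended by zero outside the image of the chart).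
\<close>

definition locally_subelliptic ::
  "('m::topological_space, 'e::euclidean_space) atlas \<Rightarrow> 'm measure \<Rightarrow>
   (('m \<Rightarrow> real) \<Rightarrow> 'm \<Rightarrow> real) \<Rightarrow> bool" where
  "locally_subelliptic A \<mu> L \<longleftrightarrow>
     (\<forall>p. \<exists>(U, \<phi>)\<in>A. \<exists>V \<epsilon> C. open V \<and> p \<in> V \<and> V \<subseteq> U \<and> 0 < \<epsilon> \<and>
        (\<forall>f\<in>Cinf_supp_in A V.
           sobolev_norm_sq \<epsilon> (\<lambda>y. if y \<in> \<phi> ` U then in_chart U \<phi> f y else 0)
             \<le> ennreal (C * (\<bar>LINT x|\<mu>. f x * L f x\<bar> + (LINT x|\<mu>. (f x)\<^sup>2)))))"

text \<open>
  \<open>L = - \<Sum>\<^sub>i X\<^sub>i\<^sup>* X\<^sub>i\<close> near every point. The fields \<open>X\<^sub>i\<close> are only Lipschitz, so the formal adjoint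
  \<open>X\<^sub>i\<^sup>*\<close> in \<open>L\<^sup>2(\<mu>)\<close> is understood by pairing with test functions. The fields are given by their
  coordinates in a chart.
\<close>

definition local_sum_of_squares ::
  "('m::topological_space, 'e::euclidean_space) atlas \<Rightarrow> 'm measure \<Rightarrow>
   (('m \<Rightarrow> real) \<Rightarrow> 'm \<Rightarrow> real) \<Rightarrow> bool" where
  "local_sum_of_squares A \<mu> L \<longleftrightarrow>
     (\<forall>p. \<exists>(U, \<phi>)\<in>A. \<exists>V (m::nat) (X :: nat \<Rightarrow> 'e \<Rightarrow> 'e). open V \<and> p \<in> V \<and> V \<subseteq> U \<and>
        (\<forall>i<m. \<exists>K. K-lipschitz_on (\<phi> ` V) (X i)) \<and>
        (let D = (\<lambda>i h x. dir_deriv (X i (\<phi> x)) (in_chart U \<phi> h) (\<phi> x)) in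
         \<forall>f\<in>Cinf A. \<forall>h\<in>Cinf_supp_in A V.
           (LINT x|\<mu>. h x * L f x) = - (\<Sum>i<m. (LINT x:V|\<mu>. D i h x * D i f x))))"

definition carre_du_champ ::
  "(('m \<Rightarrow> real) \<Rightarrow> 'm \<Rightarrow> real) \<Rightarrow> ('m \<Rightarrow> real) \<Rightarrow> ('m \<Rightarrow> real) \<Rightarrow> 'm \<Rightarrow> real" where
  "carre_du_champ L f h x = (L (\<lambda>y. f y * h y) x - f x * L h x - h x * L f x) / 2"

definition smooth_bilinear_form ::
  "('m, 'e::euclidean_space) atlas \<Rightarrow>
   (('m \<Rightarrow> real) \<Rightarrow> ('m \<Rightarrow> real) \<Rightarrow> 'm \<Rightarrow> real) \<Rightarrow> bool" where
  "smooth_bilinear_form A G \<longleftrightarrow>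
     (\<forall>(U, \<phi>)\<in>A. \<exists>q :: 'e \<Rightarrow> 'e \<Rightarrow> 'e \<Rightarrow> real.
        (\<forall>i\<in>Basis. \<forall>j\<in>Basis. smooth_on (\<phi> ` U) (q i j)) \<and>
        (\<forall>f\<in>Cinf A. \<forall>h\<in>Cinf A. \<forall>y\<in>\<phi> ` U.
           in_chart U \<phi> (G f h) y =
             (\<Sum>i\<in>Basis. \<Sum>j\<in>Basis. q i j y *
                dir_deriv i (in_chart U \<phi> f) y * dir_deriv j (in_chart U \<phi> h) y)))"

text \<open>
  With \<open>G = carre_du_champ L\<close> this is \<open>\<Gamma>\<^sub>2\<close>, and with \<open>G = \<Gamma>\<^sup>Z\<close> it is \<open>\<Gamma>\<^sub>2\<^sup>Z\<close>.
\<close>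

definition iterated_form ::
  "(('m \<Rightarrow> real) \<Rightarrow> 'm \<Rightarrow> real) \<Rightarrow> (('m \<Rightarrow> real) \<Rightarrow> ('m \<Rightarrow> real) \<Rightarrow> 'm \<Rightarrow> real) \<Rightarrow>
   ('m \<Rightarrow> real) \<Rightarrow> 'm \<Rightarrow> real" where
  "iterated_form L G f x = (L (G f f) x - 2 * G f (L f) x) / 2"

definition gen_CD ::
  "('m, 'e::euclidean_space) atlas \<Rightarrow> (('m \<Rightarrow> real) \<Rightarrow> 'm \<Rightarrow> real) \<Rightarrow>
   (('m \<Rightarrow> real) \<Rightarrow> ('m \<Rightarrow> real) \<Rightarrow> 'm \<Rightarrow> real) \<Rightarrow>
   real \<Rightarrow> real \<Rightarrow> real \<Rightarrow> real \<Rightarrow> bool" where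
  "gen_CD A L \<Gamma>Z \<rho>1 \<rho>2 k d \<longleftrightarrow>
     (\<forall>f\<in>Cinf A. \<forall>\<nu>>0. \<forall>x.
        iterated_form L (carre_du_champ L) f x + \<nu> * iterated_form L \<Gamma>Z f x \<ge>
          1 / d * (L f x)\<^sup>2 + (\<rho>1 - k / \<nu>) * carre_du_champ L f f x + \<rho>2 * \<Gamma>Z f f x)"

section \<open>Heat equation and entropies\<close>

text \<open>
  Classical solutions: continuous up to time \<open>0\<close>, and jointly smooth with the equation holding
  at positive times.
\<close>

definition positive_heat_solution ::
  "('m::topological_space, 'e::euclidean_space) atlas \<Rightarrow> (('m \<Rightarrow> real) \<Rightarrow> 'm \<Rightarrow> real) \<Rightarrow>
   ('m \<Rightarrow> real \<Rightarrow> real) \<Rightarrow> bool" where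
  "positive_heat_solution A L u \<longleftrightarrow>
     continuous_on (UNIV \<times> {0..}) (\<lambda>(x, t). u x t) \<and>
     (\<forall>x. \<forall>t\<ge>0. 0 < u x t) \<and>
     (\<forall>(U, \<phi>)\<in>A. smooth_on (\<phi> ` U \<times> {0<..}) (\<lambda>(y, t). in_chart U \<phi> (\<lambda>x. u x t) y)) \<and>
     (\<forall>x. \<forall>t>0. ((\<lambda>s. u x s) has_real_derivative L (\<lambda>y. u y t) x) (at t))"

text \<open>
  The entropies at time \<open>t\<close> are functionals of the time slice \<open>v = u(\<cdot>, t)\<close>, and
  \<open>potential \<alpha> t v\<close> is the function \<open>g(\<cdot>, t)\<close>, where \<open>\<alpha> = \<tau> D\<close>.
\<close>

definition potential :: "real \<Rightarrow> real \<Rightarrow> ('m \<Rightarrow> real) \<Rightarrow> 'm \<Rightarrow> real" where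
  "potential \<alpha> t v x = - ln ((4 * pi * t) powr (\<alpha> / 2) * v x)"

lemma potential_iff:
  assumes "0 < t" and "0 < v x"
  shows "v x = exp (- y) / (4 * pi * t) powr (\<alpha> / 2) \<longleftrightarrow> y = potential \<alpha> t v x"
proof -
  have p: "0 < (4 * pi * t) powr (\<alpha> / 2)" (is "0 < ?p") using assms by simp
  have "v x = exp (- y) / ?p \<longleftrightarrow> ?p * v x = exp (- y)"
    using p by (auto simp: field_simps)
  also have "\<dots> \<longleftrightarrow> ln (?p * v x) = - y"
    using p assms by (metis exp_ln ln_exp mult_pos_pos)
  also have "\<dots> \<longleftrightarrow> y = potential \<alpha> t v x"
    unfolding potential_def by auto
  finally show ?thesis .
qed

definition W_entropy ::
  "'m measure \<Rightarrow> (('m \<Rightarrow> real) \<Rightarrow> 'm \<Rightarrow> real) \<Rightarrow> real \<Rightarrow> ('m \<Rightarrow> real) \<Rightarrow> real \<Rightarrow> real" where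
  "W_entropy \<mu> L \<alpha> v t =
     (let g = potential \<alpha> t v in
      LINT x|\<mu>. v x * (t * carre_du_champ L g g x + g x - \<alpha>))"

definition W_entropy_Z ::
  "'m measure \<Rightarrow> (('m \<Rightarrow> real) \<Rightarrow> 'm \<Rightarrow> real) \<Rightarrow>
   (('m \<Rightarrow> real) \<Rightarrow> ('m \<Rightarrow> real) \<Rightarrow> 'm \<Rightarrow> real) \<Rightarrow> real \<Rightarrow> real \<Rightarrow>
   ('m \<Rightarrow> real) \<Rightarrow> real \<Rightarrow> real" where
  "W_entropy_Z \<mu> L \<Gamma>Z \<sigma> \<alpha> v t =
     W_entropy \<mu> L \<alpha> v t +
     \<sigma> * t\<^sup>2 * (LINT x|\<mu>. v x * \<Gamma>Z (\<lambda>y. ln (v y)) (\<lambda>y. ln (v y)) x)"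

end

theory Submission
  imports Defs
begin

text \<open>
Write \<open>f = ln u\<close>, \<open>A(t) = \<integral> u \<Gamma>(f)\<close> and \<open>B(t) = \<integral> u \<Gamma>\<^sup>Z(f)\<close>. Integrals of the form \<open>\<integral> L h\<close> vanish, so
differentiating under the integral gives \<open>(\<integral> u f)' = - A\<close>, \<open>A' = - 2 \<integral> u \<Gamma>\<^sub>2(f)\<close> and
\<open>B' = - 2 \<integral> u \<Gamma>\<^sub>2\<^sup>Z(f)\<close>; the last formula is where \<open>\<Gamma>(f, \<Gamma>\<^sup>Z(f)) = \<Gamma>\<^sup>Z(f, \<Gamma>(f))\<close> enters
(\<open>form_energy_derivative\<close>). With \<open>\<alpha> = \<tau> D\<close> the derivative of the entropy is therefore
\<open>2 A + t A' - \<alpha> / (2 t) + 2 \<sigma> t B + \<sigma> t\<^sup>2 B'\<close>, and the curvature-dimension inequality with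
\<open>\<nu> = \<sigma> t\<close> bounds it by
\<open>- (2 t / d) \<integral> u (L f)\<^sup>2 + 2 (1 + k / \<sigma>) A + 2 t (\<sigma> - \<rho>\<^sub>2) B - \<alpha> / (2 t)\<close>.

It remains to prove an integrated Li-Yau estimate \<open>A + \<kappa> t B \<le> D / (2 t)\<close> with
\<open>\<kappa> = 2 \<rho>\<^sub>2 / 3\<close>; the upper bound on \<open>\<sigma>\<close> says exactly that \<open>\<sigma> - \<rho>\<^sub>2 \<le> \<kappa>\<close>.
The function \<open>s\<^sup>2 A + \<kappa> s\<^sup>3 B\<close> has derivative at most \<open>D / 2\<close>, by the curvature-dimension inequality with \<open>\<nu> = \<kappa> s\<close> and by \<open>\<integral> u (L f)\<^sup>2 \<ge> A\<^sup>2\<close> (Cauchy-Schwarz, since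
\<open>\<integral> u L f = - A\<close> and \<open>\<integral> u = 1\<close>). The value of \<open>\<kappa>\<close> makes the terms in \<open>B\<close> cancel, and
completing the square in \<open>A\<close> produces \<open>D\<close>. The solution is only continuous at time \<open>0\<close>, so the
estimate is first proved with \<open>s - e\<close> in place of \<open>s\<close>, starting from a time \<open>e > 0\<close>, and then
\<open>e\<close> tends to \<open>0\<close> (\<open>fisher_estimate\<close>).

Comparing the coefficient \<open>\<sigma> - \<rho>\<^sub>2\<close> with \<open>\<kappa>\<close> needs the sign of \<open>\<Gamma>\<^sup>Z\<close>, which has to be extracted from
the curvature-dimension inequality. Letting \<open>\<nu>\<close> tend to infinity gives \<open>\<Gamma>\<^sub>2\<^sup>Z \<ge> 0\<close>. For a product of
two functions vanishing at a point, \<open>\<Gamma>\<^sub>2\<^sup>Z\<close> only sees products of first order terms, and this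
yields \<open>\<Gamma>\<^sup>Z \<ge> 0\<close> wherever \<open>\<Gamma>\<close> does not vanish, hence on the closure of that set. On an open
set where \<open>\<Gamma>\<close> vanishes identically, the symmetry of \<open>L\<close> forces \<open>L = 0\<close>
(\<open>L_zero_where_degenerate\<close>). On this degenerate set \<open>\<Gamma>\<^sup>Z \<le> 0\<close> and \<open>u\<close> is stationary, so the set
contributes a nonpositive constant to \<open>B\<close>. The argument above is run with this constant removed
from \<open>B\<close> (\<open>fisher_differential_inequality\<close>), and putting it back only improves the estimate.

The analytic part of the text supplies the regularity behind these manipulations: in charts,
\<open>L\<close> and \<open>\<Gamma>\<^sup>Z\<close> are expressions in directional derivatives with smooth coefficients, so they preserve joint
smoothness in space and time, and the forms can be differentiated in time by the product rule.
\<close>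

section \<open>Calculus of iterated directional derivatives\<close>

lemma Ck_on_subset: "Ck_on k S f \<Longrightarrow> T \<subseteq> S \<Longrightarrow> Ck_on k T f"
  by (induction k arbitrary: f) (auto intro: continuous_on_subset)

text \<open>
Since \<open>Ck_on\<close> is defined by iterating \<^const>\<open>frechet_derivative\<close>, which is a choice at points where a
function is not differentiable, closure properties are proved on open sets, where a function may be
replaced by any other formula for it before it is differentiated.
\<close>

lemma Ck_on_cong:
  assumes "open S" "\<And>x. x \<in> S \<Longrightarrow> f x = g x" "Ck_on k S f"
  shows "Ck_on k S g"
  using assms(2,3)
proof (induction k arbitrary: f g)
  case 0
  then show ?case unfolding Ck_on.simps by (blast intro: continuous_on_eq)
next
  case (Suc k)
  have f: "(f has_derivative frechet_derivative f (at x)) (at x)" if "x \<in> S" for x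
    using Suc.prems(2) that by (intro frechet_derivative_works[THEN iffD1]) simp
  have g: "(g has_derivative frechet_derivative f (at x)) (at x)" if x: "x \<in> S" for x
    by (rule has_derivative_transform_within_open[of f _ x UNIV S g, OF f[OF x] assms(1) x Suc.prems(1)])
  have "Ck_on k S (\<lambda>x. frechet_derivative g (at x) v)" for v
  proof (rule Suc.IH)
    show "Ck_on k S (\<lambda>x. frechet_derivative f (at x) v)" using Suc.prems(2) by simp
    show "frechet_derivative f (at x) v = frechet_derivative g (at x) v" if "x \<in> S" for x
      using frechet_derivative_at[OF g[OF that]] by simp
  qed
  then show ?case
    using g by (auto simp: differentiable_def)
qed

lemma Ck_on_SucI:
  assumes "open S" "\<And>x. x \<in> S \<Longrightarrow> (f has_derivative f' x) (at x)"
    and "\<And>v. Ck_on k S (\<lambda>x. f' x v)"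
  shows "Ck_on (Suc k) S f"
proof -
  have "Ck_on k S (\<lambda>x. frechet_derivative f (at x) v)" for v
    by (rule Ck_on_cong[OF assms(1) _ assms(3)[of v]])
       (use assms(2) frechet_derivative_at in fastforce)
  then show ?thesis using assms(2) by (auto simp: differentiable_def)
qed

lemma Ck_on_Suc_imp: "Ck_on (Suc k) S f \<Longrightarrow> Ck_on k S f"
proof (induction k arbitrary: f)
  case 0
  then show ?case
    by (auto intro!: continuous_at_imp_continuous_on differentiable_imp_continuous_within)
next
  case (Suc k)
  then show ?case by (metis Ck_on.simps(2))
qed

lemma Ck_on_has_derivative:
  "Ck_on (Suc k) S f \<Longrightarrow> x \<in> S \<Longrightarrow> (f has_derivative frechet_derivative f (at x)) (at x)"
  using frechet_derivative_works by auto

lemma Ck_on_const: "Ck_on k S (\<lambda>_. c)"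
  by (induction k arbitrary: c) (auto simp: frechet_derivative_const)

lemma Ck_on_locally:
  assumes "\<And>x. x \<in> S \<Longrightarrow> \<exists>T. open T \<and> x \<in> T \<and> Ck_on k T f"
  shows "Ck_on k S f"
  using assms
proof (induction k arbitrary: f)
  case 0
  have "isCont f x" if "x \<in> S" for x
    using 0[OF that] by (auto simp: continuous_on_eq_continuous_at)
  then show ?case by (simp add: continuous_at_imp_continuous_on)
next
  case (Suc k)
  have "f differentiable (at x)" if "x \<in> S" for x
    using Suc.prems[OF that] by auto
  moreover have "Ck_on k S (\<lambda>x. frechet_derivative f (at x) v)" for v
    by (rule Suc.IH) (use Suc.prems in \<open>fastforce\<close>)
  ultimately show ?case by simp
qed

lemma Ck_on_add:
  assumes "open S" "Ck_on k S f" "Ck_on k S g"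
  shows "Ck_on k S (\<lambda>x. f x + g x)"
  using assms(2,3)
proof (induction k arbitrary: f g)
  case 0
  then show ?case by (auto intro!: continuous_intros)
next
  case (Suc k)
  show ?case
    by (rule Ck_on_SucI[OF assms(1), where f' = "\<lambda>x v. frechet_derivative f (at x) v + frechet_derivative g (at x) v"])
       (use Suc in \<open>auto intro!: has_derivative_add simp: frechet_derivative_works[symmetric]\<close>)
qed

lemma Ck_on_sum:
  assumes "open S" "\<And>i. i \<in> I \<Longrightarrow> Ck_on k S (f i)"
  shows "Ck_on k S (\<lambda>x. \<Sum>i\<in>I. f i x)"
  using assms(2)
  by (induction I rule: infinite_finite_induct) (auto intro!: Ck_on_const Ck_on_add assms(1))

lemma Ck_on_mult:
  fixes f g :: "'a::real_normed_vector \<Rightarrow> real"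
  assumes "open S" "Ck_on k S f" "Ck_on k S g"
  shows "Ck_on k S (\<lambda>x. f x * g x)"
  using assms(2,3)
proof (induction k arbitrary: f g)
  case 0
  then show ?case by (auto intro!: continuous_intros)
next
  case (Suc k)
  show ?case
  proof (rule Ck_on_SucI[OF assms(1), where f' = "\<lambda>x v. f x * frechet_derivative g (at x) v + frechet_derivative f (at x) v * g x"])
    show "((\<lambda>x. f x * g x) has_derivative (\<lambda>v. f x * frechet_derivative g (at x) v + frechet_derivative f (at x) v * g x)) (at x)"
      if "x \<in> S" for x
      by (intro has_derivative_mult Ck_on_has_derivative[OF Suc.prems(1) that] Ck_on_has_derivative[OF Suc.prems(2) that])
    show "Ck_on k S (\<lambda>x. f x * frechet_derivative g (at x) v + frechet_derivative f (at x) v * g x)" for v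
      by (intro Ck_on_add[OF assms(1)] Suc.IH Suc.prems[THEN Ck_on_Suc_imp]) (use Suc.prems in auto)
  qed
qed

lemma Ck_on_inverse:
  fixes f :: "'a::real_normed_vector \<Rightarrow> real"
  assumes "open S" "Ck_on k S f" "\<And>x. x \<in> S \<Longrightarrow> f x \<noteq> 0"
  shows "Ck_on k S (\<lambda>x. inverse (f x))"
  using assms(2)
proof (induction k)
  case 0
  then show ?case using assms(3) by (auto intro!: continuous_intros)
next
  case (Suc k)
  show ?case
  proof (rule Ck_on_SucI[OF assms(1), where f' = "\<lambda>x v. (-1) * (inverse (f x) * frechet_derivative f (at x) v * inverse (f x))"])
    show "((\<lambda>x. inverse (f x)) has_derivative (\<lambda>v. (-1) * (inverse (f x) * frechet_derivative f (at x) v * inverse (f x)))) (at x)"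
      if "x \<in> S" for x
      using Deriv.has_derivative_inverse[OF assms(3)[OF that] Ck_on_has_derivative[OF Suc.prems that]] by simp
    show "Ck_on k S (\<lambda>x. (-1) * (inverse (f x) * frechet_derivative f (at x) v * inverse (f x)))" for v
      by (intro Ck_on_mult[OF assms(1)] Ck_on_const Suc.IH Suc.prems[THEN Ck_on_Suc_imp])
         (use Suc.prems in auto)
  qed
qed

lemma Ck_on_ln:
  fixes f :: "'a::real_normed_vector \<Rightarrow> real"
  assumes "open S" "Ck_on k S f" "\<And>x. x \<in> S \<Longrightarrow> f x > 0"
  shows "Ck_on k S (\<lambda>x. ln (f x))"
proof (cases k)
  case 0
  then show ?thesis using assms by (force intro!: continuous_intros)
next
  case (Suc j)
  have f: "Ck_on (Suc j) S f" using assms Suc by simp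
  have "Ck_on (Suc j) S (\<lambda>x. ln (f x))"
  proof (rule Ck_on_SucI[OF assms(1), where f' = "\<lambda>x v. frechet_derivative f (at x) v * inverse (f x)"])
    show "((\<lambda>x. ln (f x)) has_derivative (\<lambda>v. frechet_derivative f (at x) v * inverse (f x))) (at x)"
      if "x \<in> S" for x
      using assms(3)[OF that] Ck_on_has_derivative[OF f that]
      by (auto intro!: derivative_eq_intros simp: divide_inverse)
    show "Ck_on j S (\<lambda>x. frechet_derivative f (at x) v * inverse (f x))" for v
      using f Ck_on_Suc_imp[OF f] assms(3)
      by (intro Ck_on_mult[OF assms(1)] Ck_on_inverse[OF assms(1)]) force+
  qed
  then show ?thesis using Suc by simp
qed

lemma Ck_on_inner_left:
  fixes g :: "'a::real_normed_vector \<Rightarrow> 'b::real_inner"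
  assumes "open S" "Ck_on k S g"
  shows "Ck_on k S (\<lambda>x. g x \<bullet> b)"
  using assms(2)
proof (induction k arbitrary: g)
  case 0
  then show ?case by (auto intro!: continuous_intros)
next
  case (Suc k)
  show ?case
    by (rule Ck_on_SucI[OF assms(1), where f' = "\<lambda>x v. frechet_derivative g (at x) v \<bullet> b"])
       (use Suc in \<open>auto intro!: has_derivative_inner_left simp: frechet_derivative_works[symmetric]\<close>)
qed

text \<open>
The derivative of a composition is expanded in a basis, because only the directional derivatives
of the outer function in fixed directions are known to be of class \<open>C\<^sup>k\<close>.
\<close>

lemma Ck_on_compose:
  fixes f :: "'b::euclidean_space \<Rightarrow> real" and g :: "'a::real_normed_vector \<Rightarrow> 'b"
  assumes "open S" "open T" "Ck_on k T f" "Ck_on k S g" "g ` S \<subseteq> T"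
  shows "Ck_on k S (\<lambda>x. f (g x))"
  using assms(3,4)
proof (induction k arbitrary: f)
  case 0
  then show ?case using assms(5) continuous_on_compose2[of T f S g] by simp
next
  case (Suc k)
  show ?case
  proof (rule Ck_on_SucI[OF assms(1), where f' = "\<lambda>x v. \<Sum>b\<in>Basis. (frechet_derivative g (at x) v \<bullet> b) * frechet_derivative f (at (g x)) b"])
    fix x assume x: "x \<in> S"
    have f: "(f has_derivative frechet_derivative f (at (g x))) (at (g x))"
      using assms(5) x by (intro Ck_on_has_derivative[OF Suc.prems(1)]) auto
    have D: "((\<lambda>x. f (g x)) has_derivative (\<lambda>v. frechet_derivative f (at (g x)) (frechet_derivative g (at x) v))) (at x)"
      by (rule has_derivative_compose[OF Ck_on_has_derivative[OF Suc.prems(2) x] f])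
    have rep: "frechet_derivative f (at (g x)) w = (\<Sum>b\<in>Basis. (w \<bullet> b) * frechet_derivative f (at (g x)) b)" for w
    proof -
      have l: "linear (frechet_derivative f (at (g x)))" by (rule has_derivative_linear[OF f])
      have "(\<Sum>b\<in>Basis. (w \<bullet> b) * frechet_derivative f (at (g x)) b)
          = frechet_derivative f (at (g x)) (\<Sum>b\<in>Basis. (w \<bullet> b) *\<^sub>R b)"
        unfolding linear_sum[OF l] linear_scale[OF l] by simp
      then show ?thesis by (simp only: euclidean_representation)
    qed
    show "((\<lambda>x. f (g x)) has_derivative (\<lambda>v. \<Sum>b\<in>Basis. (frechet_derivative g (at x) v \<bullet> b) * frechet_derivative f (at (g x)) b)) (at x)"
      by (rule has_derivative_eq_rhs[OF D]) (rule ext, rule rep)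
  next
    fix v
    show "Ck_on k S (\<lambda>x. \<Sum>b\<in>Basis. (frechet_derivative g (at x) v \<bullet> b) * frechet_derivative f (at (g x)) b)"
      by (intro Ck_on_sum Ck_on_mult Ck_on_inner_left Suc.IH assms(1) Suc.prems(2)[THEN Ck_on_Suc_imp])
         (use Suc.prems in auto)
  qed
qed

lemma frechet_derivative_slice:
  fixes W :: "'a::real_normed_vector \<times> 'b::real_normed_vector \<Rightarrow> real"
  assumes "W differentiable (at (y, t))"
  shows "((\<lambda>y. W (y, t)) has_derivative (\<lambda>v. frechet_derivative W (at (y, t)) (v, 0))) (at y)"
    and "((\<lambda>t. W (y, t)) has_derivative (\<lambda>s. frechet_derivative W (at (y, t)) (0, s))) (at t)"
proof -
  have W: "(W has_derivative frechet_derivative W (at (y, t))) (at (y, t))"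
    using assms frechet_derivative_works by blast
  show "((\<lambda>y. W (y, t)) has_derivative (\<lambda>v. frechet_derivative W (at (y, t)) (v, 0))) (at y)"
    by (rule has_derivative_compose[of "\<lambda>y. (y,t)" "\<lambda>v. (v, 0)", OF _ W]) (auto intro!: derivative_eq_intros)
  show "((\<lambda>t. W (y, t)) has_derivative (\<lambda>s. frechet_derivative W (at (y, t)) (0, s))) (at t)"
    by (rule has_derivative_compose[of "\<lambda>t. (y,t)" "\<lambda>v. (0, v)", OF _ W]) (auto intro!: derivative_eq_intros)
qed

lemma Ck_on_slice:
  fixes W :: "'a::real_normed_vector \<times> 'b::real_normed_vector \<Rightarrow> real"
  assumes "open S" "t \<in> T" "Ck_on k (S \<times> T) W"
  shows "Ck_on k S (\<lambda>y. W (y, t))"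
  using assms(3)
proof (induction k arbitrary: W)
  case 0
  have "continuous_on S (\<lambda>y. (y, t))" by (intro continuous_intros)
  then show ?case using 0 assms(2) continuous_on_compose2[of "S \<times> T" W S "\<lambda>y. (y, t)"] by auto
next
  case (Suc k)
  show ?case
  proof (rule Ck_on_SucI[OF assms(1), where f' = "\<lambda>y v. frechet_derivative W (at (y, t)) (v, 0)"])
    show "((\<lambda>y. W (y, t)) has_derivative (\<lambda>v. frechet_derivative W (at (y, t)) (v, 0))) (at y)"
      if "y \<in> S" for y
      using Suc.prems assms(2) that by (intro frechet_derivative_slice) simp
    show "Ck_on k S (\<lambda>y. frechet_derivative W (at (y, t)) (v, 0))" for v
      by (rule Suc.IH) (use Suc.prems in simp)
  qed
qed

lemma Ck_on_fst:
  fixes a :: "'a::real_normed_vector \<Rightarrow> real"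
  assumes "open S" "open T" "Ck_on k S a"
  shows "Ck_on k (S \<times> T) (\<lambda>p. a (fst p))"
  using assms(3)
proof (induction k arbitrary: a)
  case 0
  have "continuous_on (S \<times> T) fst" by (intro continuous_intros)
  then show ?case using 0 continuous_on_compose2[of S a "S \<times> T" fst] by auto
next
  case (Suc k)
  show ?case
  proof (rule Ck_on_SucI[where f' = "\<lambda>p v. frechet_derivative a (at (fst p)) (fst v)"])
    show "open (S \<times> T)" using assms by (simp add: open_Times)
    show "((\<lambda>p. a (fst p)) has_derivative (\<lambda>v. frechet_derivative a (at (fst p)) (fst v))) (at p)"
      if "p \<in> S \<times> T" for p :: "'a \<times> 'b"
    proof (rule has_derivative_compose[where f = fst and f' = fst])
      show "(fst has_derivative fst) (at p)" by (intro derivative_intros)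
      show "(a has_derivative frechet_derivative a (at (fst p))) (at (fst p))"
        using that by (intro Ck_on_has_derivative[OF Suc.prems]) auto
    qed
    show "Ck_on k (S \<times> T) (\<lambda>p. frechet_derivative a (at (fst p)) (fst v))" for v :: "'a \<times> 'b"
      by (rule Suc.IH) (use Suc.prems in simp)
  qed
qed

section \<open>Symmetry of second derivatives\<close>

lemma has_real_derivative_along_line:
  assumes "(f has_derivative F) (at (c + r *\<^sub>R v))"
  shows "((\<lambda>r. f (c + r *\<^sub>R v)) has_real_derivative F v) (at r)"
proof -
  have l: "((\<lambda>r. c + r *\<^sub>R v) has_derivative (\<lambda>k. k *\<^sub>R v)) (at r)"
    by (auto intro!: derivative_eq_intros)
  have "((\<lambda>r. f (c + r *\<^sub>R v)) has_derivative (\<lambda>k. F (k *\<^sub>R v))) (at r)"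
    by (rule has_derivative_compose[OF l assms])
  moreover have "(\<lambda>k. F (k *\<^sub>R v)) = (*) (F v)"
    using linear_scale[OF has_derivative_linear[OF assms]] by (auto simp: fun_eq_iff)
  ultimately show ?thesis by (simp add: has_field_derivative_def)
qed

text \<open>
Two applications of the mean value theorem turn the second difference into \<open>s\<^sup>2\<close> times the mixed
derivative at a nearby point. The second difference is symmetric in \<open>v\<close> and \<open>w\<close>, which is why mixed
derivatives commute.
\<close>

lemma second_difference_quotient_tendsto:
  fixes f :: "'a::real_normed_vector \<Rightarrow> real"
  assumes S: "open S" "x \<in> S" and f: "Ck_on (Suc (Suc 0)) S f"
  shows "((\<lambda>s. (f (x + s *\<^sub>R v + s *\<^sub>R w) - f (x + s *\<^sub>R v) - f (x + s *\<^sub>R w) + f x) / s\<^sup>2)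
           \<longlongrightarrow> dir_deriv w (\<lambda>y. dir_deriv v f y) x) (at_right 0)"
proof (rule tendstoI)
  define h where "h = (\<lambda>y. dir_deriv w (\<lambda>y. dir_deriv v f y) y)"
  fix e :: real assume e: "e > 0"
  have fv: "Ck_on (Suc 0) S (\<lambda>y. dir_deriv v f y)"
    using f by simp
  have "continuous_on S h"
    using fv unfolding h_def by simp
  then have "isCont h x" using S by (simp add: continuous_on_eq_continuous_at)
  then obtain d1 where d1: "d1 > 0" "\<And>y. dist y x < d1 \<Longrightarrow> dist (h y) (h x) < e"
    using e by (auto simp: continuous_at_eps_delta)
  obtain d2 where d2: "d2 > 0" "ball x d2 \<subseteq> S" using S open_contains_ball by blast
  \<comment> \<open>the parallelogram of side \<open>s < d\<close> at \<open>x\<close> lies within distance \<open>min d1 d2\<close>\<close>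
  define d where "d = min d1 d2 / (norm v + norm w + 1)"
  have pos: "norm v + norm w + 1 > 0" by (simp add: add_nonneg_pos)
  have d: "d > 0" using d1 d2 pos by (simp add: d_def)
  have "dist ((f (x + s *\<^sub>R v + s *\<^sub>R w) - f (x + s *\<^sub>R v) - f (x + s *\<^sub>R w) + f x) / s\<^sup>2) (h x) < e"
    if s: "0 < s" "s < d" for s
  proof -
    have near: "dist (x + a *\<^sub>R v + b *\<^sub>R w) x < min d1 d2"
      if "0 \<le> a" "a \<le> s" "0 \<le> b" "b \<le> s" for a b
    proof -
      have "dist (x + a *\<^sub>R v + b *\<^sub>R w) x = norm (a *\<^sub>R v + b *\<^sub>R w)"
        by (simp add: dist_norm add.assoc)
      also have "\<dots> \<le> a * norm v + b * norm w"
        using norm_triangle_ineq[of "a *\<^sub>R v" "b *\<^sub>R w"] that by simp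
      also have "\<dots> \<le> s * norm v + s * norm w"
        using that by (intro add_mono mult_right_mono) auto
      also have "\<dots> \<le> s * (norm v + norm w + 1)" using s by (simp add: algebra_simps)
      also have "\<dots> < d * (norm v + norm w + 1)" using s pos by simp
      also have "\<dots> = min d1 d2" using pos by (simp add: d_def)
      finally show ?thesis .
    qed
    have inS: "x + a *\<^sub>R v + b *\<^sub>R w \<in> S" if "0 \<le> a" "a \<le> s" "0 \<le> b" "b \<le> s" for a b
      using near[OF that] d2(2) by (auto simp: dist_commute)
    have D1: "((\<lambda>r. f (x + r *\<^sub>R v + b *\<^sub>R w)) has_real_derivative dir_deriv v f (x + r *\<^sub>R v + b *\<^sub>R w)) (at r)"
      if "0 \<le> r" "r \<le> s" "0 \<le> b" "b \<le> s" for r b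
      using has_real_derivative_along_line[of f _ "x + b *\<^sub>R w" r v] Ck_on_has_derivative[OF f inS[OF that]]
      by (simp add: add_ac)
    have D2: "((\<lambda>r. dir_deriv v f (x + a *\<^sub>R v + r *\<^sub>R w)) has_real_derivative h (x + a *\<^sub>R v + r *\<^sub>R w)) (at r)"
      if "0 \<le> r" "r \<le> s" "0 \<le> a" "a \<le> s" for r a
      unfolding h_def
      by (rule has_real_derivative_along_line) (rule Ck_on_has_derivative[OF fv inS], use that in auto)
    have "\<exists>\<xi>>0. \<xi> < s \<and> (f (x + s *\<^sub>R v + s *\<^sub>R w) - f (x + s *\<^sub>R v + 0 *\<^sub>R w)) - (f (x + 0 *\<^sub>R v + s *\<^sub>R w) - f (x + 0 *\<^sub>R v + 0 *\<^sub>R w))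
      = (s - 0) * (dir_deriv v f (x + \<xi> *\<^sub>R v + s *\<^sub>R w) - dir_deriv v f (x + \<xi> *\<^sub>R v + 0 *\<^sub>R w))"
      by (rule MVT2[OF s(1), of "\<lambda>r. f (x + r *\<^sub>R v + s *\<^sub>R w) - f (x + r *\<^sub>R v + 0 *\<^sub>R w)"])
         (intro DERIV_diff D1, use s in auto)
    then obtain \<xi> where \<xi>: "0 < \<xi>" "\<xi> < s" and
      1: "f (x + s *\<^sub>R v + s *\<^sub>R w) - f (x + s *\<^sub>R v) - f (x + s *\<^sub>R w) + f x
      = s * (dir_deriv v f (x + \<xi> *\<^sub>R v + s *\<^sub>R w) - dir_deriv v f (x + \<xi> *\<^sub>R v + 0 *\<^sub>R w))"
      by (auto simp: algebra_simps)
    have "\<exists>\<eta>>0. \<eta> < s \<and> dir_deriv v f (x + \<xi> *\<^sub>R v + s *\<^sub>R w) - dir_deriv v f (x + \<xi> *\<^sub>R v + 0 *\<^sub>R w)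
      = (s - 0) * h (x + \<xi> *\<^sub>R v + \<eta> *\<^sub>R w)"
      by (rule MVT2[OF s(1)]) (use \<xi> in \<open>auto intro!: D2\<close>)
    then obtain \<eta> where \<eta>: "0 < \<eta>" "\<eta> < s" and
      2: "dir_deriv v f (x + \<xi> *\<^sub>R v + s *\<^sub>R w) - dir_deriv v f (x + \<xi> *\<^sub>R v + 0 *\<^sub>R w)
      = s * h (x + \<xi> *\<^sub>R v + \<eta> *\<^sub>R w)" by auto
    have "(f (x + s *\<^sub>R v + s *\<^sub>R w) - f (x + s *\<^sub>R v) - f (x + s *\<^sub>R w) + f x) / s\<^sup>2 = h (x + \<xi> *\<^sub>R v + \<eta> *\<^sub>R w)"
      unfolding 1 2 using s by (simp add: power2_eq_square)
    then show ?thesis using d1(2) near[of \<xi> \<eta>] \<xi> \<eta> by simp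
  qed
  then show "\<forall>\<^sub>F s in at_right 0. dist ((f (x + s *\<^sub>R v + s *\<^sub>R w) - f (x + s *\<^sub>R v) - f (x + s *\<^sub>R w) + f x) / s\<^sup>2)
       (dir_deriv w (\<lambda>y. dir_deriv v f y) x) < e"
    using d unfolding h_def by (auto simp: eventually_at_right)
qed

lemma dir_deriv_commute:
  fixes f :: "'a::real_normed_vector \<Rightarrow> real"
  assumes "open S" "x \<in> S" "Ck_on (Suc (Suc 0)) S f"
  shows "dir_deriv w (\<lambda>y. dir_deriv v f y) x = dir_deriv v (\<lambda>y. dir_deriv w f y) x"
proof (rule tendsto_unique)
  show "((\<lambda>s. (f (x + s *\<^sub>R v + s *\<^sub>R w) - f (x + s *\<^sub>R v) - f (x + s *\<^sub>R w) + f x) / s\<^sup>2)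
           \<longlongrightarrow> dir_deriv w (\<lambda>y. dir_deriv v f y) x) (at_right 0)"
    by (rule second_difference_quotient_tendsto[OF assms])
  show "((\<lambda>s. (f (x + s *\<^sub>R v + s *\<^sub>R w) - f (x + s *\<^sub>R v) - f (x + s *\<^sub>R w) + f x) / s\<^sup>2)
           \<longlongrightarrow> dir_deriv v (\<lambda>y. dir_deriv w f y) x) (at_right 0)"
    using second_difference_quotient_tendsto[OF assms, of w v] by (simp add: algebra_simps)
qed simp

section \<open>A smooth function that is flat at the origin\<close>

text \<open>
The powers of \<open>1 / x\<close> are carried along because they arise from differentiating \<open>exp (- 1 / x)\<close>;
the family is closed under differentiation, so smoothness is a single induction.
\<close>

definition flat_exp :: "nat \<Rightarrow> real \<Rightarrow> real" where
  "flat_exp n x = (if x > 0 then exp (- inverse x) * inverse x ^ n else 0)"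

lemma flat_exp_tendsto_0: "(flat_exp n \<longlongrightarrow> 0) (at 0)"
proof -
  have "((\<lambda>x. x ^ n / exp x) \<longlongrightarrow> (0::real)) at_top"
    by (rule tendsto_power_div_exp_0)
  then have "((\<lambda>x. inverse x ^ n / exp (inverse x)) \<longlongrightarrow> (0::real)) (at_right 0)"
    by (rule filterlim_compose) (rule filterlim_inverse_at_top_right)
  then have "(flat_exp n \<longlongrightarrow> 0) (at_right 0)"
    by (rule Lim_transform_eventually)
       (auto simp: eventually_at_filter flat_exp_def exp_minus field_simps intro!: always_eventually)
  moreover have "(flat_exp n \<longlongrightarrow> 0) (at_left 0)"
    by (rule Lim_transform_eventually[OF tendsto_const])
       (auto simp: eventually_at_filter flat_exp_def intro!: always_eventually)
  ultimately show ?thesis by (simp add: filterlim_split_at)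
qed

lemma flat_exp_has_real_derivative:
  "(flat_exp n has_real_derivative flat_exp (n + 2) x - real n * flat_exp (n + 1) x) (at x)"
proof (cases x "0::real" rule: linorder_cases)
  case less
  show ?thesis
    using less has_field_derivative_transform_within_open[of "\<lambda>_. 0" 0 x "{..<0}" "flat_exp n"]
    by (simp add: flat_exp_def)
next
  case equal
  have "((\<lambda>h. (flat_exp n (0 + h) - flat_exp n 0) / h) \<longlongrightarrow> 0) (at 0)"
    by (rule Lim_transform_eventually[OF flat_exp_tendsto_0[of "Suc n"]])
       (auto simp: flat_exp_def eventually_at_filter divide_inverse)
  then show ?thesis using equal by (simp add: DERIV_def flat_exp_def)
next
  case greater
  have "real n * inverse x ^ (n - Suc 0) * inverse x = real n * inverse x ^ n"
    by (cases n) auto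
  then have "exp (- inverse x) * (inverse x * inverse x) * inverse x ^ n
      + exp (- inverse x) * (real n * inverse x ^ (n - Suc 0) * - (inverse x * inverse x))
    = flat_exp (n + 2) x - real n * flat_exp (n + 1) x"
    using greater by (auto simp: flat_exp_def power2_eq_square algebra_simps)
  moreover have "((\<lambda>x. exp (- inverse x) * inverse x ^ n) has_real_derivative
      exp (- inverse x) * (inverse x * inverse x) * inverse x ^ n
      + exp (- inverse x) * (real n * inverse x ^ (n - Suc 0) * - (inverse x * inverse x))) (at x)"
    using greater by (auto intro!: derivative_eq_intros)
  ultimately have "((\<lambda>x. exp (- inverse x) * inverse x ^ n) has_real_derivative
      flat_exp (n + 2) x - real n * flat_exp (n + 1) x) (at x)"
    by (simp only:)
  then show ?thesis
    by (rule has_field_derivative_transform_within_open[of _ _ x "{0<..}"])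
       (use greater in \<open>auto simp: flat_exp_def\<close>)
qed

lemma Ck_on_flat_exp: "Ck_on k UNIV (flat_exp n)"
proof (induction k arbitrary: n)
  case 0
  then show ?case
    by (auto intro!: continuous_at_imp_continuous_on DERIV_isCont[OF flat_exp_has_real_derivative])
next
  case (Suc k)
  have D: "(flat_exp n has_derivative (\<lambda>v. (flat_exp (n + 2) x + (- real n) * flat_exp (n + 1) x) * v)) (at x)" for x
    using flat_exp_has_real_derivative[of n x] by (simp add: has_field_derivative_def)
  show ?case
    by (rule Ck_on_SucI[OF open_UNIV D])
       (intro Ck_on_mult Ck_on_add Ck_on_const Suc.IH open_UNIV)
qed

lemma Ck_on_inner_diff: "Ck_on k S (\<lambda>y. c + (y - a) \<bullet> (w::'a::real_inner))" if "open S"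
proof (cases k)
  case 0
  then show ?thesis by (auto intro!: continuous_intros)
next
  case (Suc j)
  have "Ck_on (Suc j) S (\<lambda>y. c + (y - a) \<bullet> w)"
    by (rule Ck_on_SucI[OF that, where f' = "\<lambda>x v. v \<bullet> w"])
       (auto intro!: derivative_eq_intros Ck_on_const)
  then show ?thesis using Suc by simp
qed

lemma Ck_on_dist_sq:
  fixes a :: "'a::real_inner" assumes "open S" shows "Ck_on k S (\<lambda>y. c - (y - a) \<bullet> (y - a))"
proof (cases k)
  case 0
  then show ?thesis by (auto intro!: continuous_intros)
next
  case (Suc j)
  have "Ck_on (Suc j) S (\<lambda>y. c - (y - a) \<bullet> (y - a))"
  proof (rule Ck_on_SucI[OF assms, where f' = "\<lambda>x v. 0 + (x - a) \<bullet> ((-2) *\<^sub>R v)"])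
    show "((\<lambda>y. c - (y - a) \<bullet> (y - a)) has_derivative (\<lambda>v. 0 + (x - a) \<bullet> ((-2) *\<^sub>R v))) (at x)" for x
      by (auto intro!: derivative_eq_intros simp: inner_commute algebra_simps)
  qed (rule Ck_on_inner_diff[OF assms])
  then show ?thesis using Suc by simp
qed

section \<open>Smooth functions and their restrictions to time slices\<close>

lemma smooth_on_cong:
  "open S \<Longrightarrow> (\<And>x. x \<in> S \<Longrightarrow> f x = g x) \<Longrightarrow> smooth_on S f \<Longrightarrow> smooth_on S g"
  unfolding smooth_on_def using Ck_on_cong by blast

lemma smooth_on_const: "smooth_on S (\<lambda>_. c)"
  by (simp add: smooth_on_def Ck_on_const)

lemma smooth_on_add:
  "open S \<Longrightarrow> smooth_on S f \<Longrightarrow> smooth_on S g \<Longrightarrow> smooth_on S (\<lambda>x. f x + g x)"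
  by (simp add: smooth_on_def Ck_on_add)

lemma smooth_on_sum:
  "open S \<Longrightarrow> (\<And>i. i \<in> I \<Longrightarrow> smooth_on S (f i)) \<Longrightarrow> smooth_on S (\<lambda>x. \<Sum>i\<in>I. f i x)"
  by (simp add: smooth_on_def Ck_on_sum)

lemma smooth_on_mult:
  fixes f g :: "'a::real_normed_vector \<Rightarrow> real"
  shows "open S \<Longrightarrow> smooth_on S f \<Longrightarrow> smooth_on S g \<Longrightarrow> smooth_on S (\<lambda>x. f x * g x)"
  by (simp add: smooth_on_def Ck_on_mult)

lemma smooth_on_dir_deriv: "smooth_on S f \<Longrightarrow> smooth_on S (dir_deriv v f)"
  unfolding smooth_on_def by (metis Ck_on.simps(2))

lemma smooth_on_imp_differentiable: "smooth_on S f \<Longrightarrow> x \<in> S \<Longrightarrow> f differentiable (at x)"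
  unfolding smooth_on_def by (metis Ck_on.simps(2))

lemma smooth_on_imp_continuous: "smooth_on S f \<Longrightarrow> continuous_on S f"
  unfolding smooth_on_def by (metis Ck_on.simps(1))

lemma smooth_on_slice:
  fixes W :: "'a::real_normed_vector \<times> 'b::real_normed_vector \<Rightarrow> real"
  shows "open S \<Longrightarrow> t \<in> T \<Longrightarrow> smooth_on (S \<times> T) W \<Longrightarrow> smooth_on S (\<lambda>y. W (y, t))"
  by (simp add: smooth_on_def Ck_on_slice)

lemma smooth_on_fst:
  fixes a :: "'a::real_normed_vector \<Rightarrow> real"
  shows "open S \<Longrightarrow> open T \<Longrightarrow> smooth_on S a \<Longrightarrow> smooth_on (S \<times> T) (\<lambda>p. a (fst p))"
  by (simp add: smooth_on_def Ck_on_fst)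

lemma dir_deriv_cong:
  assumes "open S" "x \<in> S" "f differentiable (at x)" "\<And>x. x \<in> S \<Longrightarrow> f x = g x"
  shows "dir_deriv v f x = dir_deriv v g x"
  using frechet_derivative_transform_within_open[OF assms(3,1,2,4)] by simp

lemma dir_deriv_slice:
  assumes "W differentiable (at (y, t))"
  shows "dir_deriv v (\<lambda>y. W (y, t)) y = dir_deriv (v, 0) W (y, t)"
  using frechet_derivative_at[OF frechet_derivative_slice(1)[OF assms]] by metis

text \<open>
Spatial derivatives of a time slice are derivatives of the joint function in directions \<open>(v, 0)\<close>.
This reduces every statement about \<open>L\<close> acting on a time-dependent function to calculus on the
product space.
\<close>

lemma dir_deriv_dir_deriv_slice:
  fixes W :: "'a::real_normed_vector \<times> 'b::real_normed_vector \<Rightarrow> real"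
  assumes "open S" "y \<in> S" "t \<in> T" "smooth_on (S \<times> T) W"
  shows "dir_deriv v (dir_deriv w (\<lambda>y. W (y, t))) y = dir_deriv (v, 0) (dir_deriv (w, 0) W) (y, t)"
proof -
  have W: "W differentiable (at (y, t))" if "y \<in> S" for y
    using that assms by (intro smooth_on_imp_differentiable) auto
  have W': "dir_deriv (w, 0) W differentiable (at (y, t))"
    using assms by (intro smooth_on_imp_differentiable[OF smooth_on_dir_deriv[OF assms(4)]]) auto
  have "(\<lambda>y. dir_deriv (w, 0) W (y, t)) differentiable (at y)"
    using frechet_derivative_slice(1)[OF W'] differentiable_def by blast
  then have "dir_deriv v (\<lambda>y. dir_deriv (w, 0) W (y, t)) y = dir_deriv v (dir_deriv w (\<lambda>y. W (y, t))) y"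
    by (rule dir_deriv_cong[OF assms(1,2)]) (simp add: dir_deriv_slice W)
  from this[symmetric] dir_deriv_slice[OF W', of v] show ?thesis by (rule trans)
qed

lemma has_real_derivative_time_slice:
  fixes W :: "'a::real_normed_vector \<times> real \<Rightarrow> real"
  assumes "W differentiable (at (y, t))"
  shows "((\<lambda>s. W (y, s)) has_real_derivative dir_deriv (0, 1) W (y, t)) (at t)"
proof -
  have l: "linear (frechet_derivative W (at (y, t)))"
    by (rule has_derivative_linear[OF frechet_derivative_works[THEN iffD1, OF assms]])
  have "dir_deriv (0, s) W (y, t) = dir_deriv (0, 1) W (y, t) * s" for s
    using linear_scale[OF l, of s "(0, 1)"] by simp
  then have "(\<lambda>s. dir_deriv (0, s) W (y, t)) = (*) (dir_deriv (0, 1) W (y, t))"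
    by (rule ext)
  then show ?thesis
    using frechet_derivative_slice(2)[OF assms] by (simp add: has_field_derivative_def)
qed

lemma smooth_dir_deriv_commute:
  fixes f :: "'a::real_normed_vector \<Rightarrow> real"
  assumes "open S" "x \<in> S" "smooth_on S f"
  shows "dir_deriv w (dir_deriv v f) x = dir_deriv v (dir_deriv w f) x"
  using dir_deriv_commute[OF assms(1,2)] assms(3) unfolding smooth_on_def by blast

lemma dir_deriv_mult:
  fixes f g :: "'a::real_normed_vector \<Rightarrow> real"
  assumes "f differentiable (at x)" "g differentiable (at x)"
  shows "dir_deriv v (\<lambda>x. f x * g x) x = f x * dir_deriv v g x + dir_deriv v f x * g x"
  using frechet_derivative_at[OF has_derivative_mult[OF assms[THEN frechet_derivative_works[THEN iffD1]]]]
  by metis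

lemma dir_deriv_add:
  fixes f g :: "'a::real_normed_vector \<Rightarrow> real"
  assumes "f differentiable (at x)" "g differentiable (at x)"
  shows "dir_deriv v (\<lambda>x. f x + g x) x = dir_deriv v f x + dir_deriv v g x"
  using frechet_derivative_at[OF has_derivative_add[OF assms[THEN frechet_derivative_works[THEN iffD1]]]]
  by metis

lemma dir_deriv_dir_deriv_mult:
  fixes f g :: "'a::real_normed_vector \<Rightarrow> real"
  assumes S: "open S" "x \<in> S" and f: "smooth_on S f" and g: "smooth_on S g"
  shows "dir_deriv v (dir_deriv w (\<lambda>x. f x * g x)) x =
    f x * dir_deriv v (dir_deriv w g) x + dir_deriv v f x * dir_deriv w g x
    + (dir_deriv w f x * dir_deriv v g x + dir_deriv v (dir_deriv w f) x * g x)"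
proof -
  note d = smooth_on_imp_differentiable[OF _ S(2)]
  have e: "f x * dir_deriv w g x + dir_deriv w f x * g x = dir_deriv w (\<lambda>x. f x * g x) x" if "x \<in> S" for x
    using that f g by (simp add: dir_deriv_mult smooth_on_imp_differentiable)
  have "dir_deriv v (\<lambda>x. f x * dir_deriv w g x + dir_deriv w f x * g x) x = dir_deriv v (dir_deriv w (\<lambda>x. f x * g x)) x"
    by (rule dir_deriv_cong[OF S _ e])
       (intro d smooth_on_add smooth_on_mult S(1) smooth_on_dir_deriv f g)
  moreover have "dir_deriv v (\<lambda>x. f x * dir_deriv w g x + dir_deriv w f x * g x) x =
    dir_deriv v (\<lambda>x. f x * dir_deriv w g x) x + dir_deriv v (\<lambda>x. dir_deriv w f x * g x) x"
    by (rule dir_deriv_add) (intro d smooth_on_add smooth_on_mult S(1) smooth_on_dir_deriv f g)+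
  moreover have "dir_deriv v (\<lambda>x. f x * dir_deriv w g x) x = f x * dir_deriv v (dir_deriv w g) x + dir_deriv v f x * dir_deriv w g x"
    by (rule dir_deriv_mult) (intro d smooth_on_dir_deriv f g)+
  moreover have "dir_deriv v (\<lambda>x. dir_deriv w f x * g x) x = dir_deriv w f x * dir_deriv v g x + dir_deriv v (dir_deriv w f) x * g x"
    by (rule dir_deriv_mult) (intro d smooth_on_dir_deriv f g)+
  ultimately show ?thesis by simp
qed

lemma dir_deriv_dir_deriv_add:
  fixes f g :: "'a::real_normed_vector \<Rightarrow> real"
  assumes S: "open S" "x \<in> S" and f: "smooth_on S f" and g: "smooth_on S g"
  shows "dir_deriv v (dir_deriv w (\<lambda>x. f x + g x)) x =
    dir_deriv v (dir_deriv w f) x + dir_deriv v (dir_deriv w g) x"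
proof -
  note d = smooth_on_imp_differentiable[OF _ S(2)]
  have e: "dir_deriv w f x + dir_deriv w g x = dir_deriv w (\<lambda>x. f x + g x) x" if "x \<in> S" for x
    using that f g by (simp add: dir_deriv_add smooth_on_imp_differentiable)
  have "dir_deriv v (\<lambda>x. dir_deriv w f x + dir_deriv w g x) x = dir_deriv v (dir_deriv w (\<lambda>x. f x + g x)) x"
    by (rule dir_deriv_cong[OF S _ e])
       (intro d smooth_on_add smooth_on_mult S(1) smooth_on_dir_deriv f g)
  moreover have "dir_deriv v (\<lambda>x. dir_deriv w f x + dir_deriv w g x) x =
    dir_deriv v (dir_deriv w f) x + dir_deriv v (dir_deriv w g) x"
    by (rule dir_deriv_add) (intro d smooth_on_dir_deriv f g)+
  ultimately show ?thesis by simp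
qed

lemma smooth_on_ln:
  fixes f :: "'a::real_normed_vector \<Rightarrow> real"
  shows "open S \<Longrightarrow> smooth_on S f \<Longrightarrow> (\<And>x. x \<in> S \<Longrightarrow> f x > 0) \<Longrightarrow> smooth_on S (\<lambda>x. ln (f x))"
  unfolding smooth_on_def by (blast intro: Ck_on_ln)

lemma smooth_on_exp:
  fixes f :: "'a::real_normed_vector \<Rightarrow> real"
  assumes "open S" "smooth_on S f"
  shows "smooth_on S (\<lambda>x. exp (f x))"
proof -
  have "Ck_on k S (\<lambda>x. exp (f x))" for k
  proof (induction k)
    case 0
    then show ?case using smooth_on_imp_continuous[OF assms(2)] by (auto intro!: continuous_intros)
  next
    case (Suc k)
    show ?case
    proof (rule Ck_on_SucI[OF assms(1), where f' = "\<lambda>x v. exp (f x) * dir_deriv v f x"])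
      fix x assume x: "x \<in> S"
      have "(f has_derivative frechet_derivative f (at x)) (at x)"
        using smooth_on_imp_differentiable[OF assms(2) x] frechet_derivative_works by blast
      then show "((\<lambda>x. exp (f x)) has_derivative (\<lambda>v. exp (f x) * dir_deriv v f x)) (at x)"
        by (auto intro!: derivative_eq_intros)
    next
      show "Ck_on k S (\<lambda>x. exp (f x) * dir_deriv v f x)" for v
        using smooth_on_dir_deriv[OF assms(2)] unfolding smooth_on_def
        by (intro Ck_on_mult assms(1) Suc.IH) blast
    qed
  qed
  then show ?thesis by (simp add: smooth_on_def)
qed

lemma smooth_on_locally:
  "(\<And>x. x \<in> S \<Longrightarrow> \<exists>T. open T \<and> x \<in> T \<and> smooth_on T f) \<Longrightarrow> smooth_on S f"
  unfolding smooth_on_def using Ck_on_locally by metis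

lemma smooth_on_compose:
  fixes f :: "'b::euclidean_space \<Rightarrow> real" and g :: "'a::real_normed_vector \<Rightarrow> 'b"
  shows "open S \<Longrightarrow> open T \<Longrightarrow> smooth_on T f \<Longrightarrow> smooth_on S g \<Longrightarrow> g ` S \<subseteq> T \<Longrightarrow> smooth_on S (\<lambda>x. f (g x))"
  unfolding smooth_on_def by (simp add: Ck_on_compose)

lemma smooth_bump: "smooth_on UNIV (\<lambda>y::'a::euclidean_space. flat_exp 0 (r - (y - a) \<bullet> (y - a)))"
  by (rule smooth_on_compose[of UNIV UNIV "flat_exp 0"])
     (auto simp: smooth_on_def intro: Ck_on_flat_exp Ck_on_dist_sq)

section \<open>Differential expressions in one chart\<close>

definition second_order_expr ::
  "('e::euclidean_space \<Rightarrow> 'e \<Rightarrow> 'e \<Rightarrow> real) \<Rightarrow> ('e \<Rightarrow> 'e \<Rightarrow> real) \<Rightarrow> ('e \<Rightarrow> real) \<Rightarrow> ('e \<Rightarrow> real) \<Rightarrow> 'e \<Rightarrow> real" where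
  "second_order_expr a b c h y =
     (\<Sum>i\<in>Basis. \<Sum>j\<in>Basis. a i j y * dir_deriv i (dir_deriv j h) y) +
     (\<Sum>i\<in>Basis. b i y * dir_deriv i h y) + c y * h y"

definition bilinear_expr ::
  "('e::euclidean_space \<Rightarrow> 'e \<Rightarrow> 'e \<Rightarrow> real) \<Rightarrow> ('e \<Rightarrow> real) \<Rightarrow> ('e \<Rightarrow> real) \<Rightarrow> 'e \<Rightarrow> real" where
  "bilinear_expr q f h y = (\<Sum>i\<in>Basis. \<Sum>j\<in>Basis. q i j y * dir_deriv i f y * dir_deriv j h y)"

lemma bilinear_expr_cong:
  assumes S: "open S" "y \<in> S" and f: "smooth_on S f" "smooth_on S h"
    and eq: "\<And>x. x \<in> S \<Longrightarrow> f x = f' x" "\<And>x. x \<in> S \<Longrightarrow> h x = h' x"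
  shows "bilinear_expr q f h y = bilinear_expr q f' h' y"
  unfolding bilinear_expr_def
  using dir_deriv_cong[OF S smooth_on_imp_differentiable[OF f(1) S(2)] eq(1)]
    dir_deriv_cong[OF S smooth_on_imp_differentiable[OF f(2) S(2)] eq(2)] by simp

lemma second_order_expr_add:
  assumes S: "open S" "y \<in> S" and f: "smooth_on S f" and g: "smooth_on S g"
  shows "second_order_expr a b c (\<lambda>y. f y + g y) y = second_order_expr a b c f y + second_order_expr a b c g y"
  unfolding second_order_expr_def
  using f g S
  by (simp add: dir_deriv_dir_deriv_add[OF S f g] dir_deriv_add smooth_on_imp_differentiable
      distrib_left sum.distrib)

lemma bilinear_expr_add:
  assumes y: "y \<in> S" and f: "smooth_on S f" "smooth_on S g"
  shows "bilinear_expr q h (\<lambda>y. f y + g y) y = bilinear_expr q h f y + bilinear_expr q h g y"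
  unfolding bilinear_expr_def
  using assms by (simp add: dir_deriv_add smooth_on_imp_differentiable distrib_left sum.distrib)

lemma bilinear_expr_mult:
  assumes y: "y \<in> S" and f: "smooth_on S f" "smooth_on S g"
  shows "bilinear_expr q (\<lambda>y. f y * g y) h y = f y * bilinear_expr q g h y + g y * bilinear_expr q f h y"
  unfolding bilinear_expr_def
  using assms by (simp add: dir_deriv_mult smooth_on_imp_differentiable algebra_simps sum.distrib sum_distrib_left)

lemma bilinear_expr_commute:
  assumes "\<And>i j. i \<in> Basis \<Longrightarrow> j \<in> Basis \<Longrightarrow> q i j y = q j i y"
  shows "bilinear_expr q f h y = bilinear_expr q h f y"
  unfolding bilinear_expr_def
  by (subst sum.swap) (auto intro!: sum.cong simp: assms)

text \<open>
The zeroth order term is counted once on the left and twice on the right, hence the correction.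
\<close>

lemma second_order_expr_mult:
  assumes S: "open S" "y \<in> S" and f: "smooth_on S f" and g: "smooth_on S g"
    and sym: "\<And>i j. i \<in> Basis \<Longrightarrow> j \<in> Basis \<Longrightarrow> a i j y = a j i y"
  shows "second_order_expr a b c (\<lambda>y. f y * g y) y =
    f y * second_order_expr a b c g y + g y * second_order_expr a b c f y
    + 2 * bilinear_expr a f g y - c y * f y * g y"
proof -
  have "(\<Sum>i\<in>Basis. \<Sum>j\<in>Basis. a i j y * dir_deriv i (dir_deriv j (\<lambda>y. f y * g y)) y) =
     f y * (\<Sum>i\<in>Basis. \<Sum>j\<in>Basis. a i j y * dir_deriv i (dir_deriv j g) y)
     + g y * (\<Sum>i\<in>Basis. \<Sum>j\<in>Basis. a i j y * dir_deriv i (dir_deriv j f) y)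
     + bilinear_expr a f g y + bilinear_expr a g f y"
    unfolding bilinear_expr_def dir_deriv_dir_deriv_mult[OF S f g]
    by (simp add: algebra_simps sum.distrib sum_distrib_left)
  moreover have "(\<Sum>i\<in>Basis. b i y * dir_deriv i (\<lambda>y. f y * g y) y) =
     f y * (\<Sum>i\<in>Basis. b i y * dir_deriv i g y) + g y * (\<Sum>i\<in>Basis. b i y * dir_deriv i f y)"
    using f g S
    by (simp add: dir_deriv_mult smooth_on_imp_differentiable algebra_simps sum.distrib sum_distrib_left)
  ultimately show ?thesis
    using bilinear_expr_commute[of a y g f] sym unfolding second_order_expr_def
    by (simp add: algebra_simps)
qed

lemma dir_deriv_exp:
  fixes f :: "'a::real_normed_vector \<Rightarrow> real"
  assumes "f differentiable (at x)"
  shows "dir_deriv v (\<lambda>x. exp (f x)) x = exp (f x) * dir_deriv v f x"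
proof -
  have "(f has_derivative frechet_derivative f (at x)) (at x)"
    using assms frechet_derivative_works by blast
  then have "((\<lambda>x. exp (f x)) has_derivative (\<lambda>v. exp (f x) * dir_deriv v f x)) (at x)"
    by (auto intro!: derivative_eq_intros)
  from frechet_derivative_at[OF this] show ?thesis by metis
qed

lemma bilinear_expr_exp:
  assumes y: "y \<in> S" and f: "smooth_on S f"
  shows "bilinear_expr q (\<lambda>y. exp (f y)) h y = exp (f y) * bilinear_expr q f h y"
  unfolding bilinear_expr_def
  using assms by (simp add: dir_deriv_exp smooth_on_imp_differentiable sum_distrib_left algebra_simps)

lemma second_order_expr_exp:
  assumes S: "open S" "y \<in> S" and f: "smooth_on S f" and c: "c y = 0"
  shows "second_order_expr a b c (\<lambda>y. exp (f y)) y =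
    exp (f y) * (second_order_expr a b c f y + bilinear_expr a f f y)"
proof -
  have e: "smooth_on S (\<lambda>y. exp (f y))" by (rule smooth_on_exp[OF S(1) f])
  have "dir_deriv i (dir_deriv j (\<lambda>y. exp (f y))) y
     = exp (f y) * dir_deriv i (dir_deriv j f) y + exp (f y) * dir_deriv i f y * dir_deriv j f y" for i j
  proof -
    have "dir_deriv i (\<lambda>y. exp (f y) * dir_deriv j f y) y = dir_deriv i (dir_deriv j (\<lambda>y. exp (f y))) y"
      by (rule dir_deriv_cong[OF S])
         (auto intro!: smooth_on_imp_differentiable[OF _ S(2)] smooth_on_mult smooth_on_dir_deriv e f S
           simp: dir_deriv_exp smooth_on_imp_differentiable[OF f])
    moreover have "dir_deriv i (\<lambda>y. exp (f y) * dir_deriv j f y) y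
        = exp (f y) * dir_deriv i (dir_deriv j f) y + dir_deriv i (\<lambda>y. exp (f y)) y * dir_deriv j f y"
      by (rule dir_deriv_mult) (intro smooth_on_imp_differentiable[OF _ S(2)] smooth_on_dir_deriv e f)+
    ultimately show ?thesis using smooth_on_imp_differentiable[OF f S(2)] by (simp add: dir_deriv_exp)
  qed
  then show ?thesis
    using smooth_on_imp_differentiable[OF f S(2)] c
    unfolding second_order_expr_def bilinear_expr_def
    by (simp add: dir_deriv_exp sum_distrib_left algebra_simps sum.distrib)
qed

lemma dir_deriv_const: "dir_deriv v (\<lambda>_. c) y = 0"
  by (simp add: frechet_derivative_const)

lemma second_order_expr_const: "second_order_expr a b c (\<lambda>_. r) y = c y * r"
  by (simp add: second_order_expr_def dir_deriv_const)

lemma bilinear_expr_const: "bilinear_expr q (\<lambda>_. r) h y = 0"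
  by (simp add: bilinear_expr_def dir_deriv_const)

lemma bilinear_expr_nonneg:
  assumes "\<And>\<xi>. 0 \<le> (\<Sum>i\<in>Basis. \<Sum>j\<in>Basis. q i j y * (\<xi> \<bullet> i) * (\<xi> \<bullet> j))"
  shows "0 \<le> bilinear_expr q f f (y::'e::euclidean_space)"
  using assms[of "\<Sum>b\<in>Basis. dir_deriv b f y *\<^sub>R b"]
  unfolding bilinear_expr_def by (simp add: inner_sum_left inner_Basis if_distrib sum.delta cong: if_cong)

lemma second_order_expr_slice:
  fixes W :: "'e::euclidean_space \<times> 'b::real_normed_vector \<Rightarrow> real"
  assumes "open S" "y \<in> S" "t \<in> T" "smooth_on (S \<times> T) W"
  shows "second_order_expr a b c (\<lambda>y. W (y, t)) y =
     (\<Sum>i\<in>Basis. \<Sum>j\<in>Basis. a i j y * dir_deriv (i, 0) (dir_deriv (j, 0) W) (y, t)) +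
     (\<Sum>i\<in>Basis. b i y * dir_deriv (i, 0) W (y, t)) + c y * W (y, t)"
  using smooth_on_imp_differentiable[OF assms(4), of "(y, t)"] assms(2,3)
  by (simp add: second_order_expr_def dir_deriv_dir_deriv_slice[OF assms] dir_deriv_slice)

lemma bilinear_expr_slice:
  fixes V W :: "'e::euclidean_space \<times> 'b::real_normed_vector \<Rightarrow> real"
  assumes "y \<in> S" "t \<in> T" "smooth_on (S \<times> T) V" "smooth_on (S \<times> T) W"
  shows "bilinear_expr q (\<lambda>y. V (y, t)) (\<lambda>y. W (y, t)) y =
     (\<Sum>i\<in>Basis. \<Sum>j\<in>Basis. q i j y * dir_deriv (i, 0) V (y, t) * dir_deriv (j, 0) W (y, t))"
  using smooth_on_imp_differentiable[OF assms(3), of "(y, t)"]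
    smooth_on_imp_differentiable[OF assms(4), of "(y, t)"] assms(1,2)
  by (simp add: bilinear_expr_def dir_deriv_slice)

text \<open>
The coefficients do not depend on time, so this is the product rule together with the symmetry of mixed
derivatives.
\<close>

lemma bilinear_expr_time_derivative:
  fixes V W :: "'e::euclidean_space \<times> real \<Rightarrow> real"
  assumes S: "open S" "y \<in> S" "open T" "t \<in> T" and V: "smooth_on (S \<times> T) V" and W: "smooth_on (S \<times> T) W"
  shows "((\<lambda>s. bilinear_expr q (\<lambda>y. V (y, s)) (\<lambda>y. W (y, s)) y) has_real_derivative
          bilinear_expr q (\<lambda>y. dir_deriv (0, 1) V (y, t)) (\<lambda>y. W (y, t)) y
          + bilinear_expr q (\<lambda>y. V (y, t)) (\<lambda>y. dir_deriv (0, 1) W (y, t)) y) (at t)"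
proof -
  have ST: "open (S \<times> T)" "(y, t) \<in> S \<times> T" using S by (auto simp: open_Times)
  note d = has_real_derivative_time_slice[OF smooth_on_imp_differentiable[OF smooth_on_dir_deriv ST(2)]]
  have "((\<lambda>s. \<Sum>i\<in>Basis. \<Sum>j\<in>Basis. q i j y * (dir_deriv (i, 0) V (y, s) * dir_deriv (j, 0) W (y, s)))
     has_real_derivative
     (\<Sum>i\<in>Basis. \<Sum>j\<in>Basis. q i j y * (dir_deriv (0, 1) (dir_deriv (i, 0) V) (y, t) * dir_deriv (j, 0) W (y, t)
        + dir_deriv (0, 1) (dir_deriv (j, 0) W) (y, t) * dir_deriv (i, 0) V (y, t)))) (at t)"
    by (intro DERIV_sum DERIV_cmult DERIV_mult d V W)
  moreover have "bilinear_expr q (\<lambda>y. dir_deriv (0, 1) V (y, t)) (\<lambda>y. W (y, t)) y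
          + bilinear_expr q (\<lambda>y. V (y, t)) (\<lambda>y. dir_deriv (0, 1) W (y, t)) y
     = (\<Sum>i\<in>Basis. \<Sum>j\<in>Basis. q i j y * (dir_deriv (0, 1) (dir_deriv (i, 0) V) (y, t) * dir_deriv (j, 0) W (y, t)
        + dir_deriv (0, 1) (dir_deriv (j, 0) W) (y, t) * dir_deriv (i, 0) V (y, t)))"
    unfolding bilinear_expr_slice[OF S(2,4) smooth_on_dir_deriv[OF V] W]
      bilinear_expr_slice[OF S(2,4) V smooth_on_dir_deriv[OF W]]
      smooth_dir_deriv_commute[OF ST V, where w = "(0, 1)"]
      smooth_dir_deriv_commute[OF ST W, where w = "(0, 1)"]
    by (simp add: sum.distrib algebra_simps)
  ultimately have D: "((\<lambda>s. \<Sum>i\<in>Basis. \<Sum>j\<in>Basis. q i j y * (dir_deriv (i, 0) V (y, s) * dir_deriv (j, 0) W (y, s)))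
     has_real_derivative
      bilinear_expr q (\<lambda>y. dir_deriv (0, 1) V (y, t)) (\<lambda>y. W (y, t)) y
          + bilinear_expr q (\<lambda>y. V (y, t)) (\<lambda>y. dir_deriv (0, 1) W (y, t)) y) (at t)" by (simp only:)
  show ?thesis
    by (rule has_field_derivative_transform_within_open[OF D S(3,4)])
       (simp add: bilinear_expr_slice[OF S(2) _ V W] mult.assoc)
qed

section \<open>Smooth functions on the manifold and in space-time\<close>

text \<open>
The regularity class of a heat solution. It is stable under products, under the time derivative, and
under \<open>L\<close> and the bilinear forms.
\<close>

definition CinfT :: "('m, 'e::euclidean_space) atlas \<Rightarrow> ('m \<Rightarrow> real \<Rightarrow> real) set" where
  "CinfT A = {w. \<forall>(U, \<phi>)\<in>A.
     smooth_on (\<phi> ` U \<times> {0<..}) (\<lambda>p. w (inv_into U \<phi> (fst p)) (snd p))}"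

locale smooth_manifold =
  fixes A :: "('m::{t2_space, second_countable_topology}, 'e::euclidean_space) atlas"
  assumes smooth_atlas: "smooth_atlas A"
begin

lemma chart:
  assumes "(U, \<phi>) \<in> A"
  shows "open U" "open (\<phi> ` U)" "continuous_on U \<phi>" "continuous_on (\<phi> ` U) (inv_into U \<phi>)"
    "\<And>x. x \<in> U \<Longrightarrow> inv_into U \<phi> (\<phi> x) = x" "\<And>y. y \<in> \<phi> ` U \<Longrightarrow> \<phi> (inv_into U \<phi> y) = y"
    "\<And>y. y \<in> \<phi> ` U \<Longrightarrow> inv_into U \<phi> y \<in> U"
  using assms smooth_atlas unfolding smooth_atlas_def homeomorphism_def
  by (auto simp: inv_into_into f_inv_into_f)

lemma chart_transition:
  "(U, \<phi>) \<in> A \<Longrightarrow> (V, \<psi>) \<in> A \<Longrightarrow> smooth_on (\<phi> ` (U \<inter> V)) (\<psi> \<circ> inv_into U \<phi>)"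
  using smooth_atlas unfolding smooth_atlas_def by blast

lemma chart_around: obtains U \<phi> where "(U, \<phi>) \<in> A" "x \<in> U"
  using smooth_atlas unfolding smooth_atlas_def by blast

lemma chart_image_open:
  assumes "(U, \<phi>) \<in> A" "open V" shows "open (\<phi> ` (U \<inter> V))"
proof -
  note c = chart[OF assms(1)]
  have "\<phi> ` (U \<inter> V) = inv_into U \<phi> -` V \<inter> \<phi> ` U"
    using c(5-7) by (auto simp: image_iff)
  then show ?thesis
    using continuous_open_preimage[OF c(4,2) assms(2)] by (simp add: Int_commute)
qed

lemma chart_dom_open: "(U, \<phi>) \<in> A \<Longrightarrow> open (\<phi> ` U \<times> {0::real<..})"
  using chart(2) by (simp add: open_Times)

lemma CinfD: "f \<in> Cinf A \<Longrightarrow> (U, \<phi>) \<in> A \<Longrightarrow> smooth_on (\<phi> ` U) (\<lambda>y. f (inv_into U \<phi> y))"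
  by (auto simp: Cinf_def in_chart_def comp_def)

lemma CinfI: "(\<And>U \<phi>. (U, \<phi>) \<in> A \<Longrightarrow> smooth_on (\<phi> ` U) (\<lambda>y. f (inv_into U \<phi> y))) \<Longrightarrow> f \<in> Cinf A"
  by (auto simp: Cinf_def in_chart_def comp_def)

lemma CinfTD: "w \<in> CinfT A \<Longrightarrow> (U, \<phi>) \<in> A \<Longrightarrow>
    smooth_on (\<phi> ` U \<times> {0<..}) (\<lambda>p. w (inv_into U \<phi> (fst p)) (snd p))"
  by (auto simp: CinfT_def)

lemma CinfTI: "(\<And>U \<phi>. (U, \<phi>) \<in> A \<Longrightarrow>
    smooth_on (\<phi> ` U \<times> {0<..}) (\<lambda>p. w (inv_into U \<phi> (fst p)) (snd p))) \<Longrightarrow> w \<in> CinfT A"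
  by (auto simp: CinfT_def)

lemma CinfT_add: "v \<in> CinfT A \<Longrightarrow> w \<in> CinfT A \<Longrightarrow> (\<lambda>x t. v x t + w x t) \<in> CinfT A"
  by (rule CinfTI) (intro smooth_on_add chart_dom_open CinfTD)

lemma CinfT_mult: "v \<in> CinfT A \<Longrightarrow> w \<in> CinfT A \<Longrightarrow> (\<lambda>x t. v x t * w x t) \<in> CinfT A"
  by (rule CinfTI) (intro smooth_on_mult chart_dom_open CinfTD)

lemma CinfT_const: "(\<lambda>x t. c) \<in> CinfT A"
  by (rule CinfTI) (rule smooth_on_const)

lemma CinfT_ln:
  assumes "w \<in> CinfT A" "\<And>x t. t > 0 \<Longrightarrow> w x t > 0" shows "(\<lambda>x t. ln (w x t)) \<in> CinfT A"
  by (rule CinfTI, rule smooth_on_ln[OF chart_dom_open CinfTD[OF assms(1)]]) (use assms(2) in auto)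

lemma CinfT_static:
  assumes "f \<in> Cinf A" shows "(\<lambda>x t. f x) \<in> CinfT A"
proof (rule CinfTI)
  fix U and \<phi> :: "'m \<Rightarrow> 'e" assume "(U, \<phi>) \<in> A"
  then show "smooth_on (\<phi> ` U \<times> {0::real<..}) (\<lambda>p. f (inv_into U \<phi> (fst p)))"
    by (intro smooth_on_fst chart(2) open_greaterThan CinfD assms)
qed

lemma CinfT_slice:
  assumes "w \<in> CinfT A" "t > 0" shows "(\<lambda>x. w x t) \<in> Cinf A"
proof (rule CinfI)
  fix U and \<phi> :: "'m \<Rightarrow> 'e" assume "(U, \<phi>) \<in> A"
  then show "smooth_on (\<phi> ` U) (\<lambda>y. w (inv_into U \<phi> y) t)"
    using smooth_on_slice[OF chart(2) _ CinfTD, of U \<phi> t w] assms by simp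
qed

text \<open>
Closure properties of smooth functions on the manifold are obtained from those of space-time
functions by regarding a function as constant in time.
\<close>

lemma Cinf_from_static: "(\<lambda>x t. f x) \<in> CinfT A \<Longrightarrow> f \<in> Cinf A"
  using CinfT_slice[of "\<lambda>x t. f x" 1] by simp

lemma CinfT_continuous:
  assumes "w \<in> CinfT A" shows "continuous_on (UNIV \<times> {0<..}) (\<lambda>p. w (fst p) (snd p))"
proof -
  have "isCont (\<lambda>p. w (fst p) (snd p)) (x, t)" if t: "t > 0" for x and t :: real
  proof -
    obtain U \<phi> where U: "(U, \<phi>) \<in> A" "x \<in> U" by (rule chart_around)
    note c = chart[OF U(1)]
    have "continuous_on (U \<times> {0<..}) (\<lambda>p. (\<phi> (fst p), snd p))"
      using c(3) by (auto intro!: continuous_intros continuous_on_compose2[of U \<phi> _ fst])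
    then have "continuous_on (U \<times> {0<..}) (\<lambda>p. w (inv_into U \<phi> (fst (\<phi> (fst p), snd p))) (snd (\<phi> (fst p), snd p)))"
      by (rule continuous_on_compose2[OF smooth_on_imp_continuous[OF CinfTD[OF assms U(1)]]]) auto
    then have "continuous_on (U \<times> {0<..}) (\<lambda>p. w (fst p) (snd p))"
      by (rule continuous_on_eq) (use c in auto)
    then show ?thesis
      using U c(1) t by (simp add: continuous_on_eq_continuous_at open_Times)
  qed
  then show ?thesis by (auto intro!: continuous_at_imp_continuous_on)
qed

lemma Cinf_continuous:
  assumes "f \<in> Cinf A" shows "continuous_on UNIV f"
proof -
  have "continuous_on UNIV (\<lambda>x. (x, 1::real))" by (intro continuous_intros)
  moreover have "range (\<lambda>x::'m. (x, 1::real)) \<subseteq> UNIV \<times> {0<..}" by auto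
  ultimately show ?thesis
    using continuous_on_compose2[OF CinfT_continuous[OF CinfT_static[OF assms]]] by fastforce
qed

lemma CinfT_time_derivative_chart:
  assumes w: "w \<in> CinfT A" and U: "(U, \<phi>) \<in> A" "y \<in> \<phi> ` U" and t: "t > 0"
  shows "((\<lambda>s. w (inv_into U \<phi> y) s) has_real_derivative
           dir_deriv (0, 1) (\<lambda>p. w (inv_into U \<phi> (fst p)) (snd p)) (y, t)) (at t)"
  using has_real_derivative_time_slice[of "\<lambda>p. w (inv_into U \<phi> (fst p)) (snd p)" y t]
    smooth_on_imp_differentiable[OF CinfTD[OF w U(1)], of "(y, t)"] U t by simp

lemma CinfT_time_derivative_eq:
  assumes w: "w \<in> CinfT A" and w': "\<And>x t. t > 0 \<Longrightarrow> ((\<lambda>s. w x s) has_real_derivative w' x t) (at t)"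
    and U: "(U, \<phi>) \<in> A" "p \<in> \<phi> ` U \<times> {0<..}"
  shows "dir_deriv (0, 1) (\<lambda>p. w (inv_into U \<phi> (fst p)) (snd p)) p = w' (inv_into U \<phi> (fst p)) (snd p)"
  using CinfT_time_derivative_chart[OF w U(1), of "fst p" "snd p"] U(2) w'[of "snd p" "inv_into U \<phi> (fst p)"]
  by (auto intro: DERIV_unique)

text \<open>
In a chart the time derivative is the directional derivative along \<open>(0, 1)\<close>.
\<close>

lemma CinfT_time_derivative:
  assumes w: "w \<in> CinfT A" and w': "\<And>x t. t > 0 \<Longrightarrow> ((\<lambda>s. w x s) has_real_derivative w' x t) (at t)"
  shows "w' \<in> CinfT A"
  by (rule CinfTI, rule smooth_on_cong[OF chart_dom_open _ smooth_on_dir_deriv[OF CinfTD[OF w], where v = "(0, 1)"]])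
     (auto simp: CinfT_time_derivative_eq[OF w w'])

lemma Cinf_add: "f \<in> Cinf A \<Longrightarrow> h \<in> Cinf A \<Longrightarrow> (\<lambda>x. f x + h x) \<in> Cinf A"
  by (rule Cinf_from_static) (intro CinfT_add CinfT_static)

lemma Cinf_mult: "f \<in> Cinf A \<Longrightarrow> h \<in> Cinf A \<Longrightarrow> (\<lambda>x. f x * h x) \<in> Cinf A"
  by (rule Cinf_from_static) (intro CinfT_mult CinfT_static)

lemma Cinf_const: "(\<lambda>_. c) \<in> Cinf A"
  by (rule Cinf_from_static) (rule CinfT_const)

lemma Cinf_diff:
  assumes "f \<in> Cinf A" "h \<in> Cinf A" shows "(\<lambda>x. f x - h x) \<in> Cinf A"
  using Cinf_add[OF assms(1) Cinf_mult[OF Cinf_const[of "- 1"] assms(2)]] by simp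

lemma Cinf_exp:
  assumes "f \<in> Cinf A" shows "(\<lambda>x. exp (f x)) \<in> Cinf A"
  by (rule CinfI) (intro smooth_on_exp chart(2) CinfD assms)

end

section \<open>Bilinear forms and diffusion operators\<close>

locale bilinear_form = smooth_manifold A
  for A :: "('m::{t2_space, second_countable_topology}, 'e::euclidean_space) atlas" +
  fixes G :: "('m \<Rightarrow> real) \<Rightarrow> ('m \<Rightarrow> real) \<Rightarrow> 'm \<Rightarrow> real"
  assumes smooth_form: "smooth_bilinear_form A G"
begin

text \<open>
The coefficients of a form in a chart. The identity is stated at points of the manifold, so that it
can be rewritten with directly.
\<close>

definition represents_form :: "'m set \<Rightarrow> ('m \<Rightarrow> 'e) \<Rightarrow> ('e \<Rightarrow> 'e \<Rightarrow> 'e \<Rightarrow> real) \<Rightarrow> bool" where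
  "represents_form U \<phi> q \<longleftrightarrow> (\<forall>i\<in>Basis. \<forall>j\<in>Basis. smooth_on (\<phi> ` U) (q i j)) \<and>
     (\<forall>f\<in>Cinf A. \<forall>h\<in>Cinf A. \<forall>x\<in>U.
        G f h x = bilinear_expr q (\<lambda>y. f (inv_into U \<phi> y)) (\<lambda>y. h (inv_into U \<phi> y)) (\<phi> x))"

lemma represents_formD:
  assumes "represents_form U \<phi> q"
  shows "i \<in> Basis \<Longrightarrow> j \<in> Basis \<Longrightarrow> smooth_on (\<phi> ` U) (q i j)"
    and "f \<in> Cinf A \<Longrightarrow> h \<in> Cinf A \<Longrightarrow> x \<in> U \<Longrightarrow>
      G f h x = bilinear_expr q (\<lambda>y. f (inv_into U \<phi> y)) (\<lambda>y. h (inv_into U \<phi> y)) (\<phi> x)"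
  using assms by (auto simp: represents_form_def)

lemma represents_form_exists:
  assumes U: "(U, \<phi>) \<in> A" shows "\<exists>q. represents_form U \<phi> q"
proof -
  obtain q :: "'e \<Rightarrow> 'e \<Rightarrow> 'e \<Rightarrow> real" where q:
    "\<forall>i\<in>Basis. \<forall>j\<in>Basis. smooth_on (\<phi> ` U) (q i j)"
    "\<forall>f\<in>Cinf A. \<forall>h\<in>Cinf A. \<forall>y\<in>\<phi> ` U.
           in_chart U \<phi> (G f h) y =
             (\<Sum>i\<in>Basis. \<Sum>j\<in>Basis. q i j y *
                dir_deriv i (in_chart U \<phi> f) y * dir_deriv j (in_chart U \<phi> h) y)"
    using smooth_form U unfolding smooth_bilinear_form_def by fast
  have "represents_form U \<phi> q"
    unfolding represents_form_def bilinear_expr_def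
    using q chart(5)[OF U] by (simp add: in_chart_def comp_def)
  then show ?thesis by blast
qed

lemma form_at:
  obtains U \<phi> q where "(U, \<phi>) \<in> A" "x \<in> U" "represents_form U \<phi> q"
  using chart_around[of x] represents_form_exists by metis

lemma form_CinfT:
  assumes v: "v \<in> CinfT A" and w: "w \<in> CinfT A"
  shows "(\<lambda>x t. G (\<lambda>y. v y t) (\<lambda>y. w y t) x) \<in> CinfT A"
proof (rule CinfTI)
  fix U and \<phi> :: "'m \<Rightarrow> 'e" assume U: "(U, \<phi>) \<in> A"
  note c = chart[OF U]
  note O = chart_dom_open[OF U]
  let ?V = "\<lambda>p. v (inv_into U \<phi> (fst p)) (snd p)" and ?W = "\<lambda>p. w (inv_into U \<phi> (fst p)) (snd p)"
  note V = CinfTD[OF v U] and W = CinfTD[OF w U]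
  obtain q where q: "represents_form U \<phi> q" using represents_form_exists[OF U] by blast
  show "smooth_on (\<phi> ` U \<times> {0<..}) (\<lambda>p. G (\<lambda>y. v y (snd p)) (\<lambda>y. w y (snd p)) (inv_into U \<phi> (fst p)))"
  proof (rule smooth_on_cong[OF O])
    show "smooth_on (\<phi> ` U \<times> {0<..})
      (\<lambda>p. \<Sum>i\<in>Basis. \<Sum>j\<in>Basis. q i j (fst p) * dir_deriv (i, 0) ?V p * dir_deriv (j, 0) ?W p)"
      by (intro smooth_on_sum smooth_on_mult smooth_on_dir_deriv smooth_on_fst O V W represents_formD(1)[OF q] c(2) open_greaterThan)
    show "(\<Sum>i\<in>Basis. \<Sum>j\<in>Basis. q i j (fst p) * dir_deriv (i, 0) ?V p * dir_deriv (j, 0) ?W p) =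
       G (\<lambda>y. v y (snd p)) (\<lambda>y. w y (snd p)) (inv_into U \<phi> (fst p))"
      if p: "p \<in> \<phi> ` U \<times> {0<..}" for p
    proof -
      have y: "fst p \<in> \<phi> ` U" "snd p \<in> {0<..}" using p by auto
      show ?thesis
        using bilinear_expr_slice[OF y V W, of q] y(2)
        by (simp add: represents_formD(2)[OF q CinfT_slice[OF v] CinfT_slice[OF w] c(7)[OF y(1)]] c(6)[OF y(1)])
    qed
  qed
qed

lemma form_Cinf: "f \<in> Cinf A \<Longrightarrow> h \<in> Cinf A \<Longrightarrow> G f h \<in> Cinf A"
  by (rule Cinf_from_static) (rule form_CinfT[OF CinfT_static CinfT_static])

lemma form_time_derivative:
  assumes v: "v \<in> CinfT A" "\<And>x t. t > 0 \<Longrightarrow> ((\<lambda>s. v x s) has_real_derivative v' x t) (at t)"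
    and w: "w \<in> CinfT A" "\<And>x t. t > 0 \<Longrightarrow> ((\<lambda>s. w x s) has_real_derivative w' x t) (at t)"
    and t: "t > 0"
  shows "((\<lambda>s. G (\<lambda>y. v y s) (\<lambda>y. w y s) x) has_real_derivative
     G (\<lambda>y. v' y t) (\<lambda>y. w y t) x + G (\<lambda>y. v y t) (\<lambda>y. w' y t) x) (at t)"
proof -
  obtain U \<phi> q where U: "(U, \<phi>) \<in> A" "x \<in> U" and
    q: "represents_form U \<phi> q"
    by (rule form_at)
  let ?V = "\<lambda>p. v (inv_into U \<phi> (fst p)) (snd p)" and ?W = "\<lambda>p. w (inv_into U \<phi> (fst p)) (snd p)"
  note c = chart[OF U(1)]
  have y: "\<phi> x \<in> \<phi> ` U" using U by simp
  have tT: "t \<in> {0<..}" using t by simp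
  note V = CinfTD[OF v(1) U(1)] and W = CinfTD[OF w(1) U(1)]
  note sl = smooth_on_slice[OF c(2) tT]
  note eq = CinfT_time_derivative_eq[OF _ _ U(1), of _ _ "(_, t)"]
  have e1: "bilinear_expr q (\<lambda>y. dir_deriv (0, 1) ?V (y, t)) (\<lambda>y. w (inv_into U \<phi> y) t) (\<phi> x)
      = G (\<lambda>y. v' y t) (\<lambda>y. w y t) x"
    using bilinear_expr_cong[OF c(2) y sl[OF smooth_on_dir_deriv[OF V]] sl[OF W], where f' = "\<lambda>y. v' (inv_into U \<phi> y) t"
        and h' = "\<lambda>y. w (inv_into U \<phi> y) t"] eq[OF v] t
    by (simp add: represents_formD(2)[OF q CinfT_slice[OF CinfT_time_derivative[OF v] t] CinfT_slice[OF w(1) t] U(2)])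
  have e2: "bilinear_expr q (\<lambda>y. v (inv_into U \<phi> y) t) (\<lambda>y. dir_deriv (0, 1) ?W (y, t)) (\<phi> x)
      = G (\<lambda>y. v y t) (\<lambda>y. w' y t) x"
    using bilinear_expr_cong[OF c(2) y sl[OF V] sl[OF smooth_on_dir_deriv[OF W]], where f' = "\<lambda>y. v (inv_into U \<phi> y) t"
        and h' = "\<lambda>y. w' (inv_into U \<phi> y) t"] eq[OF w] t
    by (simp add: represents_formD(2)[OF q CinfT_slice[OF v(1) t] CinfT_slice[OF CinfT_time_derivative[OF w] t] U(2)])
  have D: "((\<lambda>s. bilinear_expr q (\<lambda>y. v (inv_into U \<phi> y) s) (\<lambda>y. w (inv_into U \<phi> y) s) (\<phi> x)) has_real_derivative
     G (\<lambda>y. v' y t) (\<lambda>y. w y t) x + G (\<lambda>y. v y t) (\<lambda>y. w' y t) x) (at t)"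
    using bilinear_expr_time_derivative[OF c(2) y open_greaterThan tT V W, of q] e1 e2 by simp
  show ?thesis
    by (rule has_field_derivative_transform_within_open[OF D open_greaterThan tT])
       (simp add: represents_formD(2)[OF q CinfT_slice[OF v(1)] CinfT_slice[OF w(1)] U(2)])
qed

lemma form_add:
  assumes f: "f \<in> Cinf A" "g \<in> Cinf A" "h \<in> Cinf A"
  shows "G h (\<lambda>y. f y + g y) x = G h f x + G h g x"
proof -
  obtain U \<phi> q where U: "(U, \<phi>) \<in> A" "x \<in> U" and
    q: "represents_form U \<phi> q"
    by (rule form_at)
  show ?thesis
    using U bilinear_expr_add[OF imageI[OF U(2)] CinfD[OF f(1) U(1)] CinfD[OF f(2) U(1)]]
    by (simp add: represents_formD(2)[OF q] f Cinf_add)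
qed

lemma form_mult:
  assumes f: "f \<in> Cinf A" "g \<in> Cinf A" "h \<in> Cinf A"
  shows "G (\<lambda>y. f y * g y) h x = f x * G g h x + g x * G f h x"
proof -
  obtain U \<phi> q where U: "(U, \<phi>) \<in> A" "x \<in> U" and
    q: "represents_form U \<phi> q"
    by (rule form_at)
  show ?thesis
    using U bilinear_expr_mult[OF imageI[OF U(2)] CinfD[OF f(1) U(1)] CinfD[OF f(2) U(1)]]
    by (simp add: represents_formD(2)[OF q] f Cinf_mult chart(5)[OF U(1)])
qed

lemma form_exp:
  assumes f: "f \<in> Cinf A" "h \<in> Cinf A"
  shows "G (\<lambda>y. exp (f y)) h x = exp (f x) * G f h x"
proof -
  obtain U \<phi> q where U: "(U, \<phi>) \<in> A" "x \<in> U" and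
    q: "represents_form U \<phi> q"
    by (rule form_at)
  show ?thesis
    using U bilinear_expr_exp[OF imageI[OF U(2)] CinfD[OF f(1) U(1)]]
    by (simp add: represents_formD(2)[OF q] f Cinf_exp chart(5)[OF U(1)])
qed

lemma form_const:
  assumes f: "h \<in> Cinf A" shows "G (\<lambda>_. r) h x = 0"
proof -
  obtain U \<phi> q where U: "(U, \<phi>) \<in> A" "x \<in> U" and
    q: "represents_form U \<phi> q"
    by (rule form_at)
  show ?thesis
    using U by (simp add: represents_formD(2)[OF q] f Cinf_const bilinear_expr_const)
qed

lemma form_local:
  assumes f: "f \<in> Cinf A" "h \<in> Cinf A" "f' \<in> Cinf A" "h' \<in> Cinf A"
    and V: "open V" "x \<in> V" "\<And>y. y \<in> V \<Longrightarrow> f y = f' y" "\<And>y. y \<in> V \<Longrightarrow> h y = h' y"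
  shows "G f h x = G f' h' x"
proof -
  obtain U \<phi> q where U: "(U, \<phi>) \<in> A" "x \<in> U" and
    q: "represents_form U \<phi> q"
    by (rule form_at)
  have sm: "smooth_on (\<phi> ` (U \<inter> V)) (\<lambda>y. f (inv_into U \<phi> y))" if "f \<in> Cinf A" for f
    using CinfD[OF that U(1)] by (auto simp: smooth_on_def intro: Ck_on_subset)
  have "bilinear_expr q (\<lambda>y. f (inv_into U \<phi> y)) (\<lambda>y. h (inv_into U \<phi> y)) (\<phi> x)
      = bilinear_expr q (\<lambda>y. f' (inv_into U \<phi> y)) (\<lambda>y. h' (inv_into U \<phi> y)) (\<phi> x)"
    by (rule bilinear_expr_cong[OF chart_image_open[OF U(1) V(1)] _ sm sm])
       (use U V f chart(5)[OF U(1)] in auto)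
  then show ?thesis by (simp add: represents_formD(2)[OF q] f U)
qed

end

locale diffusion = smooth_manifold A
  for A :: "('m::{t2_space, second_countable_topology}, 'e::euclidean_space) atlas" +
  fixes L :: "('m \<Rightarrow> real) \<Rightarrow> 'm \<Rightarrow> real"
  assumes diffusion: "diffusion_operator A L" and L_one: "\<And>x. L (\<lambda>_. 1) x = 0"
begin

abbreviation \<Gamma> :: "('m \<Rightarrow> real) \<Rightarrow> ('m \<Rightarrow> real) \<Rightarrow> 'm \<Rightarrow> real" where
  "\<Gamma> \<equiv> carre_du_champ L"

text \<open>
The coefficients of \<open>L\<close> in a chart. The zeroth order coefficient \<open>c\<close> vanishes because \<open>L 1 = 0\<close>.
\<close>

definition represents_operator ::
  "'m set \<Rightarrow> ('m \<Rightarrow> 'e) \<Rightarrow> ('e \<Rightarrow> 'e \<Rightarrow> 'e \<Rightarrow> real) \<Rightarrow> ('e \<Rightarrow> 'e \<Rightarrow> real) \<Rightarrow> ('e \<Rightarrow> real) \<Rightarrow> bool" where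
  "represents_operator U \<phi> a b c \<longleftrightarrow>
     (\<forall>i\<in>Basis. \<forall>j\<in>Basis. smooth_on (\<phi> ` U) (a i j)) \<and>
     (\<forall>i\<in>Basis. smooth_on (\<phi> ` U) (b i)) \<and> smooth_on (\<phi> ` U) c \<and>
     (\<forall>y\<in>\<phi> ` U. (\<forall>i\<in>Basis. \<forall>j\<in>Basis. a i j y = a j i y) \<and> c y = 0 \<and>
        (\<forall>\<xi>. 0 \<le> (\<Sum>i\<in>Basis. \<Sum>j\<in>Basis. a i j y * (\<xi> \<bullet> i) * (\<xi> \<bullet> j)))) \<and>
     (\<forall>f\<in>Cinf A. \<forall>x\<in>U. L f x = second_order_expr a b c (\<lambda>y. f (inv_into U \<phi> y)) (\<phi> x))"

lemma represents_operatorD: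
  assumes "represents_operator U \<phi> a b c"
  shows "i \<in> Basis \<Longrightarrow> j \<in> Basis \<Longrightarrow> smooth_on (\<phi> ` U) (a i j)"
    and "i \<in> Basis \<Longrightarrow> smooth_on (\<phi> ` U) (b i)"
    and "smooth_on (\<phi> ` U) c"
    and "y \<in> \<phi> ` U \<Longrightarrow> i \<in> Basis \<Longrightarrow> j \<in> Basis \<Longrightarrow> a i j y = a j i y"
    and "y \<in> \<phi> ` U \<Longrightarrow> c y = 0"
    and "y \<in> \<phi> ` U \<Longrightarrow> 0 \<le> (\<Sum>i\<in>Basis. \<Sum>j\<in>Basis. a i j y * (\<xi> \<bullet> i) * (\<xi> \<bullet> j))"
    and "f \<in> Cinf A \<Longrightarrow> x \<in> U \<Longrightarrow> L f x = second_order_expr a b c (\<lambda>y. f (inv_into U \<phi> y)) (\<phi> x)"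
  using assms unfolding represents_operator_def by blast+

lemma represents_operator_exists:
  assumes U: "(U, \<phi>) \<in> A" shows "\<exists>a b c. represents_operator U \<phi> a b c"
proof -
  obtain a :: "'e \<Rightarrow> 'e \<Rightarrow> 'e \<Rightarrow> real" and b :: "'e \<Rightarrow> 'e \<Rightarrow> real" and c :: "'e \<Rightarrow> real" where abc:
    "(\<forall>i\<in>Basis. \<forall>j\<in>Basis. smooth_on (\<phi> ` U) (a i j)) \<and>
        (\<forall>i\<in>Basis. smooth_on (\<phi> ` U) (b i)) \<and> smooth_on (\<phi> ` U) c \<and>
        (\<forall>y\<in>\<phi> ` U. (\<forall>i\<in>Basis. \<forall>j\<in>Basis. a i j y = a j i y) \<and>
           (\<forall>\<xi>. 0 \<le> (\<Sum>i\<in>Basis. \<Sum>j\<in>Basis. a i j y * (\<xi> \<bullet> i) * (\<xi> \<bullet> j)))) \<and>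
        (\<forall>f\<in>Cinf A. \<forall>y\<in>\<phi> ` U.
           in_chart U \<phi> (L f) y =
             (\<Sum>i\<in>Basis. \<Sum>j\<in>Basis. a i j y * dir_deriv i (dir_deriv j (in_chart U \<phi> f)) y) +
             (\<Sum>i\<in>Basis. b i y * dir_deriv i (in_chart U \<phi> f) y) +
             c y * in_chart U \<phi> f y)"
    using bspec[OF diffusion[unfolded diffusion_operator_def] U, unfolded prod.case] by (elim exE) (rule that)
  have L: "L f x = second_order_expr a b c (\<lambda>y. f (inv_into U \<phi> y)) (\<phi> x)"
    if "f \<in> Cinf A" "x \<in> U" for f x
    using conjunct2[OF conjunct2[OF conjunct2[OF conjunct2[OF abc]]], rule_format, OF that(1) imageI[OF that(2)]]
    unfolding second_order_expr_def by (simp add: in_chart_def comp_def chart(5)[OF U that(2)])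
  have "c y = 0" if "y \<in> \<phi> ` U" for y
    using L[OF Cinf_const[of 1], of "inv_into U \<phi> y"] chart(6,7)[OF U that]
    by (simp add: L_one second_order_expr_const)
  with abc L have "represents_operator U \<phi> a b c"
    unfolding represents_operator_def by simp
  then show ?thesis by blast
qed

lemma L_at:
  obtains U \<phi> a b c where "(U, \<phi>) \<in> A" "x \<in> U" "represents_operator U \<phi> a b c"
  using chart_around[of x] represents_operator_exists by metis

lemma L_CinfT:
  assumes w: "w \<in> CinfT A" shows "(\<lambda>x t. L (\<lambda>y. w y t) x) \<in> CinfT A"
proof (rule CinfTI)
  fix U and \<phi> :: "'m \<Rightarrow> 'e" assume U: "(U, \<phi>) \<in> A"
  note c = chart[OF U]
  note O = chart_dom_open[OF U]
  let ?W = "\<lambda>p. w (inv_into U \<phi> (fst p)) (snd p)"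
  note W = CinfTD[OF w U]
  obtain a b e where q: "represents_operator U \<phi> a b e" using represents_operator_exists[OF U] by blast
  show "smooth_on (\<phi> ` U \<times> {0<..}) (\<lambda>p. L (\<lambda>y. w y (snd p)) (inv_into U \<phi> (fst p)))"
  proof (rule smooth_on_cong[OF O])
    show "smooth_on (\<phi> ` U \<times> {0<..})
      (\<lambda>p. (\<Sum>i\<in>Basis. \<Sum>j\<in>Basis. a i j (fst p) * dir_deriv (i, 0) (dir_deriv (j, 0) ?W) p) +
         (\<Sum>i\<in>Basis. b i (fst p) * dir_deriv (i, 0) ?W p) + e (fst p) * ?W p)"
      by (intro smooth_on_add smooth_on_sum smooth_on_mult smooth_on_dir_deriv smooth_on_fst
          O W represents_operatorD(1-3)[OF q] c(2) open_greaterThan)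
    show "(\<Sum>i\<in>Basis. \<Sum>j\<in>Basis. a i j (fst p) * dir_deriv (i, 0) (dir_deriv (j, 0) ?W) p) +
         (\<Sum>i\<in>Basis. b i (fst p) * dir_deriv (i, 0) ?W p) + e (fst p) * ?W p =
       L (\<lambda>y. w y (snd p)) (inv_into U \<phi> (fst p))"
      if p: "p \<in> \<phi> ` U \<times> {0<..}" for p
    proof -
      have y: "fst p \<in> \<phi> ` U" "snd p \<in> {0<..}" using p by auto
      show ?thesis
        using second_order_expr_slice[OF c(2) y W, of a b e] y(2)
        by (simp add: represents_operatorD(7)[OF q CinfT_slice[OF w] c(7)[OF y(1)]] c(6)[OF y(1)])
    qed
  qed
qed

lemma L_Cinf: "f \<in> Cinf A \<Longrightarrow> L f \<in> Cinf A"
  by (rule Cinf_from_static) (rule L_CinfT[OF CinfT_static])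

lemma L_add:
  assumes f: "f \<in> Cinf A" "g \<in> Cinf A"
  shows "L (\<lambda>y. f y + g y) x = L f x + L g x"
proof -
  obtain U \<phi> a b e where U: "(U, \<phi>) \<in> A" "x \<in> U" and q: "represents_operator U \<phi> a b e"
    by (rule L_at)
  show ?thesis
    using U second_order_expr_add[OF chart(2)[OF U(1)] imageI[OF U(2)] CinfD[OF f(1) U(1)] CinfD[OF f(2) U(1)]]
    by (simp add: represents_operatorD(7)[OF q] f Cinf_add)
qed

lemma carre_du_champ_chart:
  assumes U: "(U, \<phi>) \<in> A" and x: "x \<in> U" and f: "f \<in> Cinf A" "h \<in> Cinf A"
    and q: "represents_operator U \<phi> a b c"
  shows "\<Gamma> f h x = bilinear_expr a (\<lambda>y. f (inv_into U \<phi> y)) (\<lambda>y. h (inv_into U \<phi> y)) (\<phi> x)"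
proof -
  have y: "\<phi> x \<in> \<phi> ` U" using x by simp
  show ?thesis
    using second_order_expr_mult[where a = a and b = b and c = c, OF chart(2)[OF U] y CinfD[OF f(1) U]
        CinfD[OF f(2) U] represents_operatorD(4)[OF q y]]
    unfolding carre_du_champ_def
    by (simp add: represents_operatorD(7)[OF q _ x] f Cinf_mult represents_operatorD(5)[OF q y] chart(5)[OF U x])
qed

text \<open>
The carre du champ is the principal part of \<open>L\<close>. Hence it is an instance of the bilinear forms above,
and the rules for \<open>\<Gamma>\<^sup>Z\<close> apply to it as well.
\<close>

lemma smooth_bilinear_form_carre_du_champ: "smooth_bilinear_form A \<Gamma>"
  unfolding smooth_bilinear_form_def
proof safe
  fix U and \<phi> :: "'m \<Rightarrow> 'e" assume U: "(U, \<phi>) \<in> A"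
  obtain a b c where q: "represents_operator U \<phi> a b c" using represents_operator_exists[OF U] by blast
  have "in_chart U \<phi> (\<Gamma> f h) (\<phi> x) = (\<Sum>i\<in>Basis. \<Sum>j\<in>Basis. a i j (\<phi> x) *
                dir_deriv i (in_chart U \<phi> f) (\<phi> x) * dir_deriv j (in_chart U \<phi> h) (\<phi> x))"
    if "f \<in> Cinf A" "h \<in> Cinf A" "x \<in> U" for f h x
    using carre_du_champ_chart[OF U that(3,1,2) q] that(3)
    by (simp add: chart(5)[OF U] bilinear_expr_def in_chart_def comp_def)
  then show "\<exists>q :: 'e \<Rightarrow> 'e \<Rightarrow> 'e \<Rightarrow> real.
        (\<forall>i\<in>Basis. \<forall>j\<in>Basis. smooth_on (\<phi> ` U) (q i j)) \<and>
        (\<forall>f\<in>Cinf A. \<forall>h\<in>Cinf A. \<forall>y\<in>\<phi> ` U.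
           in_chart U \<phi> (\<Gamma> f h) y =
             (\<Sum>i\<in>Basis. \<Sum>j\<in>Basis. q i j y *
                dir_deriv i (in_chart U \<phi> f) y * dir_deriv j (in_chart U \<phi> h) y))"
    using represents_operatorD(1)[OF q] by (intro exI[of _ a]) auto
qed

sublocale \<Gamma>: bilinear_form A \<Gamma>
  by unfold_locales (rule smooth_bilinear_form_carre_du_champ)

lemma carre_du_champ_commute: "\<Gamma> f h x = \<Gamma> h f x"
  by (simp add: carre_du_champ_def mult.commute)

lemma carre_du_champ_nonneg:
  assumes f: "f \<in> Cinf A" shows "0 \<le> \<Gamma> f f x"
proof -
  obtain U \<phi> a b c where U: "(U, \<phi>) \<in> A" "x \<in> U" and q: "represents_operator U \<phi> a b c"
    by (rule L_at)
  have "\<Gamma> f f x = bilinear_expr a (\<lambda>y. f (inv_into U \<phi> y)) (\<lambda>y. f (inv_into U \<phi> y)) (\<phi> x)"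
    by (rule carre_du_champ_chart[OF U f f q])
  then show ?thesis using bilinear_expr_nonneg[of a "\<phi> x", OF represents_operatorD(6)[OF q imageI[OF U(2)]]] by simp
qed

lemma L_mult: "L (\<lambda>y. f y * h y) x = f x * L h x + h x * L f x + 2 * \<Gamma> f h x"
  by (simp add: carre_du_champ_def field_simps)

lemma L_const: "L (\<lambda>_. r) x = 0"
proof -
  obtain U \<phi> a b c where U: "(U, \<phi>) \<in> A" "x \<in> U" and q: "represents_operator U \<phi> a b c"
    by (rule L_at)
  show ?thesis using represents_operatorD(5)[OF q imageI[OF U(2)]]
    by (simp add: represents_operatorD(7)[OF q _ U(2)] Cinf_const second_order_expr_const)
qed

lemma L_exp:
  assumes f: "f \<in> Cinf A"
  shows "L (\<lambda>y. exp (f y)) x = exp (f x) * (L f x + \<Gamma> f f x)"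
proof -
  obtain U \<phi> a b c where U: "(U, \<phi>) \<in> A" "x \<in> U" and q: "represents_operator U \<phi> a b c"
    by (rule L_at)
  have "\<Gamma> f f x = bilinear_expr a (\<lambda>y. f (inv_into U \<phi> y)) (\<lambda>y. f (inv_into U \<phi> y)) (\<phi> x)"
    by (rule carre_du_champ_chart[OF U f f q])
  then show ?thesis
    using second_order_expr_exp[OF chart(2)[OF U(1)] imageI[OF U(2)] CinfD[OF f U(1)], of c a b] represents_operatorD(5)[OF q imageI[OF U(2)]]
    by (simp add: represents_operatorD(7)[OF q _ U(2)] f Cinf_exp chart(5)[OF U])
qed

end

section \<open>Bump functions and integration\<close>

context smooth_manifold
begin

text \<open>
Near \<open>x\<close> the bump is a flat exponential of the distance in a chart. It extends smoothly by zero because it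
vanishes outside the image of a compact ball, which is closed in the whole manifold.
\<close>

lemma Cinf_bump:
  assumes W: "open W" "x \<in> W"
  obtains h where "h \<in> Cinf A" "h x > 0" "\<And>y. y \<notin> W \<Longrightarrow> h y = 0"
proof -
  obtain U \<phi> where U: "(U, \<phi>) \<in> A" "x \<in> U" by (rule chart_around)
  note c = chart[OF U(1)]
  have "open (\<phi> ` (U \<inter> W))" "\<phi> x \<in> \<phi> ` (U \<inter> W)"
    using chart_image_open[OF U(1) W(1)] U W by auto
  then obtain r where r: "r > 0" "cball (\<phi> x) r \<subseteq> \<phi> ` (U \<inter> W)"
    using open_contains_cball by blast
  define b where "b = (\<lambda>y. flat_exp 0 (r\<^sup>2 - (y - \<phi> x) \<bullet> (y - \<phi> x)))"
  define h where "h = (\<lambda>z. if z \<in> U then b (\<phi> z) else 0)"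
  have b0: "b y = 0" if "y \<notin> cball (\<phi> x) r" for y
  proof -
    have "norm (y - \<phi> x) > r" using that by (simp add: dist_norm norm_minus_commute)
    then have "(norm (y - \<phi> x))\<^sup>2 > r\<^sup>2" using r(1) by (intro power_strict_mono) auto
    then show ?thesis by (simp add: b_def flat_exp_def power2_norm_eq_inner)
  qed
  define K where "K = inv_into U \<phi> ` cball (\<phi> x) r"
  have rU: "cball (\<phi> x) r \<subseteq> \<phi> ` U" using r(2) by auto
  have "compact K"
    unfolding K_def by (rule compact_continuous_image[OF continuous_on_subset[OF c(4) rU] compact_cball])
  then have K: "closed K" by (rule compact_imp_closed)
  have KU: "K \<subseteq> U" using c(7) rU by (auto simp: K_def)
  have hK: "h z = 0" if "z \<notin> K" for z
  proof (cases "z \<in> U")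
    case True
    then have "\<phi> z \<notin> cball (\<phi> x) r" using that c(5)[OF True] unfolding K_def by (metis imageI)
    then show ?thesis by (simp add: h_def b0)
  qed (simp add: h_def)
  have "h \<in> Cinf A"
  proof (rule CinfI)
    fix V and \<psi> :: "'m \<Rightarrow> 'e" assume V: "(V, \<psi>) \<in> A"
    note cV = chart[OF V]
    show "smooth_on (\<psi> ` V) (\<lambda>y. h (inv_into V \<psi> y))"
    proof (rule smooth_on_locally)
      fix y assume y: "y \<in> \<psi> ` V"
      show "\<exists>T. open T \<and> y \<in> T \<and> smooth_on T (\<lambda>y. h (inv_into V \<psi> y))"
      proof (cases "inv_into V \<psi> y \<in> U")
        case True
        have T: "open (\<psi> ` (V \<inter> U))" by (rule chart_image_open[OF V c(1)])
        have "smooth_on (\<psi> ` (V \<inter> U)) (\<lambda>y. b ((\<phi> \<circ> inv_into V \<psi>) y))"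
          unfolding b_def
          by (rule smooth_on_compose[OF T open_UNIV smooth_bump chart_transition[OF V U(1)] subset_UNIV])
        then have "smooth_on (\<psi> ` (V \<inter> U)) (\<lambda>y. h (inv_into V \<psi> y))"
          by (rule smooth_on_cong[OF T, rotated]) (auto simp: h_def cV(5))
        moreover have "y \<in> \<psi> ` (V \<inter> U)"
          using True cV(6,7)[OF y] by (metis IntI imageI)
        ultimately show ?thesis using T by blast
      next
        case False
        have T: "open (\<psi> ` (V \<inter> - K))" by (rule chart_image_open[OF V]) (use K in auto)
        have "smooth_on (\<psi> ` (V \<inter> - K)) (\<lambda>y. h (inv_into V \<psi> y))"
          by (rule smooth_on_cong[OF T _ smooth_on_const[of _ 0]]) (auto simp: hK cV(5))
        moreover have "y \<in> \<psi> ` (V \<inter> - K)"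
          using False KU cV(6,7)[OF y] by (metis Compl_iff IntI imageI subsetD)
        ultimately show ?thesis using T by blast
      qed
    qed
  qed
  moreover have "h x > 0" using U r by (simp add: h_def b_def flat_exp_def)
  moreover have "h y = 0" if "y \<notin> W" for y
  proof (cases "y \<in> U")
    case True
    have "\<phi> y \<notin> \<phi> ` (U \<inter> W)"
    proof
      assume "\<phi> y \<in> \<phi> ` (U \<inter> W)"
      then obtain z where z: "z \<in> U" "z \<in> W" "\<phi> y = \<phi> z" by auto
      from c(5)[OF z(1)] have "y = z" unfolding z(3)[symmetric] c(5)[OF True] .
      then show False using that z(2) by simp
    qed
    then have "\<phi> y \<notin> cball (\<phi> x) r" using r(2) by blast
    from b0[OF this] show ?thesis by (simp add: h_def)
  qed (simp add: h_def)
  ultimately show thesis using that by blast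
qed

end

locale symmetric_diffusion = diffusion A L
  for A :: "('m::{t2_space, second_countable_topology}, 'e::euclidean_space) atlas" and L +
  fixes \<mu> :: "'m measure"
  assumes compact: "compact (UNIV :: 'm set)"
    and smooth_measure: "smooth_measure A \<mu>" and prob: "prob_space \<mu>"
    and symmetric: "f \<in> Cinf A \<Longrightarrow> h \<in> Cinf A \<Longrightarrow> (LINT x|\<mu>. f x * L h x) = (LINT x|\<mu>. h x * L f x)"
begin

sublocale prob_space \<mu> by (rule prob)

lemma sets_eq_borel: "sets \<mu> = sets borel"
  using smooth_measure by (simp add: smooth_measure_def)

lemma continuous_integrable:
  fixes f :: "'m \<Rightarrow> real"
  assumes f: "continuous_on UNIV f" shows "integrable \<mu> f"
proof -
  have "bounded (range f)"
    using compact_continuous_image[OF f compact] compact_imp_bounded by blast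
  then obtain B where B: "\<And>x. norm (f x) \<le> B" by (auto simp: bounded_iff)
  have "f \<in> borel_measurable \<mu>"
    using borel_measurable_continuous_onI[OF f] measurable_cong_sets[OF sets_eq_borel refl] by blast
  then show ?thesis by (rule integrable_const_bound[OF AE_I2[OF B]])
qed

lemma Cinf_integrable: "f \<in> Cinf A \<Longrightarrow> integrable \<mu> f"
  by (rule continuous_integrable[OF Cinf_continuous])

lemma integral_L:
  assumes f: "f \<in> Cinf A" shows "(LINT x|\<mu>. L f x) = 0"
  using symmetric[OF Cinf_const[of 1] f] by (simp add: L_one)

lemma CinfT_bounded:
  assumes w: "w \<in> CinfT A" and ab: "0 < a"
  obtains C where "\<And>x s. a \<le> s \<Longrightarrow> s \<le> b \<Longrightarrow> \<bar>w x s\<bar> \<le> C"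
proof -
  have "compact ((UNIV :: 'm set) \<times> {a..b})" by (intro compact_Times compact compact_Icc)
  moreover have "continuous_on ((UNIV :: 'm set) \<times> {a..b}) (\<lambda>p. w (fst p) (snd p))"
    by (rule continuous_on_subset[OF CinfT_continuous[OF w]]) (use ab in auto)
  ultimately have "bounded ((\<lambda>p. w (fst p) (snd p)) ` (UNIV \<times> {a..b}))"
    by (intro compact_imp_bounded compact_continuous_image)
  then obtain C where "\<forall>y\<in>(\<lambda>p. w (fst p) (snd p)) ` (UNIV \<times> {a..b}). norm y \<le> C"
    unfolding bounded_iff by blast
  then show thesis by (intro that[of C]) force
qed

text \<open>
By compactness of the manifold the time derivative is bounded on compact intervals of positive times, so
the difference quotients are dominated by a constant.
\<close>

lemma integral_time_derivative:
  assumes w: "w \<in> CinfT A" and w': "\<And>x t. t > 0 \<Longrightarrow> ((\<lambda>s. w x s) has_real_derivative w' x t) (at t)"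
    and t: "t > 0"
  shows "((\<lambda>s. LINT x|\<mu>. w x s) has_real_derivative (LINT x|\<mu>. w' x t)) (at t)"
proof -
  define S where "S = {t/2<..<2*t}"
  have S: "open S" "t \<in> S" "convex S" "\<And>s. s \<in> S \<Longrightarrow> s > 0" using t by (auto simp: S_def)
  have at: "at t within S = at t" by (rule at_within_open[OF S(2,1)])
  note w'T = CinfT_time_derivative[OF w w']
  obtain C where C: "\<And>x s. t/2 \<le> s \<Longrightarrow> s \<le> 2*t \<Longrightarrow> \<bar>w' x s\<bar> \<le> C"
    using CinfT_bounded[OF w'T, of "t/2" "2*t"] t by auto
  have int: "integrable \<mu> (\<lambda>x. w x s)" if "s > 0" for s
    by (rule Cinf_integrable[OF CinfT_slice[OF w that]])
  have lip: "\<bar>w x s - w x t\<bar> \<le> C * \<bar>s - t\<bar>" if s: "s \<in> S" for x s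
  proof -
    have "norm (w x s - w x t) \<le> C * norm (s - t)"
    proof (rule field_differentiable_bound[OF S(3) _ _ s S(2), where f' = "w' x"])
      show "(w x has_field_derivative w' x z) (at z within S)" if "z \<in> S" for z
        by (rule has_field_derivative_at_within[OF w'[OF S(4)[OF that]]])
      show "norm (w' x z) \<le> C" if "z \<in> S" for z
        using C[of z x] that by (simp add: S_def)
    qed
    then show ?thesis by simp
  qed
  have "((\<lambda>y. ((LINT x|\<mu>. w x y) - (LINT x|\<mu>. w x t)) / (y - t)) \<longlongrightarrow> (LINT x|\<mu>. w' x t)) (at t within S)"
    unfolding tendsto_at_iff_sequentially
  proof (intro allI impI)
    fix X assume X: "\<forall>i. X i \<in> S - {t}" "X \<longlonglongrightarrow> t"
    have "(\<lambda>i. LINT x|\<mu>. (w x (X i) - w x t) / (X i - t)) \<longlonglongrightarrow> (LINT x|\<mu>. w' x t)"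
    proof (rule integral_dominated_convergence[where w = "\<lambda>_. C"])
      show "(\<lambda>x. w' x t) \<in> borel_measurable \<mu>"
        using Cinf_integrable[OF CinfT_slice[OF w'T t]] by simp
      show "(\<lambda>x. (w x (X i) - w x t) / (X i - t)) \<in> borel_measurable \<mu>" for i
        using int[of "X i"] int[OF t] S(4)[of "X i"] X(1) by simp
      show "AE x in \<mu>. (\<lambda>i. (w x (X i) - w x t) / (X i - t)) \<longlonglongrightarrow> w' x t"
      proof (rule AE_I2)
        fix x
        have "((\<lambda>y. (w x y - w x t) / (y - t)) \<longlongrightarrow> w' x t) (at t within S)"
          using w'[OF t, of x] at by (simp add: has_field_derivative_iff)
        then show "(\<lambda>i. (w x (X i) - w x t) / (X i - t)) \<longlonglongrightarrow> w' x t"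
          using X unfolding tendsto_at_iff_sequentially by (simp add: comp_def)
      qed
      show "AE x in \<mu>. norm ((w x (X i) - w x t) / (X i - t)) \<le> C" for i
        using lip[of "X i"] X(1) by (intro AE_I2) (simp add: divide_le_eq)
    qed simp
    moreover have "(LINT x|\<mu>. (w x (X i) - w x t) / (X i - t)) = ((LINT x|\<mu>. w x (X i)) - (LINT x|\<mu>. w x t)) / (X i - t)" for i
      using int[of "X i"] int[OF t] S(4)[of "X i"] X(1) by simp
    ultimately show "((\<lambda>y. ((LINT x|\<mu>. w x y) - (LINT x|\<mu>. w x t)) / (y - t)) \<circ> X) \<longlonglongrightarrow> (LINT x|\<mu>. w' x t)"
      by (simp only: comp_def)
  qed
  then show ?thesis using at by (simp add: has_field_derivative_iff)
qed

text \<open>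
The density in a chart is positive, so nonempty open sets have positive measure.
\<close>

lemma integral_zero_imp_zero:
  fixes f :: "'m \<Rightarrow> real"
  assumes f: "continuous_on UNIV f" "\<And>x. 0 \<le> f x" and 0: "(LINT x|\<mu>. f x) = 0"
  shows "f x = 0"
proof (rule ccontr)
  assume "f x \<noteq> 0"
  then have fx: "f x > 0" using f(2)[of x] by simp
  obtain U \<phi> where U: "(U, \<phi>) \<in> A" "x \<in> U" by (rule chart_around)
  note c = chart[OF U(1)]
  define P where "P = {x. f x > 0}"
  have P: "open P" unfolding P_def using f(1) by (intro open_Collect_less) (auto intro: continuous_on_const)
  define B where "B = U \<inter> P"
  have B: "open B" "B \<subseteq> U" "open (\<phi> ` B)" "\<phi> x \<in> \<phi> ` B"
    using P c(1) chart_image_open[OF U(1) P] U fx by (auto simp: B_def P_def)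
  have "AE x in \<mu>. f x = 0"
    using integral_nonneg_eq_0_iff_AE[OF continuous_integrable[OF f(1)]] f(2) 0 by simp
  then have "AE x in \<mu>. x \<notin> B" by (rule AE_mp) (auto simp: B_def P_def)
  then have muB: "emeasure \<mu> B = 0"
    using B(1) sets_eq_borel by (subst (asm) AE_iff_null_sets[symmetric]) auto
  obtain w :: "'e \<Rightarrow> real" where w: "smooth_on (\<phi> ` U) w" "\<forall>y\<in>\<phi> ` U. 0 < w y"
    "\<forall>B\<in>sets borel. B \<subseteq> U \<longrightarrow> emeasure \<mu> B = (\<integral>\<^sup>+y\<in>\<phi> ` B. ennreal (w y) \<partial>lborel)"
    using smooth_measure U(1) unfolding smooth_measure_def by fast
  have sub: "\<phi> ` B \<subseteq> \<phi> ` U" using B(2) by auto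
  have "(\<lambda>y. indicator (\<phi> ` B) y *\<^sub>R w y) \<in> borel_measurable borel"
    by (rule borel_measurable_continuous_on_indicator)
       (use B(3) continuous_on_subset[OF smooth_on_imp_continuous[OF w(1)] sub] in auto)
  then have meas: "(\<lambda>y. ennreal (indicator (\<phi> ` B) y *\<^sub>R w y)) \<in> borel_measurable lborel"
    by simp
  have "(\<integral>\<^sup>+y. ennreal (indicator (\<phi> ` B) y *\<^sub>R w y) \<partial>lborel) = (\<integral>\<^sup>+y\<in>\<phi> ` B. ennreal (w y) \<partial>lborel)"
    by (intro nn_integral_cong) (auto simp: indicator_def)
  also have "\<dots> = 0" using w(3) B muB by auto
  finally have "AE y in lborel. ennreal (indicator (\<phi> ` B) y *\<^sub>R w y) = 0"
    using nn_integral_0_iff_AE[OF meas] by simp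
  then have ae: "AE y in lborel. y \<notin> \<phi> ` B"
    by (rule AE_mp) (use w(2) sub in \<open>force simp: indicator_def ennreal_eq_0_iff\<close>)
  obtain r where r: "r > 0" "ball (\<phi> x) r \<subseteq> \<phi> ` B" using B(3,4) open_contains_ball by blast
  from ae have "AE y in lborel. y \<notin> ball (\<phi> x) r" by (rule AE_mp) (use r in \<open>auto simp: subset_eq\<close>)
  then have "emeasure lborel (ball (\<phi> x) r) = 0"
    by (subst (asm) AE_iff_null_sets[symmetric]) auto
  then have "measure lborel (ball (\<phi> x) r) = 0" by (simp add: measure_def)
  then show False using content_ball_pos[OF r(1), of "\<phi> x"] by simp
qed

end

section \<open>Consequences of the curvature-dimension inequality\<close>

context bilinear_form
begin

lemma form_scale:
  assumes "f \<in> Cinf A" "h \<in> Cinf A" shows "G (\<lambda>y. r * f y) h x = r * G f h x"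
  using form_mult[OF Cinf_const[of r] assms] form_const[OF assms(2)] by simp

end

context diffusion
begin

text \<open>
The degenerate case of the Cauchy-Schwarz inequality: \<open>\<Gamma>(h + r f)\<close> is nonnegative and affine in \<open>r\<close>.
\<close>

lemma carre_du_champ_eq_0:
  assumes f: "f \<in> Cinf A" and h: "h \<in> Cinf A" and 0: "\<Gamma> f f x = 0"
  shows "\<Gamma> f h x = 0"
proof -
  \<comment> \<open>the quadratic term in \<open>r\<close> is absent because \<open>\<Gamma> f f x = 0\<close>\<close>
  have pos: "0 \<le> \<Gamma> h h x + 2 * r * \<Gamma> f h x" for r
  proof -
    have rf: "(\<lambda>y. r * f y) \<in> Cinf A" by (intro Cinf_mult Cinf_const f)
    have p: "(\<lambda>y. h y + r * f y) \<in> Cinf A" by (intro Cinf_add h rf)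
    have l: "\<Gamma> (\<lambda>y. h y + r * f y) g x = \<Gamma> h g x + r * \<Gamma> f g x" if "g \<in> Cinf A" for g
      using \<Gamma>.form_add[OF h rf that, of x] \<Gamma>.form_scale[OF f that, of r x]
      by (simp add: carre_du_champ_commute[of _ g])
    have "\<Gamma> (\<lambda>y. h y + r * f y) (\<lambda>y. h y + r * f y) x
        = \<Gamma> h h x + r * \<Gamma> h f x + r * (\<Gamma> f h x + r * \<Gamma> f f x)"
      using l[OF p] l[OF h] l[OF f]
      by (simp add: carre_du_champ_commute[of h "\<lambda>y. h y + r * f y"]
          carre_du_champ_commute[of f "\<lambda>y. h y + r * f y"] carre_du_champ_commute[of h f])
    then show ?thesis
      using carre_du_champ_nonneg[OF p, of x] 0 by (simp add: carre_du_champ_commute[of h f])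
  qed
  show ?thesis
  proof (rule ccontr)
    assume "\<Gamma> f h x \<noteq> 0"
    then show False
      using pos[of "- (\<Gamma> h h x + 1) / (2 * \<Gamma> f h x)"] by (simp add: field_simps)
  qed
qed

lemma L_mult_vanishing:
  assumes f: "f \<in> Cinf A" "h \<in> Cinf A" "q \<in> Cinf A" and 0: "f x = 0" "h x = 0"
  shows "L (\<lambda>y. f y * (h y * q y)) x = 2 * q x * \<Gamma> f h x"
  using \<Gamma>.form_mult[OF f(2,3,1), of x] 0
  by (simp add: L_mult carre_du_champ_commute[of f])

end

text \<open>
A diffusion operator together with a symmetric form. Both \<open>\<Gamma>\<^sup>Z\<close> and the carre du champ itself are
used in the role of \<open>G\<close>, so that \<open>\<Gamma>\<^sub>2\<close> and \<open>\<Gamma>\<^sub>2\<^sup>Z\<close> are treated by the same lemmas.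
\<close>

locale bilinear_form_pair = diffusion A L + Z: bilinear_form A G
  for A :: "('m::{t2_space, second_countable_topology}, 'e::euclidean_space) atlas" and L and G +
  assumes G_commute: "f \<in> Cinf A \<Longrightarrow> h \<in> Cinf A \<Longrightarrow> G f h x = G h f x"
begin

text \<open>
At a common zero of \<open>f\<close> and \<open>h\<close> the product has vanishing differential and Hessian \<open>df dh + dh df\<close>,
so only the part of the iterated form that is quadratic in the Hessian survives.
\<close>

lemma iterated_form_mult_vanishing:
  assumes f: "f \<in> Cinf A" and h: "h \<in> Cinf A" and 0: "f x = 0" "h x = 0"
  shows "iterated_form L G (\<lambda>y. f y * h y) x
    = \<Gamma> f f x * G h h x + 2 * \<Gamma> f h x * G f h x + \<Gamma> h h x * G f f x"
proof -
  have fh: "(\<lambda>y. f y * h y) \<in> Cinf A" by (rule Cinf_mult[OF f h])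
  have "G (\<lambda>y. f y * h y) (\<lambda>y. f y * h y) y
      = f y * (f y * G h h y) + f y * (h y * (2 * G f h y)) + h y * (h y * G f f y)" for y
    using Z.form_mult[OF f h fh, of y] Z.form_mult[OF f h h, of y] Z.form_mult[OF f h f, of y]
    by (simp add: G_commute[OF h fh] G_commute[OF f fh] G_commute[OF h f] algebra_simps)
  then have e: "G (\<lambda>y. f y * h y) (\<lambda>y. f y * h y)
      = (\<lambda>y. f y * (f y * G h h y) + f y * (h y * (2 * G f h y)) + h y * (h y * G f f y))"
    by (rule ext)
  have C: "G h h \<in> Cinf A" "G f f \<in> Cinf A" "(\<lambda>y. 2 * G f h y) \<in> Cinf A"
    by (auto intro!: Z.form_Cinf Cinf_mult Cinf_const f h)
  have "L (G (\<lambda>y. f y * h y) (\<lambda>y. f y * h y)) x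
      = L (\<lambda>y. f y * (f y * G h h y)) x + L (\<lambda>y. f y * (h y * (2 * G f h y))) x + L (\<lambda>y. h y * (h y * G f f y)) x"
    unfolding e
    by (subst L_add L_add, intro Cinf_add Cinf_mult C f h, intro Cinf_mult C f h)+ simp
  also have "\<dots> = 2 * (\<Gamma> f f x * G h h x + 2 * \<Gamma> f h x * G f h x + \<Gamma> h h x * G f f x)"
    by (simp add: L_mult_vanishing f h 0 C)
  finally have "L (G (\<lambda>y. f y * h y) (\<lambda>y. f y * h y)) x
    = 2 * (\<Gamma> f f x * G h h x + 2 * \<Gamma> f h x * G f h x + \<Gamma> h h x * G f f x)" .
  moreover have "G (\<lambda>y. f y * h y) (L (\<lambda>y. f y * h y)) x = 0"
    using Z.form_mult[OF f h L_Cinf[OF fh], of x] 0 by simp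
  ultimately show ?thesis by (simp add: iterated_form_def)
qed

lemma iterated_form_Cinf:
  assumes f: "f \<in> Cinf A" shows "iterated_form L G f \<in> Cinf A"
proof -
  have "(\<lambda>x. (1 / 2) * (L (G f f) x - 2 * G f (L f) x)) \<in> Cinf A"
    by (intro Cinf_mult Cinf_const Cinf_diff L_Cinf Z.form_Cinf f)
  moreover have "iterated_form L G f = (\<lambda>x. (1 / 2) * (L (G f f) x - 2 * G f (L f) x))"
    by (rule ext) (simp add: iterated_form_def)
  ultimately show ?thesis by (simp only:)
qed

lemma G_diff_const:
  assumes f: "f \<in> Cinf A" and h: "h \<in> Cinf A" shows "G (\<lambda>y. f y - r) h x = G f h x"
proof -
  have fr: "(\<lambda>y. f y + (- r)) \<in> Cinf A" by (intro Cinf_add Cinf_const f)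
  have "G h (\<lambda>y. f y + (- r)) x = G h f x + G h (\<lambda>_. - r) x"
    by (rule Z.form_add[OF f Cinf_const h])
  then show ?thesis
    using G_commute[OF h fr] G_commute[OF h f] G_commute[OF h Cinf_const] Z.form_const[OF h] by simp
qed

end

sublocale diffusion \<subseteq> \<Gamma>: bilinear_form_pair A L "carre_du_champ L"
  by unfold_locales (rule carre_du_champ_commute)

locale gen_curvature = symmetric_diffusion A L \<mu> + Z: bilinear_form_pair A L \<Gamma>Z
  for A :: "('m::{t2_space, second_countable_topology}, 'e::euclidean_space) atlas" and L and \<mu> and \<Gamma>Z +
  fixes \<rho>1 \<rho>2 k d :: real
  assumes commute: "f \<in> Cinf A \<Longrightarrow> \<Gamma> f (\<Gamma>Z f f) x = \<Gamma>Z f (\<Gamma> f f) x"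
    and \<rho>1: "\<rho>1 \<ge> 0" and \<rho>2: "\<rho>2 > 0" and k: "k \<ge> 0" and d: "d > 0"
    and gen_CD: "gen_CD A L \<Gamma>Z \<rho>1 \<rho>2 k d"
begin

lemma CD:
  assumes f: "f \<in> Cinf A" and \<nu>: "\<nu> > 0"
  shows "(L f x)\<^sup>2 / d - k / \<nu> * \<Gamma> f f x + \<rho>2 * \<Gamma>Z f f x
     \<le> iterated_form L \<Gamma> f x + \<nu> * iterated_form L \<Gamma>Z f x"
proof -
  have "1 / d * (L f x)\<^sup>2 + (\<rho>1 - k / \<nu>) * \<Gamma> f f x + \<rho>2 * \<Gamma>Z f f x
     \<le> iterated_form L \<Gamma> f x + \<nu> * iterated_form L \<Gamma>Z f x"
    using gen_CD f \<nu> unfolding gen_CD_def by blast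
  moreover have "0 \<le> \<rho>1 * \<Gamma> f f x" by (intro mult_nonneg_nonneg \<rho>1 carre_du_champ_nonneg f)
  ultimately show ?thesis by (simp add: algebra_simps)
qed

text \<open>
Only the term with \<open>\<Gamma>\<^sub>2\<^sup>Z\<close> grows linearly in \<open>\<nu>\<close>; the others stay bounded below as \<open>\<nu>\<close> tends to infinity.
\<close>

lemma iterated_Z_nonneg:
  assumes f: "f \<in> Cinf A" shows "0 \<le> iterated_form L \<Gamma>Z f x"
proof (rule ccontr)
  let ?b = "iterated_form L \<Gamma>Z f x"
  let ?c = "(L f x)\<^sup>2 / d - k * \<Gamma> f f x + \<rho>2 * \<Gamma>Z f f x - iterated_form L \<Gamma> f x"
  assume "\<not> 0 \<le> ?b"
  then have b: "?b < 0" by simp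
  have le: "?c \<le> \<nu> * ?b" if "\<nu> \<ge> 1" for \<nu>
  proof -
    have "k / \<nu> \<le> k" using that k by (simp add: divide_le_eq mult_le_cancel_left1)
    then have "k / \<nu> * \<Gamma> f f x \<le> k * \<Gamma> f f x"
      by (intro mult_right_mono carre_du_champ_nonneg f)
    then show ?thesis using CD[OF f, of \<nu> x] that by simp
  qed
  \<comment> \<open>large enough for the linear term in \<open>\<nu>\<close> to beat the constant \<open>c\<close>\<close>
  define \<nu> where "\<nu> = 1 + \<bar>?c\<bar> / (- ?b)"
  have "\<nu> \<ge> 1" using b by (simp add: \<nu>_def divide_nonneg_neg)
  moreover have "\<nu> * ?b = ?b - \<bar>?c\<bar>" using b by (simp add: \<nu>_def field_simps)
  ultimately show False using le[of \<nu>] b by linarith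
qed

text \<open>
Nonnegativity of \<open>\<Gamma>\<^sub>2\<^sup>Z\<close> is tested on products of functions shifted to vanish at \<open>x\<close>. If \<open>\<Gamma>(f)(x) > 0\<close>, the
square of \<open>f\<close> suffices and gives \<open>\<Gamma>(f) \<Gamma>\<^sup>Z(f) \<ge> 0\<close>. Otherwise \<open>\<Gamma>(f, h)(x) = 0\<close> by Cauchy-Schwarz, and the
product of \<open>f\<close> and \<open>h\<close> gives \<open>\<Gamma>(h) \<Gamma>\<^sup>Z(f) \<ge> 0\<close>.
\<close>

lemma Z_nonneg_where_elliptic:
  assumes f: "f \<in> Cinf A" and h: "h \<in> Cinf A" and pos: "\<Gamma> h h x > 0"
  shows "0 \<le> \<Gamma>Z f f x"
proof -
  have shift: "0 \<le> \<Gamma> f f x * \<Gamma>Z h h x + 2 * \<Gamma> f h x * \<Gamma>Z f h x + \<Gamma> h h x * \<Gamma>Z f f x"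
    if f: "f \<in> Cinf A" and h: "h \<in> Cinf A" for f h
  proof -
    have f0: "(\<lambda>y. f y - f x) \<in> Cinf A" and h0: "(\<lambda>y. h y - h x) \<in> Cinf A"
      by (intro Cinf_diff Cinf_const f h)+
    have eq: "\<Gamma> (\<lambda>y. f y - a) (\<lambda>y. h y - b) x = \<Gamma> f h x" "\<Gamma>Z (\<lambda>y. f y - a) (\<lambda>y. h y - b) x = \<Gamma>Z f h x"
      if f: "f \<in> Cinf A" and h: "h \<in> Cinf A" for f h a b
    proof -
      have h0: "(\<lambda>y. h y - b) \<in> Cinf A" by (intro Cinf_diff Cinf_const h)
      show "\<Gamma> (\<lambda>y. f y - a) (\<lambda>y. h y - b) x = \<Gamma> f h x"
        using \<Gamma>.G_diff_const[OF f h0] \<Gamma>.G_diff_const[OF h f] by (simp add: carre_du_champ_commute[of f])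
      show "\<Gamma>Z (\<lambda>y. f y - a) (\<lambda>y. h y - b) x = \<Gamma>Z f h x"
        using Z.G_diff_const[OF f h0] Z.G_diff_const[OF h f] Z.G_commute[OF f h0] Z.G_commute[OF f h] by simp
    qed
    show ?thesis
      using iterated_Z_nonneg[OF Cinf_mult[OF f0 h0], of x] Z.iterated_form_mult_vanishing[OF f0 h0, of x]
      by (simp add: eq f h)
  qed
  show ?thesis
  proof (cases "\<Gamma> f f x = 0")
    case True
    then show ?thesis
      using shift[OF f h] carre_du_champ_eq_0[OF f h True] pos by (simp add: zero_le_mult_iff)
  next
    case False
    then have "\<Gamma> f f x > 0" using carre_du_champ_nonneg[OF f, of x] by simp
    then show ?thesis using shift[OF f f] by (simp add: zero_le_mult_iff)
  qed
qed

text \<open>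
Where \<open>\<Gamma>\<close> vanishes, \<open>L\<close> is a derivation, hence antisymmetric up to a divergence; being symmetric as well, it is zero.
Concretely, if \<open>L f > 0\<close> somewhere, take a bump \<open>h\<close> supported where \<open>L f > 0\<close> and integrate \<open>L (f h\<^sup>2)\<close>.
The square of the bump is used because \<open>\<Gamma>(f, h\<^sup>2) = 2 h \<Gamma>(f, h)\<close> vanishes at every zero of \<open>h\<close>.
\<close>

lemma L_zero_where_degenerate:
  assumes V: "open V" "x \<in> V" and 0: "\<And>h y. h \<in> Cinf A \<Longrightarrow> y \<in> V \<Longrightarrow> \<Gamma> h h y = 0"
    and f: "f \<in> Cinf A"
  shows "L f x = 0"
proof -
  have "\<not> L f x > 0" if f: "f \<in> Cinf A" for f
  proof
    assume pos: "L f x > 0"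
    \<comment> \<open>the bump vanishes outside this set, so that the integrand below is nonnegative\<close>
    define W where "W = V \<inter> {y. L f y > 0}"
    have "open W"
      unfolding W_def using V Cinf_continuous[OF L_Cinf[OF f]]
      by (intro open_Int open_Collect_less) (auto intro: continuous_on_const)
    then obtain h where h: "h \<in> Cinf A" "h x > 0" "\<And>y. y \<notin> W \<Longrightarrow> h y = 0"
      using Cinf_bump[of W x] V pos by (auto simp: W_def)
    have hh: "(\<lambda>y. h y * h y) \<in> Cinf A" by (rule Cinf_mult[OF h(1,1)])
    have \<Gamma>0: "\<Gamma> f (\<lambda>y. h y * h y) y = 0" for y
    proof (cases "y \<in> V")
      case True
      then show ?thesis using carre_du_champ_eq_0[OF f hh] 0[OF f] by blast
    next
      case False
      then have "h y = 0" using h(3) by (auto simp: W_def)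
      then show ?thesis
        using \<Gamma>.form_mult[OF h(1,1) f, of y] by (simp add: carre_du_champ_commute[of f])
    qed
    have eq: "L (\<lambda>y. f y * (h y * h y)) y = f y * L (\<lambda>y. h y * h y) y + h y * h y * L f y" for y
      using L_mult[of f "\<lambda>y. h y * h y" y] \<Gamma>0 by simp
    have "0 = (LINT y|\<mu>. L (\<lambda>y. f y * (h y * h y)) y)"
      by (rule integral_L[OF Cinf_mult[OF f hh], symmetric])
    also have "\<dots> = (LINT y|\<mu>. f y * L (\<lambda>y. h y * h y) y) + (LINT y|\<mu>. h y * h y * L f y)"
      unfolding eq
      by (intro Bochner_Integration.integral_add Cinf_integrable Cinf_mult L_Cinf f hh)
    also have "\<dots> = 2 * (LINT y|\<mu>. h y * h y * L f y)"
      using symmetric[OF f hh] by simp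
    finally have int0: "(LINT y|\<mu>. h y * h y * L f y) = 0" by simp
    have "h x * h x * L f x = 0"
    proof (rule integral_zero_imp_zero[OF _ _ int0])
      show "continuous_on UNIV (\<lambda>y. h y * h y * L f y)"
        by (intro Cinf_continuous Cinf_mult L_Cinf f h)
      show "0 \<le> h y * h y * L f y" for y
        using h(3)[of y] by (cases "y \<in> W") (auto simp: W_def)
    qed
    then show False using h(2) pos by simp
  qed
  moreover have "L (\<lambda>y. - 1 * f y) x = - L f x"
  proof -
    have "\<Gamma> (\<lambda>_. - 1) f x = 0" by (rule \<Gamma>.form_const[OF f])
    then show ?thesis using L_mult[of "\<lambda>_. - 1" f x] by (simp add: L_const)
  qed
  moreover have "(\<lambda>y. - 1 * f y) \<in> Cinf A" by (intro Cinf_mult Cinf_const f)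
  ultimately show ?thesis using f by (metis linorder_neqE_linordered_idom neg_0_less_iff_less)
qed

text \<open>
The interior of the set where the operator is trivial. It replaces the interior of the zero set of the
principal symbol, with which it agrees by \<open>L_zero_where_degenerate\<close>, and makes locality immediate.
\<close>

definition degenerate :: "'m set" where
  "degenerate = {x. \<exists>V. open V \<and> x \<in> V \<and> (\<forall>h\<in>Cinf A. \<forall>y\<in>V. L h y = 0)}"

lemma open_degenerate: "open degenerate"
  unfolding open_subopen[of degenerate] by (auto simp: degenerate_def)

lemma L_degenerate: "x \<in> degenerate \<Longrightarrow> h \<in> Cinf A \<Longrightarrow> L h x = 0"
  by (auto simp: degenerate_def)

text \<open>
If \<open>\<Gamma>\<^sup>Z(f)\<close> is negative at a point, it is negative near it, so \<open>\<Gamma>\<close> vanishes on a whole neighborhood.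
\<close>

lemma Z_nonneg_nondegenerate:
  assumes f: "f \<in> Cinf A" and x: "x \<notin> degenerate" shows "0 \<le> \<Gamma>Z f f x"
proof (rule ccontr)
  assume neg: "\<not> 0 \<le> \<Gamma>Z f f x"
  define V where "V = {y. \<Gamma>Z f f y < 0}"
  have V: "open V" "x \<in> V"
    unfolding V_def using neg Cinf_continuous[OF Z.Z.form_Cinf[OF f f]]
    by (auto intro!: open_Collect_less continuous_on_const)
  have "\<Gamma> h h y = 0" if "h \<in> Cinf A" "y \<in> V" for h y
    using Z_nonneg_where_elliptic[OF f that(1), of y] carre_du_champ_nonneg[OF that(1), of y] that(2)
    by (force simp: V_def)
  then have "x \<in> degenerate"
    using L_zero_where_degenerate[OF V(1)] V unfolding degenerate_def by blast
  then show False using x by simp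
qed

lemma carre_du_champ_degenerate:
  "x \<in> degenerate \<Longrightarrow> f \<in> Cinf A \<Longrightarrow> h \<in> Cinf A \<Longrightarrow> \<Gamma> f h x = 0"
  by (simp add: carre_du_champ_def L_degenerate Cinf_mult)

lemma iterated_form_degenerate:
  assumes x: "x \<in> degenerate" and f: "f \<in> Cinf A"
  shows "iterated_form L \<Gamma> f x = 0" "iterated_form L \<Gamma>Z f x = 0"
proof -
  show "iterated_form L \<Gamma> f x = 0"
    using x f by (simp add: iterated_form_def L_degenerate carre_du_champ_degenerate \<Gamma>.form_Cinf L_Cinf)
  have "\<Gamma>Z f (L f) x = \<Gamma>Z f (\<lambda>_. 0) x"
    by (rule Z.Z.form_local[OF f L_Cinf[OF f] f Cinf_const open_degenerate x])
       (auto simp: L_degenerate f)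
  also have "\<dots> = 0"
    using Z.G_commute[OF f Cinf_const] Z.Z.form_const[OF f] by simp
  finally show "iterated_form L \<Gamma>Z f x = 0"
    using x f by (simp add: iterated_form_def L_degenerate Z.Z.form_Cinf)
qed

text \<open>
Every term of the curvature-dimension inequality except \<open>\<rho>\<^sub>2 \<Gamma>\<^sup>Z(f)\<close> is zero here.
\<close>

lemma Z_nonpos_degenerate:
  assumes x: "x \<in> degenerate" and f: "f \<in> Cinf A" shows "\<Gamma>Z f f x \<le> 0"
  using CD[OF f, of 1 x] iterated_form_degenerate[OF x f] L_degenerate[OF x f]
    carre_du_champ_degenerate[OF x f f] \<rho>2 by (simp add: mult_le_0_iff)

text \<open>
The curvature-dimension inequality survives when \<open>\<Gamma>\<^sup>Z\<close> is cut off to the set where it is nonnegative,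
because both sides are then zero on the degenerate set.
\<close>

lemma CD_nondegenerate:
  assumes f: "f \<in> Cinf A" and \<nu>: "\<nu> > 0"
  shows "(L f x)\<^sup>2 / d - k / \<nu> * \<Gamma> f f x + \<rho>2 * (indicator (- degenerate) x * \<Gamma>Z f f x)
     \<le> iterated_form L \<Gamma> f x + \<nu> * iterated_form L \<Gamma>Z f x"
proof (cases "x \<in> degenerate")
  case True
  then show ?thesis
    using iterated_form_degenerate[OF True f] L_degenerate[OF True f] carre_du_champ_degenerate[OF True f f]
    by simp
next
  case False
  then show ?thesis using CD[OF f \<nu>, of x] by simp
qed

end

section \<open>Information functionals along the heat flow\<close>

locale heat_flow = symmetric_diffusion A L \<mu>
  for A :: "('m::{t2_space, second_countable_topology}, 'e::euclidean_space) atlas" and L and \<mu> +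
  fixes u :: "'m \<Rightarrow> real \<Rightarrow> real"
  assumes solution: "positive_heat_solution A L u"
begin

abbreviation log_u :: "'m \<Rightarrow> real \<Rightarrow> real" where "log_u x t \<equiv> ln (u x t)"

lemma u_pos: "t > 0 \<Longrightarrow> u x t > 0"
  using solution by (simp add: positive_heat_solution_def)

lemma u_CinfT: "u \<in> CinfT A"
  using solution by (simp add: positive_heat_solution_def CinfT_def in_chart_def comp_def case_prod_unfold)

lemma u_heat: "t > 0 \<Longrightarrow> ((\<lambda>s. u x s) has_real_derivative L (\<lambda>y. u y t) x) (at t)"
  using solution by (simp add: positive_heat_solution_def)

lemma u_Cinf: "t > 0 \<Longrightarrow> (\<lambda>x. u x t) \<in> Cinf A"
  by (rule CinfT_slice[OF u_CinfT])

lemma log_u_CinfT: "log_u \<in> CinfT A"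
  by (rule CinfT_ln[OF u_CinfT u_pos])

lemma log_u_Cinf: "t > 0 \<Longrightarrow> (\<lambda>x. log_u x t) \<in> Cinf A"
  by (rule CinfT_slice[OF log_u_CinfT])

lemma L_u: "t > 0 \<Longrightarrow> L (\<lambda>y. u y t) x = u x t * (L (\<lambda>y. log_u y t) x + \<Gamma> (\<lambda>y. log_u y t) (\<lambda>y. log_u y t) x)"
  using L_exp[OF log_u_Cinf, of t x] by (simp add: u_pos)

lemma carre_du_champ_u:
  "t > 0 \<Longrightarrow> h \<in> Cinf A \<Longrightarrow> \<Gamma> (\<lambda>y. u y t) h x = u x t * \<Gamma> (\<lambda>y. log_u y t) h x"
  using \<Gamma>.form_exp[OF log_u_Cinf, of t h x] by (simp add: u_pos)

lemma log_u_time_derivative: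
  assumes "t > 0"
  shows "((\<lambda>s. log_u x s) has_real_derivative L (\<lambda>y. log_u y t) x + \<Gamma> (\<lambda>y. log_u y t) (\<lambda>y. log_u y t) x) (at t)"
proof -
  have "((\<lambda>s. log_u x s) has_real_derivative 1 / u x t * L (\<lambda>y. u y t) x) (at t)"
    using u_heat[OF assms, of x] u_pos[OF assms, of x] by (auto intro!: derivative_eq_intros)
  then show ?thesis using u_pos[OF assms, of x] by (simp add: L_u[OF assms])
qed

lemma integral_L_combination:
  assumes "g \<in> Cinf A" "h \<in> Cinf A"
  shows "(LINT x|\<mu>. L g x + r * h x) = r * (LINT x|\<mu>. h x)"
  using integral_L[OF assms(1)] Cinf_integrable[OF L_Cinf[OF assms(1)]] Cinf_integrable[OF assms(2)]
  by simp

lemma entropy_derivative: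
  assumes t: "t > 0"
  shows "((\<lambda>s. LINT x|\<mu>. u x s * log_u x s) has_real_derivative
     - (LINT x|\<mu>. u x t * \<Gamma> (\<lambda>y. log_u y t) (\<lambda>y. log_u y t) x)) (at t)"
proof -
  define w' where "w' = (\<lambda>x t. u x t * (L (\<lambda>y. log_u y t) x + \<Gamma> (\<lambda>y. log_u y t) (\<lambda>y. log_u y t) x) + L (\<lambda>y. u y t) x * log_u x t)"
  have D: "((\<lambda>s. LINT x|\<mu>. u x s * log_u x s) has_real_derivative (LINT x|\<mu>. w' x t)) (at t)"
    unfolding w'_def
    by (rule integral_time_derivative[OF CinfT_mult[OF u_CinfT log_u_CinfT] _ t])
       (intro DERIV_mult' u_heat log_u_time_derivative)
  have "w' x t = L (\<lambda>y. u y t * log_u y t) x + (- 1) * (u x t * \<Gamma> (\<lambda>y. log_u y t) (\<lambda>y. log_u y t) x)" for x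
    unfolding w'_def L_mult carre_du_champ_u[OF t log_u_Cinf[OF t]] by (simp add: algebra_simps)
  then have "(LINT x|\<mu>. w' x t) = - 1 * (LINT x|\<mu>. u x t * \<Gamma> (\<lambda>y. log_u y t) (\<lambda>y. log_u y t) x)"
    using t by (simp only:) (intro integral_L_combination Cinf_mult u_Cinf log_u_Cinf \<Gamma>.form_Cinf)
  then show ?thesis using D by simp
qed

text \<open>
The integrand of the time derivative differs from \<open>- 2 u\<close> times the iterated form exactly by \<open>L (u G(f, f))\<close>.
The term \<open>G(f, \<Gamma>(f))\<close> coming from \<open>\<partial>\<^sub>t f = L f + \<Gamma>(f)\<close> has to be turned into \<open>\<Gamma>(f, G(f, f))\<close>, which
is part of \<open>L (u G(f, f))\<close> since \<open>u \<Gamma>(f, q) = \<Gamma>(u, q)\<close> for every \<open>q\<close>.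
\<close>

lemma form_energy_derivative:
  assumes "bilinear_form_pair A L G"
    and commute: "\<And>h x. h \<in> Cinf A \<Longrightarrow> \<Gamma> h (G h h) x = G h (\<Gamma> h h) x"
    and t: "t > 0"
  shows "((\<lambda>s. LINT x|\<mu>. u x s * G (\<lambda>y. log_u y s) (\<lambda>y. log_u y s) x) has_real_derivative
     - 2 * (LINT x|\<mu>. u x t * iterated_form L G (\<lambda>y. log_u y t) x)) (at t)"
proof -
  interpret G: bilinear_form_pair A L G by fact
  let ?f' = "\<lambda>x t. L (\<lambda>y. log_u y t) x + \<Gamma> (\<lambda>y. log_u y t) (\<lambda>y. log_u y t) x"
  define w' where "w' = (\<lambda>x t. u x t * (G (\<lambda>y. ?f' y t) (\<lambda>y. log_u y t) x + G (\<lambda>y. log_u y t) (\<lambda>y. ?f' y t) x)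
      + L (\<lambda>y. u y t) x * G (\<lambda>y. log_u y t) (\<lambda>y. log_u y t) x)"
  have D: "((\<lambda>s. LINT x|\<mu>. u x s * G (\<lambda>y. log_u y s) (\<lambda>y. log_u y s) x) has_real_derivative (LINT x|\<mu>. w' x t)) (at t)"
    unfolding w'_def
    by (rule integral_time_derivative[OF CinfT_mult[OF u_CinfT G.Z.form_CinfT[OF log_u_CinfT log_u_CinfT]] _ t])
       (intro DERIV_mult' u_heat G.Z.form_time_derivative log_u_CinfT log_u_time_derivative)
  note F = log_u_Cinf[OF t]
  have Q: "G (\<lambda>y. log_u y t) (\<lambda>y. log_u y t) \<in> Cinf A" by (rule G.Z.form_Cinf[OF F F])
  have LF: "L (\<lambda>y. log_u y t) \<in> Cinf A" and \<Gamma>F: "\<Gamma> (\<lambda>y. log_u y t) (\<lambda>y. log_u y t) \<in> Cinf A"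
    by (intro L_Cinf \<Gamma>.form_Cinf F)+
  have "w' x t = L (\<lambda>y. u y t * G (\<lambda>y. log_u y t) (\<lambda>y. log_u y t) y) x
      + (- 2) * (u x t * iterated_form L G (\<lambda>y. log_u y t) x)" for x
  proof -
    have "w' x t = 2 * u x t * (G (\<lambda>y. log_u y t) (L (\<lambda>y. log_u y t)) x + \<Gamma> (\<lambda>y. log_u y t) (G (\<lambda>y. log_u y t) (\<lambda>y. log_u y t)) x)
      + L (\<lambda>y. u y t) x * G (\<lambda>y. log_u y t) (\<lambda>y. log_u y t) x"
      unfolding w'_def G.G_commute[OF Cinf_add[OF LF \<Gamma>F] F] G.Z.form_add[OF LF \<Gamma>F F] commute[OF F]
      by simp
    then show ?thesis
      unfolding L_mult carre_du_champ_u[OF t Q] iterated_form_def by (simp add: field_simps)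
  qed
  moreover have "iterated_form L G (\<lambda>y. log_u y t) \<in> Cinf A" by (rule G.iterated_form_Cinf[OF F])
  ultimately have "(LINT x|\<mu>. w' x t) = - 2 * (LINT x|\<mu>. u x t * iterated_form L G (\<lambda>y. log_u y t) x)"
    using t by (simp only:) (intro integral_L_combination Cinf_mult u_Cinf Q)
  then show ?thesis using D by simp
qed

lemma integral_u_L_log_u:
  assumes t: "t > 0"
  shows "(LINT x|\<mu>. u x t * L (\<lambda>y. log_u y t) x) = - (LINT x|\<mu>. u x t * \<Gamma> (\<lambda>y. log_u y t) (\<lambda>y. log_u y t) x)"
proof -
  have "(LINT x|\<mu>. L (\<lambda>y. u y t) x + (- 1) * (u x t * \<Gamma> (\<lambda>y. log_u y t) (\<lambda>y. log_u y t) x))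
    = - 1 * (LINT x|\<mu>. u x t * \<Gamma> (\<lambda>y. log_u y t) (\<lambda>y. log_u y t) x)"
    by (intro integral_L_combination Cinf_mult u_Cinf log_u_Cinf \<Gamma>.form_Cinf t)
  then show ?thesis using t by (simp add: L_u algebra_simps)
qed

end

locale curvature_heat_flow = gen_curvature A L \<mu> \<Gamma>Z \<rho>1 \<rho>2 k d + heat_flow A L \<mu> u
  for A :: "('m::{t2_space, second_countable_topology}, 'e::euclidean_space) atlas"
    and L and \<mu> and \<Gamma>Z and \<rho>1 \<rho>2 k d :: real and u +
  assumes mass: "t > 0 \<Longrightarrow> (LINT x|\<mu>. u x t) = 1"
begin

definition fisher :: "real \<Rightarrow> real" where
  "fisher t = (LINT x|\<mu>. u x t * \<Gamma> (\<lambda>y. log_u y t) (\<lambda>y. log_u y t) x)"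

definition fisher_Z :: "real \<Rightarrow> real" where
  "fisher_Z t = (LINT x|\<mu>. u x t * \<Gamma>Z (\<lambda>y. log_u y t) (\<lambda>y. log_u y t) x)"

text \<open>
The values that \<open>form_energy_derivative\<close> gives for the time derivatives of the two functionals above.
\<close>

definition fisher' :: "real \<Rightarrow> real" where
  "fisher' t = - 2 * (LINT x|\<mu>. u x t * iterated_form L \<Gamma> (\<lambda>y. log_u y t) x)"

definition fisher_Z' :: "real \<Rightarrow> real" where
  "fisher_Z' t = - 2 * (LINT x|\<mu>. u x t * iterated_form L \<Gamma>Z (\<lambda>y. log_u y t) x)"

definition dissipation :: "real \<Rightarrow> real" where
  "dissipation t = (LINT x|\<mu>. u x t * (L (\<lambda>y. log_u y t) x)\<^sup>2)"

definition fisher_Z_degenerate :: "real \<Rightarrow> real" where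
  "fisher_Z_degenerate t = (LINT x|\<mu>. indicator degenerate x * (u x t * \<Gamma>Z (\<lambda>y. log_u y t) (\<lambda>y. log_u y t) x))"

lemma fisher_derivative: "t > 0 \<Longrightarrow> (fisher has_real_derivative fisher' t) (at t)"
  unfolding fisher_def[abs_def] fisher'_def
  by (rule form_energy_derivative[OF \<Gamma>.bilinear_form_pair_axioms]) (auto simp: carre_du_champ_commute)

lemma fisher_Z_derivative: "t > 0 \<Longrightarrow> (fisher_Z has_real_derivative fisher_Z' t) (at t)"
  unfolding fisher_Z_def[abs_def] fisher_Z'_def
  by (rule form_energy_derivative[OF Z.bilinear_form_pair_axioms commute])

lemma u_constant_degenerate:
  assumes x: "x \<in> degenerate" and "s > 0" "t > 0" shows "u x s = u x t"
proof -
  have "\<exists>c. \<forall>s\<in>{0<..}. u x s = c"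
  proof (rule has_field_derivative_zero_constant)
    show "((\<lambda>s. u x s) has_field_derivative 0) (at s within {0<..})" if "s \<in> {0<..}" for s
      using u_heat[of s x] that L_degenerate[OF x u_Cinf, of s]
      by (simp add: has_field_derivative_at_within)
  qed simp
  then show ?thesis using assms by auto
qed

text \<open>
Since \<open>L\<close> is trivial on the degenerate set, \<open>u\<close> does not move there, and neither does \<open>\<Gamma>\<^sup>Z(ln u)\<close> because the
set is open and the form is local.
\<close>

lemma fisher_Z_degenerate_constant:
  assumes "s > 0" "t > 0" shows "fisher_Z_degenerate s = fisher_Z_degenerate t"
proof -
  have "indicator degenerate x * (u x s * \<Gamma>Z (\<lambda>y. log_u y s) (\<lambda>y. log_u y s) x)
      = indicator degenerate x * (u x t * \<Gamma>Z (\<lambda>y. log_u y t) (\<lambda>y. log_u y t) x)" for x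
  proof (cases "x \<in> degenerate")
    case True
    have "\<Gamma>Z (\<lambda>y. log_u y s) (\<lambda>y. log_u y s) x = \<Gamma>Z (\<lambda>y. log_u y t) (\<lambda>y. log_u y t) x"
      by (rule Z.Z.form_local[OF log_u_Cinf log_u_Cinf log_u_Cinf log_u_Cinf open_degenerate True])
         (use assms u_constant_degenerate[OF _ assms] in auto)
    then show ?thesis using u_constant_degenerate[OF True assms] by simp
  qed simp
  then show ?thesis unfolding fisher_Z_degenerate_def by (simp only:)
qed

lemma degenerate_sets: "degenerate \<in> sets \<mu>"
  using open_degenerate sets_eq_borel by auto

lemma fisher_Z_degenerate_nonpos:
  assumes "t > 0" shows "fisher_Z_degenerate t \<le> 0"
proof -
  have "0 \<le> - (indicator degenerate x * (u x t * \<Gamma>Z (\<lambda>y. log_u y t) (\<lambda>y. log_u y t) x))" for x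
    using Z_nonpos_degenerate[OF _ log_u_Cinf[OF assms], of x] u_pos[OF assms, of x]
    by (cases "x \<in> degenerate") (auto simp: mult_le_0_iff)
  then have "0 \<le> (LINT x|\<mu>. - (indicator degenerate x * (u x t * \<Gamma>Z (\<lambda>y. log_u y t) (\<lambda>y. log_u y t) x)))"
    by (intro integral_nonneg_AE AE_I2)
  then show ?thesis by (simp add: fisher_Z_degenerate_def)
qed

lemma fisher_Z_split:
  assumes t: "t > 0"
  shows "fisher_Z t - fisher_Z_degenerate t
    = (LINT x|\<mu>. u x t * (indicator (- degenerate) x * \<Gamma>Z (\<lambda>y. log_u y t) (\<lambda>y. log_u y t) x))"
    and "integrable \<mu> (\<lambda>x. u x t * (indicator (- degenerate) x * \<Gamma>Z (\<lambda>y. log_u y t) (\<lambda>y. log_u y t) x))"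
proof -
  let ?q = "\<lambda>x. u x t * \<Gamma>Z (\<lambda>y. log_u y t) (\<lambda>y. log_u y t) x"
  have q: "integrable \<mu> ?q"
    by (intro Cinf_integrable Cinf_mult u_Cinf Z.Z.form_Cinf log_u_Cinf t)
  have iq: "integrable \<mu> (\<lambda>x. indicator degenerate x * ?q x)"
    using integrable_mult_indicator[OF degenerate_sets q] by simp
  have e: "?q x - indicator degenerate x * ?q x
      = u x t * (indicator (- degenerate) x * \<Gamma>Z (\<lambda>y. log_u y t) (\<lambda>y. log_u y t) x)" for x
    by (simp add: indicator_def)
  show "fisher_Z t - fisher_Z_degenerate t
    = (LINT x|\<mu>. u x t * (indicator (- degenerate) x * \<Gamma>Z (\<lambda>y. log_u y t) (\<lambda>y. log_u y t) x))"
    unfolding fisher_Z_def fisher_Z_degenerate_def e[symmetric] by (simp only: Bochner_Integration.integral_diff[OF q iq])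
  show "integrable \<mu> (\<lambda>x. u x t * (indicator (- degenerate) x * \<Gamma>Z (\<lambda>y. log_u y t) (\<lambda>y. log_u y t) x))"
    using Bochner_Integration.integrable_diff[OF q iq] unfolding e .
qed

lemma fisher_Z_nondegenerate_nonneg:
  assumes t: "t > 0" shows "0 \<le> fisher_Z t - fisher_Z_degenerate t"
proof -
  have "0 \<le> u x t * (indicator (- degenerate) x * \<Gamma>Z (\<lambda>y. log_u y t) (\<lambda>y. log_u y t) x)" for x
    using Z_nonneg_nondegenerate[OF log_u_Cinf[OF t], of x] u_pos[OF t, of x]
    by (cases "x \<in> degenerate") auto
  then show ?thesis unfolding fisher_Z_split(1)[OF t] by (intro integral_nonneg_AE AE_I2)
qed

text \<open>
The integrated curvature-dimension inequality, with the degenerate part of \<open>B\<close> removed.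
\<close>

lemma fisher_differential_inequality:
  assumes t: "t > 0" and \<nu>: "\<nu> > 0"
  shows "fisher' t + \<nu> * fisher_Z' t
    \<le> - (2 / d) * dissipation t + 2 * k / \<nu> * fisher t - 2 * \<rho>2 * (fisher_Z t - fisher_Z_degenerate t)"
proof -
  let ?f = "\<lambda>y. log_u y t"
  note F = log_u_Cinf[OF t]
  have i1: "integrable \<mu> (\<lambda>x. u x t * (L ?f x)\<^sup>2)"
    unfolding power2_eq_square by (intro Cinf_integrable Cinf_mult u_Cinf L_Cinf F t)
  have i2: "integrable \<mu> (\<lambda>x. u x t * \<Gamma> ?f ?f x)"
    by (intro Cinf_integrable Cinf_mult u_Cinf \<Gamma>.form_Cinf F t)
  note i3 = fisher_Z_split(2)[OF t]
  have i4: "integrable \<mu> (\<lambda>x. u x t * iterated_form L \<Gamma> ?f x)"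
    by (intro Cinf_integrable Cinf_mult u_Cinf \<Gamma>.iterated_form_Cinf F t)
  have i5: "integrable \<mu> (\<lambda>x. u x t * iterated_form L \<Gamma>Z ?f x)"
    by (intro Cinf_integrable Cinf_mult u_Cinf Z.iterated_form_Cinf F t)
  have "(LINT x|\<mu>. 1 / d * (u x t * (L ?f x)\<^sup>2) - k / \<nu> * (u x t * \<Gamma> ?f ?f x)
        + \<rho>2 * (u x t * (indicator (- degenerate) x * \<Gamma>Z ?f ?f x)))
    \<le> (LINT x|\<mu>. u x t * iterated_form L \<Gamma> ?f x + \<nu> * (u x t * iterated_form L \<Gamma>Z ?f x))"
  proof (rule integral_mono)
    show "1 / d * (u x t * (L ?f x)\<^sup>2) - k / \<nu> * (u x t * \<Gamma> ?f ?f x)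
        + \<rho>2 * (u x t * (indicator (- degenerate) x * \<Gamma>Z ?f ?f x))
      \<le> u x t * iterated_form L \<Gamma> ?f x + \<nu> * (u x t * iterated_form L \<Gamma>Z ?f x)" for x
      using mult_left_mono[OF CD_nondegenerate[OF F \<nu>, of x] less_imp_le[OF u_pos[OF t, of x]]]
      by (simp add: algebra_simps)
  qed (intro Bochner_Integration.integrable_add Bochner_Integration.integrable_diff integrable_mult_right i1 i2 i3 i4 i5)+
  then have "1 / d * dissipation t - k / \<nu> * fisher t + \<rho>2 * (fisher_Z t - fisher_Z_degenerate t)
    \<le> (LINT x|\<mu>. u x t * iterated_form L \<Gamma> ?f x) + \<nu> * (LINT x|\<mu>. u x t * iterated_form L \<Gamma>Z ?f x)"
    unfolding dissipation_def fisher_def fisher_Z_split(1)[OF t]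
    using i1 i2 i3 i4 i5 by simp
  moreover have "- (2 / d) * dissipation t = - 2 * (1 / d * dissipation t)"
    "2 * k / \<nu> * fisher t = 2 * (k / \<nu> * fisher t)"
    "2 * \<rho>2 * (fisher_Z t - fisher_Z_degenerate t) = 2 * (\<rho>2 * (fisher_Z t - fisher_Z_degenerate t))"
    "\<nu> * fisher_Z' t = - 2 * (\<nu> * (LINT x|\<mu>. u x t * iterated_form L \<Gamma>Z ?f x))"
    by (simp_all add: fisher_Z'_def)
  ultimately show ?thesis unfolding fisher'_def by linarith
qed

text \<open>
The Cauchy-Schwarz inequality for the probability density \<open>u\<close>, written as
\<open>\<integral> u (L f + A)\<^sup>2 \<ge> 0\<close> with \<open>A = - \<integral> u L f\<close>.
\<close>

lemma fisher_sq_le_dissipation: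
  assumes t: "t > 0" shows "(fisher t)\<^sup>2 \<le> dissipation t"
proof -
  let ?f = "\<lambda>y. log_u y t" and ?a = "fisher t"
  note F = log_u_Cinf[OF t]
  have i1: "integrable \<mu> (\<lambda>x. u x t * (L ?f x)\<^sup>2)"
    unfolding power2_eq_square by (intro Cinf_integrable Cinf_mult u_Cinf L_Cinf F t)
  have i2: "integrable \<mu> (\<lambda>x. u x t * L ?f x)"
    by (intro Cinf_integrable Cinf_mult u_Cinf L_Cinf F t)
  have i3: "integrable \<mu> (\<lambda>x. u x t)"
    by (intro Cinf_integrable u_Cinf t)
  have "0 \<le> (LINT x|\<mu>. u x t * (L ?f x + ?a)\<^sup>2)"
    using u_pos[OF t] by (intro integral_nonneg_AE AE_I2 mult_nonneg_nonneg) (auto intro: less_imp_le)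
  also have "\<dots> = (LINT x|\<mu>. u x t * (L ?f x)\<^sup>2 + 2 * ?a * (u x t * L ?f x) + ?a\<^sup>2 * u x t)"
    by (intro Bochner_Integration.integral_cong) (auto simp: power2_eq_square algebra_simps)
  also have "\<dots> = dissipation t + 2 * ?a * (LINT x|\<mu>. u x t * L ?f x) + ?a\<^sup>2 * (LINT x|\<mu>. u x t)"
    unfolding dissipation_def using i1 i2 i3 by simp
  also have "\<dots> = dissipation t - ?a\<^sup>2"
    using integral_u_L_log_u[OF t] mass[OF t] by (simp add: fisher_def power2_eq_square)
  finally show ?thesis by simp
qed

text \<open>
The integrated Li-Yau estimate. The weights vanish at the starting time \<open>e\<close>, so the
values of the functionals there drop out.
\<close>

lemma fisher_estimate_from:
  assumes e: "0 < e" "e < t" and \<kappa>: "\<kappa> = 2 / 3 * \<rho>2" and D: "D = d * (1 + 3 * k / (2 * \<rho>2))\<^sup>2"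
  shows "fisher t + \<kappa> * (t - e) * (fisher_Z t - fisher_Z_degenerate t) \<le> D / (2 * (t - e))"
proof -
  define b where "b = fisher_Z_degenerate t"
  have b: "fisher_Z_degenerate s = b" if "s > 0" for s
    unfolding b_def by (rule fisher_Z_degenerate_constant) (use that e in auto)
  define H where "H s = (s - e)\<^sup>2 * fisher s + \<kappa> * (s - e) ^ 3 * (fisher_Z s - b) - D / 2 * (s - e)" for s
  define H' where "H' s = (s - e)\<^sup>2 * fisher' s + 2 * (s - e) * fisher s
     + (\<kappa> * (s - e) ^ 3 * fisher_Z' s + 3 * \<kappa> * (s - e)\<^sup>2 * (fisher_Z s - b)) - D / 2" for s
  have k\<kappa>: "k / \<kappa> = 3 * k / (2 * \<rho>2)" "\<kappa> > 0" using \<rho>2 by (auto simp: \<kappa> field_simps)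
  have DH: "(H has_real_derivative H' s) (at s)" if "e \<le> s" for s
    unfolding H_def[abs_def] H'_def using that e
    by (auto intro!: derivative_eq_intros fisher_derivative fisher_Z_derivative
        simp: power2_eq_square power3_eq_cube algebra_simps)
  have "H' s \<le> 0" if s: "e \<le> s" for s
  proof (cases "s = e")
    case True
    then show ?thesis using d by (simp add: H'_def D)
  next
    case False
    \<comment> \<open>with \<open>\<nu> = \<kappa> r\<close> the derivative of the weight \<open>\<kappa> r\<^sup>3\<close> cancels the term in \<open>\<rho>2\<close>\<close>
    define r where "r = s - e"
    have r: "r > 0" using False s by (simp add: r_def)
    have s0: "s > 0" using s e by simp
    have "\<kappa> * r > 0" using k\<kappa> r by simp
    from fisher_differential_inequality[OF s0 this]
    have "fisher' s + \<kappa> * r * fisher_Z' s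
      \<le> - (2 / d) * (fisher s)\<^sup>2 + 2 * k / (\<kappa> * r) * fisher s - 2 * \<rho>2 * (fisher_Z s - b)"
      using mult_left_mono[OF fisher_sq_le_dissipation[OF s0], of "2 / d"] d b[OF s0] by simp
    from mult_left_mono[OF this, of "r\<^sup>2"]
    have "r\<^sup>2 * (fisher' s + \<kappa> * r * fisher_Z' s)
      \<le> r\<^sup>2 * (- (2 / d) * (fisher s)\<^sup>2 + 2 * k / (\<kappa> * r) * fisher s - 2 * \<rho>2 * (fisher_Z s - b))"
      by simp
    also have "\<dots> = - (2 / d) * (r * fisher s)\<^sup>2 + 2 * (k / \<kappa>) * (r * fisher s) - 3 * \<kappa> * r\<^sup>2 * (fisher_Z s - b)"
      using r k\<kappa>(2) unfolding \<kappa> by (simp add: field_simps power2_eq_square)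
    finally have "H' s \<le> - (2 / d) * (r * fisher s)\<^sup>2 + 2 * (1 + k / \<kappa>) * (r * fisher s) - D / 2"
      unfolding H'_def r_def[symmetric] by (simp add: algebra_simps power2_eq_square power3_eq_cube)
    \<comment> \<open>completing the square, which is where the value of \<open>D\<close> comes from\<close>
    also have "\<dots> = - (2 / d) * (r * fisher s - d * (1 + k / \<kappa>) / 2)\<^sup>2"
      unfolding D k\<kappa>(1)[symmetric] using d by (simp add: field_simps power2_eq_square)
    also have "\<dots> \<le> 0" using d by simp
    finally show ?thesis .
  qed
  then have "H t \<le> H e"
    using DERIV_nonpos_imp_nonincreasing[of e t H] DH e by force
  then have le: "(t - e)\<^sup>2 * fisher t + \<kappa> * (t - e) ^ 3 * (fisher_Z t - b) \<le> D / 2 * (t - e)"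
    by (simp add: H_def)
  define r where "r = t - e"
  have r: "r > 0" using e by (simp add: r_def)
  have "r * (r * (fisher t + \<kappa> * r * (fisher_Z t - b))) \<le> r * (D / 2)"
    using le unfolding r_def[symmetric] by (simp add: power2_eq_square power3_eq_cube algebra_simps)
  then have "r * (fisher t + \<kappa> * r * (fisher_Z t - b)) \<le> D / 2"
    using r by (simp only: mult_le_cancel_left_pos)
  then have "fisher t + \<kappa> * r * (fisher_Z t - b) \<le> D / (2 * r)"
    using r by (simp add: pos_le_divide_eq mult.commute)
  then show ?thesis unfolding b_def r_def .
qed

text \<open>
The starting time tends to \<open>0\<close> while the constant \<open>D\<close> stays the same.
\<close>

lemma fisher_estimate:
  assumes t: "0 < t" and \<kappa>: "\<kappa> = 2 / 3 * \<rho>2" and D: "D = d * (1 + 3 * k / (2 * \<rho>2))\<^sup>2"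
  shows "fisher t + \<kappa> * t * (fisher_Z t - fisher_Z_degenerate t) \<le> D / (2 * t)"
proof -
  let ?b = "fisher_Z t - fisher_Z_degenerate t"
  have l1: "((\<lambda>e. fisher t + \<kappa> * (t - e) * ?b) \<longlongrightarrow> fisher t + \<kappa> * (t - 0) * ?b) (at_right 0)"
    by (intro tendsto_intros)
  have l2: "((\<lambda>e. D / (2 * (t - e))) \<longlongrightarrow> D / (2 * (t - 0))) (at_right 0)"
    using t by (intro tendsto_intros) auto
  have "\<forall>\<^sub>F e in at_right 0. fisher t + \<kappa> * (t - e) * ?b \<le> D / (2 * (t - e))"
    using t fisher_estimate_from[OF _ _ \<kappa> D] by (auto simp: eventually_at_right)
  from tendsto_le[OF _ l2 l1 this] show ?thesis by simp
qed

text \<open>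
The potential differs from \<open>- ln u\<close> by a constant in space, which \<open>\<Gamma>\<close> does not see and which
integrates to itself because the mass is one.
\<close>

lemma W_entropy_Z_eq:
  assumes t: "t > 0"
  shows "W_entropy_Z \<mu> L \<Gamma>Z \<sigma> \<alpha> (\<lambda>x. u x t) t
    = t * fisher t - (LINT x|\<mu>. u x t * log_u x t) - (\<alpha> / 2 * ln (4 * pi * t) + \<alpha>) + \<sigma> * t\<^sup>2 * fisher_Z t"
proof -
  let ?f = "\<lambda>y. log_u y t"
  note F = log_u_Cinf[OF t]
  define c where "c = \<alpha> / 2 * ln (4 * pi * t)"
  have u0: "u x t \<noteq> 0" for x using u_pos[OF t, of x] by simp
  have g: "potential \<alpha> t (\<lambda>x. u x t) = (\<lambda>x. - 1 * log_u x t - c)"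
    using t u0 by (auto simp: potential_def c_def fun_eq_iff ln_mult ln_powr)
  have mF: "(\<lambda>y. - 1 * log_u y t) \<in> Cinf A" by (intro Cinf_mult Cinf_const F)
  have gC: "(\<lambda>y. - 1 * log_u y t - c) \<in> Cinf A" by (intro Cinf_diff Cinf_const mF)
  have \<Gamma>g: "\<Gamma> (\<lambda>y. - 1 * log_u y t - c) (\<lambda>y. - 1 * log_u y t - c) x = \<Gamma> ?f ?f x" for x
    using \<Gamma>.G_diff_const[OF mF gC, of c x] \<Gamma>.G_diff_const[OF mF mF, of c x]
      \<Gamma>.form_scale[OF F mF, of "- 1" x] \<Gamma>.form_scale[OF F F, of "- 1" x]
      carre_du_champ_commute[of "\<lambda>y. - 1 * log_u y t" "\<lambda>y. - 1 * log_u y t - c" x]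
      carre_du_champ_commute[of "\<lambda>y. log_u y t" "\<lambda>y. - 1 * log_u y t" x]
    by simp
  have i1: "integrable \<mu> (\<lambda>x. u x t * \<Gamma> ?f ?f x)"
    by (intro Cinf_integrable Cinf_mult u_Cinf \<Gamma>.form_Cinf F t)
  have i2: "integrable \<mu> (\<lambda>x. u x t * log_u x t)"
    by (intro Cinf_integrable Cinf_mult u_Cinf F t)
  have i3: "integrable \<mu> (\<lambda>x. u x t)"
    by (intro Cinf_integrable u_Cinf t)
  have "W_entropy \<mu> L \<alpha> (\<lambda>x. u x t) t
      = (LINT x|\<mu>. t * (u x t * \<Gamma> ?f ?f x) - u x t * log_u x t - (c + \<alpha>) * u x t)"
    unfolding W_entropy_def Let_def g \<Gamma>g
    by (intro Bochner_Integration.integral_cong) (auto simp: algebra_simps)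
  also have "\<dots> = t * fisher t - (LINT x|\<mu>. u x t * log_u x t) - (c + \<alpha>) * (LINT x|\<mu>. u x t)"
    unfolding fisher_def using i1 i2 i3 by simp
  finally show ?thesis
    using mass[OF t] by (simp add: W_entropy_Z_def fisher_Z_def c_def)
qed

lemma W_entropy_Z_derivative:
  assumes t: "t > 0"
  shows "((\<lambda>s. W_entropy_Z \<mu> L \<Gamma>Z \<sigma> \<alpha> (\<lambda>x. u x s) s) has_real_derivative
    2 * fisher t + t * fisher' t - \<alpha> / (2 * t) + 2 * \<sigma> * t * fisher_Z t + \<sigma> * t\<^sup>2 * fisher_Z' t) (at t)"
proof (rule has_field_derivative_transform_within_open)
  show "open {0::real<..}" "t \<in> {0<..}" using t by auto
  show "((\<lambda>t. t * fisher t - (LINT x|\<mu>. u x t * log_u x t) - (\<alpha> / 2 * ln (4 * pi * t) + \<alpha>) + \<sigma> * t\<^sup>2 * fisher_Z t)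
     has_real_derivative
    2 * fisher t + t * fisher' t - \<alpha> / (2 * t) + 2 * \<sigma> * t * fisher_Z t + \<sigma> * t\<^sup>2 * fisher_Z' t) (at t)"
    using t entropy_derivative[OF t] unfolding fisher_def[symmetric]
    by (auto intro!: derivative_eq_intros fisher_derivative fisher_Z_derivative
        simp: field_simps power2_eq_square)
qed (simp add: W_entropy_Z_eq)

text \<open>
The first left hand side is the derivative computed in \<open>W_entropy_Z_derivative\<close>. The
curvature-dimension inequality is used with \<open>\<nu> = \<sigma> t\<close>, the coefficient that \<open>\<Gamma>\<^sub>2\<^sup>Z\<close> has relative to
\<open>\<Gamma>\<^sub>2\<close> in it, and the remaining first order terms are absorbed by the integrated Li-Yau estimate.
\<close>

theorem W_entropy_Z_monotone:
  assumes t: "t > 0" and D: "D = d * (1 + 3 * k / (2 * \<rho>2))\<^sup>2"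
    and \<sigma>: "\<rho>2 \<le> \<sigma>" "\<sigma> \<le> 5 / 3 * \<rho>2" and \<tau>: "\<tau> \<ge> 2 + 2 * k / \<rho>2"
  shows "2 * fisher t + t * fisher' t - \<tau> * D / (2 * t) + 2 * \<sigma> * t * fisher_Z t + \<sigma> * t\<^sup>2 * fisher_Z' t
     \<le> - (2 * t / d) * dissipation t + D / (2 * t) * (2 * (k + \<sigma>) / \<sigma> - \<tau>)"
    and "- (2 * t / d) * dissipation t + D / (2 * t) * (2 * (k + \<sigma>) / \<sigma> - \<tau>) \<le> 0"
proof -
  have \<sigma>0: "\<sigma> > 0" using \<sigma> \<rho>2 by simp
  define z where "z = fisher_Z t - fisher_Z_degenerate t"
  have z: "0 \<le> z" "fisher_Z t \<le> z"
    using fisher_Z_nondegenerate_nonneg[OF t] fisher_Z_degenerate_nonpos[OF t] by (auto simp: z_def)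
  define c where "c = 2 * (1 + k / \<sigma>)"
  have c: "c = 2 * (k + \<sigma>) / \<sigma>" "c \<ge> 2" using \<sigma>0 k by (auto simp: c_def field_simps)
  have "\<sigma> * t > 0" using \<sigma>0 t by simp
  from mult_left_mono[OF fisher_differential_inequality[OF t this], of t]
  have "t * fisher' t + \<sigma> * t\<^sup>2 * fisher_Z' t
    \<le> t * (- (2 / d) * dissipation t + 2 * k / (\<sigma> * t) * fisher t - 2 * \<rho>2 * z)"
    using t by (simp add: z_def power2_eq_square algebra_simps)
  also have "\<dots> = - (2 * t / d) * dissipation t + 2 * k / \<sigma> * fisher t - 2 * t * \<rho>2 * z"
    using t \<sigma>0 by (simp add: field_simps)
  finally have 1: "t * fisher' t + \<sigma> * t\<^sup>2 * fisher_Z' t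
    \<le> - (2 * t / d) * dissipation t + 2 * k / \<sigma> * fisher t - 2 * t * \<rho>2 * z" .
  have 2: "2 * \<sigma> * t * fisher_Z t \<le> 2 * \<sigma> * t * z"
    using z t \<sigma>0 by (intro mult_left_mono) auto
  \<comment> \<open>this is where the upper bound on \<open>\<sigma>\<close> is used\<close>
  have "2 * (\<sigma> - \<rho>2) \<le> c * (2 / 3 * \<rho>2)"
  proof -
    have "2 * (\<sigma> - \<rho>2) \<le> 2 * (2 / 3 * \<rho>2)" using \<sigma> by simp
    also have "\<dots> \<le> c * (2 / 3 * \<rho>2)" using c(2) \<rho>2 by (intro mult_right_mono) auto
    finally show ?thesis .
  qed
  then have "2 * (\<sigma> - \<rho>2) * (t * z) \<le> c * (2 / 3 * \<rho>2) * (t * z)"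
    using t z by (intro mult_right_mono) auto
  moreover have "c * (fisher t + 2 / 3 * \<rho>2 * t * z) \<le> c * (D / (2 * t))"
    using fisher_estimate[OF t refl D] c(2) unfolding z_def by (intro mult_left_mono) auto
  ultimately have 3: "c * fisher t + 2 * (\<sigma> - \<rho>2) * (t * z) \<le> c * (D / (2 * t))"
    by (simp add: algebra_simps)
  have "D / (2 * t) * (2 * (k + \<sigma>) / \<sigma> - \<tau>) = c * (D / (2 * t)) - \<tau> * D / (2 * t)"
    unfolding c(1)[symmetric] by (simp add: diff_divide_distrib algebra_simps)
  moreover have "c * fisher t = 2 * fisher t + 2 * k / \<sigma> * fisher t"
    by (simp add: c_def algebra_simps)
  moreover have "2 * (\<sigma> - \<rho>2) * (t * z) = 2 * \<sigma> * t * z - 2 * t * \<rho>2 * z"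
    by (simp add: algebra_simps)
  ultimately show "2 * fisher t + t * fisher' t - \<tau> * D / (2 * t) + 2 * \<sigma> * t * fisher_Z t + \<sigma> * t\<^sup>2 * fisher_Z' t
     \<le> - (2 * t / d) * dissipation t + D / (2 * t) * (2 * (k + \<sigma>) / \<sigma> - \<tau>)"
    using 1 2 3 by linarith
  have "0 \<le> dissipation t" using fisher_sq_le_dissipation[OF t] by (meson order_trans zero_le_power2)
  then have "0 \<le> 2 * t / d * dissipation t" using t d by simp
  moreover have "k / \<sigma> \<le> k / \<rho>2" using \<sigma> \<rho>2 k by (intro divide_left_mono) auto
  then have "2 * (k + \<sigma>) / \<sigma> - \<tau> \<le> 0" using \<tau> unfolding c(1)[symmetric] c_def by simp
  then have "D / (2 * t) * (2 * (k + \<sigma>) / \<sigma> - \<tau>) \<le> 0"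
    using t d by (intro mult_nonneg_nonpos) (auto simp: D)
  ultimately show "- (2 * t / d) * dissipation t + D / (2 * t) * (2 * (k + \<sigma>) / \<sigma> - \<tau>) \<le> 0" by simp
qed

end

theorem theorem5p3:
  fixes A :: "('m::{t2_space, second_countable_topology}, 'e::euclidean_space) atlas"
    and \<mu> :: "'m measure"
    and L :: "('m \<Rightarrow> real) \<Rightarrow> 'm \<Rightarrow> real"
    and \<Gamma>Z :: "('m \<Rightarrow> real) \<Rightarrow> ('m \<Rightarrow> real) \<Rightarrow> 'm \<Rightarrow> real"
    and u :: "'m \<Rightarrow> real \<Rightarrow> real"
    and \<rho>1 \<rho>2 k d D \<tau> \<sigma> :: real
  assumes "smooth_atlas A" and "compact (UNIV :: 'm set)" and "connected (UNIV :: 'm set)"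
    and "smooth_measure A \<mu>" and "prob_space \<mu>"
    and "diffusion_operator A L" and "locally_subelliptic A \<mu> L"
    and "local_sum_of_squares A \<mu> L"
    and "\<forall>x. L (\<lambda>_. 1) x = 0"
    and "\<forall>f\<in>Cinf A. \<forall>h\<in>Cinf A. (LINT x|\<mu>. f x * L h x) = (LINT x|\<mu>. h x * L f x)"
    and "\<forall>f\<in>Cinf A. (LINT x|\<mu>. f x * L f x) \<le> 0"
    and "smooth_bilinear_form A \<Gamma>Z"
    and "\<forall>f\<in>Cinf A. \<forall>h\<in>Cinf A. \<forall>x. \<Gamma>Z f h x = \<Gamma>Z h f x"
    and "\<forall>f\<in>Cinf A. \<forall>g\<in>Cinf A. \<forall>h\<in>Cinf A. \<forall>x.
           \<Gamma>Z (\<lambda>y. f y * g y) h x = f x * \<Gamma>Z g h x + g x * \<Gamma>Z f h x"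
    and "\<forall>f\<in>Cinf A. \<forall>x.
           carre_du_champ L f (\<Gamma>Z f f) x = \<Gamma>Z f (carre_du_champ L f f) x"
    and "\<rho>1 \<ge> 0" and "\<rho>2 > 0" and "k \<ge> 0" and "d > 0"
    and "gen_CD A L \<Gamma>Z \<rho>1 \<rho>2 k d"
    and "positive_heat_solution A L u"
    and "\<forall>t\<ge>0. (LINT x|\<mu>. u x t) = 1"
    and "\<rho>2 \<le> \<sigma>" and "\<sigma> \<le> 5 / 3 * \<rho>2" and "\<tau> \<ge> 2 + 2 * k / \<rho>2"
    and "D = d * (1 + 3 * k / (2 * \<rho>2))\<^sup>2"
  shows "\<forall>t>0. \<exists>W'.
           ((\<lambda>s. W_entropy_Z \<mu> L \<Gamma>Z \<sigma> (\<tau> * D) (\<lambda>x. u x s) s) has_real_derivative W') (at t) \<and>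
           W' \<le> - (2 * t / d) * (LINT x|\<mu>. u x t * (L (\<lambda>y. ln (u y t)) x)\<^sup>2)
                 + D / (2 * t) * (2 * (k + \<sigma>) / \<sigma> - \<tau>) \<and>
           - (2 * t / d) * (LINT x|\<mu>. u x t * (L (\<lambda>y. ln (u y t)) x)\<^sup>2)
                 + D / (2 * t) * (2 * (k + \<sigma>) / \<sigma> - \<tau>) \<le> 0"
proof -
  interpret prob_space \<mu> by (rule assms(5))
  interpret symmetric_diffusion A L \<mu>
  proof unfold_locales
    show "(LINT x|\<mu>. f x * L h x) = (LINT x|\<mu>. h x * L f x)" if "f \<in> Cinf A" "h \<in> Cinf A" for f h
      using assms(10) that by blast
  qed (use assms(1,2,4,6,9) in blast)+
  interpret bilinear_form_pair A L \<Gamma>Z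
    by unfold_locales (use assms(12,13) in blast)+
  interpret curvature_heat_flow A L \<mu> \<Gamma>Z \<rho>1 \<rho>2 k d u
  proof unfold_locales
    show "(LINT x|\<mu>. u x t) = 1" if "t > 0" for t using assms(22) that by simp
  qed (use assms(15-21) in blast)+
  show ?thesis
  proof (intro allI impI)
    fix t :: real assume t: "t > 0"
    note \<sigma>\<tau> = \<open>\<rho>2 \<le> \<sigma>\<close> \<open>\<sigma> \<le> 5 / 3 * \<rho>2\<close> \<open>\<tau> \<ge> 2 + 2 * k / \<rho>2\<close>
    note D = \<open>D = d * (1 + 3 * k / (2 * \<rho>2))\<^sup>2\<close>
    show "\<exists>W'.
           ((\<lambda>s. W_entropy_Z \<mu> L \<Gamma>Z \<sigma> (\<tau> * D) (\<lambda>x. u x s) s) has_real_derivative W') (at t) \<and>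
           W' \<le> - (2 * t / d) * (LINT x|\<mu>. u x t * (L (\<lambda>y. ln (u y t)) x)\<^sup>2)
                 + D / (2 * t) * (2 * (k + \<sigma>) / \<sigma> - \<tau>) \<and>
           - (2 * t / d) * (LINT x|\<mu>. u x t * (L (\<lambda>y. ln (u y t)) x)\<^sup>2)
                 + D / (2 * t) * (2 * (k + \<sigma>) / \<sigma> - \<tau>) \<le> 0"
      using W_entropy_Z_derivative[OF t, of \<sigma> "\<tau> * D"] W_entropy_Z_monotone[OF t D \<sigma>\<tau>]
      unfolding dissipation_def by (intro exI conjI)
  qed
qed

end
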